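(* Let $1\le p<\infty$, let $M\in L^{p}(\mathbb{T}^{2})$, and let $\Omega=\mathbb{Z}^2\setminus(\{0\}\times\mathbb{Z})$. Then the system $\{M(x,y)e^{ikx}e^{imy}:(k,m)\in\Omega\}$ is complete and minimal in $L^{p}(\mathbb{T}^{2})$ if and only if $M$ has a strong $(x,P)$-singularity of degree $p$ for some $P\in\Upsilon$ with $|P(y)|=1$ for a.e. $y\in\mathbb{T}$.
   Context: $\mathbb{T}=\mathbb{R}/2\pi\mathbb{Z}$ with Lebesgue measure; functions are complex valued; $p'$ is the conjugate exponent, $\frac1p+\frac1{p'}=1$. A system in a Banach space is complete if its closed linear span is the whole space, and minimal if no element lies in the closed linear span of the others. $\Upsilon$ is the class of functions $\phi\in L^{\infty}(\mathbb{T})$ with $\frac1\phi\in L^{\infty}(\mathbb{T})$. $M\in L^p(\mathbb{T}^2)$ has a strong $x$-singularity of degree $p$ if $M^{-1}\notin L^{p'}(\mathbb{T}\times E)$ for every measurable $E\subset\mathbb{T}$ with $|E|>0$ (here $x\in\mathbb{T}$, $y\in E$). $M\in L^p(\mathbb{T}^2)$ has an $(x,P)$-singularity of degree $p$, where $P\in\Upsilon$, if $M^{-1}\notin L^{p'}(\mathbb{T}^2)$ and $$\int_{\mathbb{T}^{2}}\frac{|e^{ix}-P(y)|^{p'}}{|M(x,y)|^{p'}}\,dx\,dy<+\infty .$$ $M$ has a strong $(x,P)$-singularity of degree $p$ if it has a strong $x$-singularity of degree $p$ and an $(x,P)$-singularity of degree $p$. Convention: $1/0=+\infty$. When $p=1$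 (so $p'=\infty$), the integral condition is read as $(e^{ix}-P(y))/M(x,y)\in L^\infty(\mathbb{T}^2)$. *)

theory Defs
  imports "HOL-Analysis.Analysis" "HOL-Probability.Essential_Supremum"
begin

section \<open>Lebesgue spaces\<close>

definition ennreal_powr :: "ennreal \<Rightarrow> real \<Rightarrow> ennreal" where
  "ennreal_powr x q = (if x = \<infinity> then \<infinity> else ennreal (enn2real x powr q))"

text \<open>The norm is defined for functions with values in \<^typ>\<open>ennreal\<close>, so that it applies
  both to moduli of complex functions and to reciprocals \<open>1 / \<bar>f\<bar>\<close> under the convention
  \<open>1 / 0 = \<infinity>\<close>, which is the one of \<^typ>\<open>ennreal\<close> (but not of \<^typ>\<open>complex\<close>).
  It is meant for measurable functions and exponents in \<open>[1, \<infinity>]\<close>.\<close>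

definition Lp_norm :: "'a measure \<Rightarrow> ennreal \<Rightarrow> ('a \<Rightarrow> ennreal) \<Rightarrow> ennreal" where
  "Lp_norm \<mu> p g =
     (if p = \<infinity> then esssup \<mu> g
      else ennreal_powr (\<integral>\<^sup>+z. ennreal_powr (g z) (enn2real p) \<partial>\<mu>) (1 / enn2real p))"

text \<open>Elements of \<open>L\<^sup>p\<close> are represented by functions; functions that agree almost everywhere
  are at distance zero from each other.\<close>

definition Lp :: "'a measure \<Rightarrow> ennreal \<Rightarrow> ('a \<Rightarrow> complex) set" where
  "Lp \<mu> p = {f \<in> borel_measurable \<mu>. Lp_norm \<mu> p (\<lambda>z. ennreal (cmod (f z))) < \<infinity>}"

definition recip_in_Lp :: "'a measure \<Rightarrow> ennreal \<Rightarrow> ('a \<Rightarrow> complex) \<Rightarrow> bool" where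
  "recip_in_Lp \<mu> p f \<longleftrightarrow>
     f \<in> borel_measurable \<mu> \<and> Lp_norm \<mu> p (\<lambda>z. 1 / ennreal (cmod (f z))) < \<infinity>"

definition conj_exponent :: "real \<Rightarrow> ennreal" where
  "conj_exponent p = (if p = 1 then \<infinity> else ennreal (p / (p - 1)))"

lemma conj_exponent:
  assumes "1 \<le> p"
  shows "1 / ennreal p + 1 / conj_exponent p = 1"
proof (cases "p = 1")
  case False
  with assms have p: "p > 1" by simp
  have "1 / ennreal p + 1 / ennreal (p / (p - 1)) = ennreal (1 / p) + ennreal ((p - 1) / p)"
    using p by (simp add: divide_ennreal flip: ennreal_1)
  also have "\<dots> = ennreal (1 / p + (p - 1) / p)"
    using p by (simp add: ennreal_plus)
  also have "1 / p + (p - 1) / p = 1"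
    using p by (simp add: field_simps)
  finally show ?thesis using False by (simp add: conj_exponent_def)
qed (simp add: conj_exponent_def)

section \<open>Complete and minimal systems\<close>

text \<open>A system is an indexed family \<open>u\<close> over the index set \<open>I\<close>.\<close>

definition lin_span :: "('i \<Rightarrow> 'a \<Rightarrow> complex) \<Rightarrow> 'i set \<Rightarrow> ('a \<Rightarrow> complex) set" where
  "lin_span u I = {(\<lambda>z. \<Sum>i\<in>F. c i * u i z) | F c. finite F \<and> F \<subseteq> I}"

definition closed_lin_span ::
    "'a measure \<Rightarrow> ennreal \<Rightarrow> ('i \<Rightarrow> 'a \<Rightarrow> complex) \<Rightarrow> 'i set \<Rightarrow> ('a \<Rightarrow> complex) set" where
  "closed_lin_span \<mu> p u I =
     {f \<in> Lp \<mu> p. \<forall>\<epsilon>>0. \<exists>g\<in>lin_span u I. Lp_norm \<mu> p (\<lambda>z. ennreal (cmod (f z - g z))) < \<epsilon>}"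

definition complete_system ::
    "'a measure \<Rightarrow> ennreal \<Rightarrow> ('i \<Rightarrow> 'a \<Rightarrow> complex) \<Rightarrow> 'i set \<Rightarrow> bool" where
  "complete_system \<mu> p u I \<longleftrightarrow> closed_lin_span \<mu> p u I = Lp \<mu> p"

definition minimal_system ::
    "'a measure \<Rightarrow> ennreal \<Rightarrow> ('i \<Rightarrow> 'a \<Rightarrow> complex) \<Rightarrow> 'i set \<Rightarrow> bool" where
  "minimal_system \<mu> p u I \<longleftrightarrow> (\<forall>i\<in>I. u i \<notin> closed_lin_span \<mu> p u (I - {i}))"

section \<open>The torus and singularities\<close>

text \<open>The circle \<open>\<real> / 2\<pi>\<int>\<close> is represented by a fundamental domain; values of functions
  outside of it are irrelevant.\<close>

definition circ :: "real set" where
  "circ = {0..<2 * pi}"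

abbreviation circ_measure :: "real measure" where
  "circ_measure \<equiv> lebesgue_on circ"

abbreviation torus_measure :: "(real \<times> real) measure" where
  "torus_measure \<equiv> lebesgue_on (circ \<times> circ)"

definition Upsilon :: "(real \<Rightarrow> complex) set" where
  "Upsilon = {\<phi> \<in> Lp circ_measure \<infinity>. recip_in_Lp circ_measure \<infinity> \<phi>}"

definition strong_x_singularity :: "real \<Rightarrow> (real \<times> real \<Rightarrow> complex) \<Rightarrow> bool" where
  "strong_x_singularity p M \<longleftrightarrow>
     (\<forall>E. E \<in> sets lebesgue \<and> E \<subseteq> circ \<and> emeasure lebesgue E > 0 \<longrightarrow>
        \<not> recip_in_Lp (lebesgue_on (circ \<times> E)) (conj_exponent p) M)"

text \<open>The quotients are taken in \<^typ>\<open>ennreal\<close>, so they are infinite where \<open>M\<close> vanishes and the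
  numerator does not. Both vanish at most where \<open>e\<^sup>i\<^sup>x = P(y)\<close>, which is a null set.\<close>

definition xP_singularity ::
    "real \<Rightarrow> (real \<Rightarrow> complex) \<Rightarrow> (real \<times> real \<Rightarrow> complex) \<Rightarrow> bool" where
  "xP_singularity p P M \<longleftrightarrow>
     P \<in> Upsilon \<and>
     \<not> recip_in_Lp torus_measure (conj_exponent p) M \<and>
     (if p = 1
      then Lp_norm torus_measure \<infinity>
             (\<lambda>(x, y). ennreal (cmod (exp (\<i> * of_real x) - P y)) / ennreal (cmod (M (x, y)))) < \<infinity>
      else (\<integral>\<^sup>+(x, y). ennreal (cmod (exp (\<i> * of_real x) - P y) powr enn2real (conj_exponent p))
             / ennreal (cmod (M (x, y)) powr enn2real (conj_exponent p)) \<partial>torus_measure) < \<infinity>)"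

definition strong_xP_singularity ::
    "real \<Rightarrow> (real \<Rightarrow> complex) \<Rightarrow> (real \<times> real \<Rightarrow> complex) \<Rightarrow> bool" where
  "strong_xP_singularity p P M \<longleftrightarrow> strong_x_singularity p M \<and> xP_singularity p P M"

definition weighted_exponential ::
    "(real \<times> real \<Rightarrow> complex) \<Rightarrow> int \<times> int \<Rightarrow> real \<times> real \<Rightarrow> complex" where
  "weighted_exponential M = (\<lambda>(k, m) (x, y).
     M (x, y) * exp (\<i> * of_int k * of_real x) * exp (\<i> * of_int m * of_real y))"

end

theory Submission
  imports Defs
begin

text \<open>Write \<open>q\<close> for the exponent conjugate to \<open>p\<close>. A function \<open>h\<close> in \<open>L\<^sup>1\<close> of the torus is
  orthogonal to all exponentials with first frequency nonzero exactly if it depends on \<open>y\<close> only.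
  By duality the system is therefore complete exactly if \<open>M \<noteq> 0\<close> almost everywhere and no quotient
  \<open>h(y) / M\<close> with \<open>h \<noteq> 0\<close> lies in \<open>L\<^sup>q\<close>, and the latter is the strong \<open>x\<close>-singularity. Likewise a
  functional dual to the frequency \<open>(k, 0)\<close> has the form \<open>(e\<^sup>-\<^sup>i\<^sup>k\<^sup>x - h(y)) / M\<close>. For \<open>k = 1\<close> this gives
  the symbol \<open>P\<close>: it is unimodular, because on a set of lines where \<open>\<bar>P\<bar>\<close> stays away from one the
  numerator is bounded below and \<open>1 / M\<close> would be integrable there. Conversely \<open>h = P\<^sup>-\<^sup>k\<close> serves for
  every \<open>k\<close>, since \<open>\<bar>e\<^sup>-\<^sup>i\<^sup>k\<^sup>x - P\<^sup>-\<^sup>k\<bar> \<le> \<bar>k\<bar> \<bar>e\<^sup>i\<^sup>x - P\<bar>\<close>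
  (\<open>span_does_not_approximate_own_exponential\<close>).\<close>

text \<open>Where duality would ask for a functional, the proof constructs its objects explicitly. On almost
  every horizontal line the infimum of \<open>\<integral> \<bar>u M\<bar>\<^sup>p dx\<close> under \<open>\<integral> u dx = 1\<close> is zero, which yields bounded
  kernels \<open>u\<^sub>n \<ge> 0\<close> with \<open>u\<^sub>n M \<rightarrow> 0\<close> in \<open>L\<^sup>p\<close> and mean one on nearly all lines
  (\<open>averaging_kernels_exist\<close>). Subtracting \<open>(\<integral> f dx) u\<^sub>n\<close> turns a bounded \<open>f\<close> into a function with mean
  zero over \<open>x\<close> at a negligible price (\<open>corrected_approximates\<close>), and such functions are limits of
  trigonometric polynomials from the system (\<open>mean_zero_approximation\<close>); this is completeness
  (\<open>off_axis_complete\<close>). If the system is minimal, the Fourier coefficient at \<open>(1, 0)\<close> is bounded on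
  functions of mean zero. Applied to the differences of the kernels, the bound shows that the line
  averages \<open>\<integral> u\<^sub>n e\<^sup>-\<^sup>i\<^sup>x dx\<close> converge almost everywhere; applied to corrected functions, it shows
  that their limit is the conjugate of the symbol (\<open>limit_symbol_pairing_bound\<close>), and the converse of
  Hoelder's inequality (\<open>conj_integrable_of_bounded_pairing\<close>) turns it into integrability.\<close>

section \<open>Integrals of powers\<close>

lemma borel_measurable_cnj [measurable]: "cnj \<in> borel_measurable borel"
  by (intro borel_measurable_continuous_onI continuous_intros)

definition p_integral :: "'a measure \<Rightarrow> real \<Rightarrow> ('a \<Rightarrow> complex) \<Rightarrow> ennreal" where
  "p_integral \<mu> p f = (\<integral>\<^sup>+z. ennreal (cmod (f z) powr p) \<partial>\<mu>)"

lemma Lp_norm_eq_p_integral: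
  assumes "0 < p"
  shows "Lp_norm \<mu> (ennreal p) (\<lambda>z. ennreal (cmod (f z)))
           = ennreal_powr (p_integral \<mu> p f) (1 / p)"
  using assms by (simp add: Lp_norm_def p_integral_def ennreal_powr_def)

lemma Lp_norm_less_iff:
  assumes "0 < p" "0 < e"
  shows "Lp_norm \<mu> (ennreal p) (\<lambda>z. ennreal (cmod (f z))) < ennreal e
           \<longleftrightarrow> p_integral \<mu> p f < ennreal (e powr p)"
proof (cases "p_integral \<mu> p f")
  case (real r)
  have "r powr (1 / p) < e \<longleftrightarrow> (r powr (1 / p)) powr p < e powr p"
    using assms real by (metis less_eq_real_def not_less powr_ge_zero powr_less_mono2 powr_mono2)
  also have "(r powr (1 / p)) powr p = r"
    using assms real by (simp add: powr_powr)
  finally show ?thesis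
    using real assms by (simp add: Lp_norm_eq_p_integral ennreal_powr_def ennreal_less_iff)
next
  case top
  then show ?thesis using assms by (simp add: Lp_norm_eq_p_integral ennreal_powr_def)
qed

lemma Lp_iff_p_integral:
  assumes "0 < p"
  shows "f \<in> Lp \<mu> (ennreal p) \<longleftrightarrow> f \<in> borel_measurable \<mu> \<and> p_integral \<mu> p f < \<infinity>"
  using assms by (auto simp: Lp_def Lp_norm_eq_p_integral ennreal_powr_def less_top)

lemma p_integral_cong_AE:
  assumes "AE z in \<mu>. f z = g z"
  shows "p_integral \<mu> p f = p_integral \<mu> p g"
  unfolding p_integral_def by (rule nn_integral_cong_AE) (use assms in auto)

text \<open>A cheap substitute for Minkowski's inequality; the factor is harmless because all estimates
  below are qualitative.\<close>

lemma powr_norm_add_le: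
  fixes a b :: complex
  assumes "0 \<le> p"
  shows "cmod (a + b) powr p \<le> 2 powr p * (cmod a powr p + cmod b powr p)"
proof -
  define m where "m = max (cmod a) (cmod b)"
  have "cmod (a + b) \<le> 2 * m"
    using norm_triangle_ineq[of a b] by (simp add: m_def)
  then have "cmod (a + b) powr p \<le> (2 * m) powr p"
    using assms by (intro powr_mono2) auto
  also have "\<dots> = 2 powr p * m powr p"
    by (simp add: m_def powr_mult)
  also have "m powr p \<le> cmod a powr p + cmod b powr p"
    by (simp add: m_def max_def)
  finally show ?thesis by simp
qed

lemma p_integral_add_le:
  assumes "0 \<le> p" and [measurable]: "f \<in> borel_measurable \<mu>" "g \<in> borel_measurable \<mu>"
  shows "p_integral \<mu> p (\<lambda>z. f z + g z)
           \<le> ennreal (2 powr p) * (p_integral \<mu> p f + p_integral \<mu> p g)"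
proof -
  have "p_integral \<mu> p (\<lambda>z. f z + g z)
      \<le> (\<integral>\<^sup>+z. ennreal (2 powr p) * (ennreal (cmod (f z) powr p) + ennreal (cmod (g z) powr p)) \<partial>\<mu>)"
    unfolding p_integral_def
    by (intro nn_integral_mono)
      (use powr_norm_add_le[OF assms(1)] in \<open>auto simp flip: ennreal_plus ennreal_mult intro!: ennreal_leI\<close>)
  also have "\<dots> = ennreal (2 powr p) * (p_integral \<mu> p f + p_integral \<mu> p g)"
    by (simp add: p_integral_def nn_integral_cmult nn_integral_add)
  finally show ?thesis .
qed

lemma p_integral_cmult:
  assumes "0 \<le> p" and [measurable]: "f \<in> borel_measurable \<mu>"
  shows "p_integral \<mu> p (\<lambda>z. c * f z) = ennreal (cmod c powr p) * p_integral \<mu> p f"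
  unfolding p_integral_def
  by (simp add: nn_integral_cmult norm_mult powr_mult ennreal_mult)

lemma p_integral_uminus: "p_integral \<mu> p (\<lambda>z. - f z) = p_integral \<mu> p f"
  by (simp add: p_integral_def)

lemma p_integral_mono_AE:
  assumes "0 \<le> p" "AE z in \<mu>. cmod (f z) \<le> cmod (g z)"
  shows "p_integral \<mu> p f \<le> p_integral \<mu> p g"
  unfolding p_integral_def
  by (rule nn_integral_mono_AE)
    (use assms in \<open>auto intro!: ennreal_leI powr_mono2 elim: eventually_mono\<close>)

text \<open>Dominated convergence, with the majorant in \<open>L\<^sup>p\<close>.\<close>

lemma p_integral_tendsto_0:
  assumes p: "0 < p"
    and [measurable]: "\<And>n. f n \<in> borel_measurable \<mu>" "g \<in> borel_measurable \<mu>"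
    and bound: "\<And>n. AE z in \<mu>. cmod (f n z) \<le> K * cmod (g z)"
    and g: "p_integral \<mu> p g < \<infinity>"
    and lim: "AE z in \<mu>. (\<lambda>n. f n z) \<longlonglongrightarrow> 0"
  shows "(\<lambda>n. p_integral \<mu> p (f n)) \<longlonglongrightarrow> 0"
proof -
  define w where "w z = ennreal (\<bar>K\<bar> powr p) * ennreal (cmod (g z) powr p)" for z
  have [measurable]: "w \<in> borel_measurable \<mu>" unfolding w_def by measurable
  have "(\<lambda>n. p_integral \<mu> p (f n)) \<longlonglongrightarrow> (\<integral>\<^sup>+z. 0 \<partial>\<mu>)"
    unfolding p_integral_def
  proof (rule nn_integral_dominated_convergence[where w = w])
    show "AE z in \<mu>. ennreal (cmod (f n z) powr p) \<le> w z" for n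
      using bound[of n]
    proof eventually_elim
      case (elim z)
      have "K * cmod (g z) \<le> \<bar>K\<bar> * cmod (g z)"
        by (intro mult_right_mono) auto
      then have "cmod (f n z) powr p \<le> (\<bar>K\<bar> * cmod (g z)) powr p"
        using elim p by (intro powr_mono2) auto
      then show ?case
        by (simp add: w_def powr_mult flip: ennreal_mult)
    qed
    show "(\<integral>\<^sup>+z. w z \<partial>\<mu>) < \<infinity>"
      using g by (simp add: w_def nn_integral_cmult p_integral_def ennreal_mult_less_top)
    show "AE z in \<mu>. (\<lambda>n. ennreal (cmod (f n z) powr p)) \<longlonglongrightarrow> 0"
      using lim
    proof eventually_elim
      case (elim z)
      then have "(\<lambda>n. cmod (f n z) powr p) \<longlonglongrightarrow> 0 powr p"
        using p by (intro tendsto_powr2) (auto intro: tendsto_norm_zero)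
      then show ?case using p by (simp add: tendsto_ennrealI[where x=0, simplified])
    qed
  qed (auto)
  then show ?thesis by simp
qed

section \<open>Conjugate integrability\<close>

text \<open>The parameter is the exponent \<open>p\<close>; the integrability is that of its conjugate exponent.\<close>

definition conj_integrable :: "'a measure \<Rightarrow> real \<Rightarrow> ('a \<Rightarrow> complex) \<Rightarrow> bool" where
  "conj_integrable \<mu> p g \<longleftrightarrow>
     (if p = 1 then \<exists>C. AE z in \<mu>. cmod (g z) \<le> C else p_integral \<mu> (p / (p - 1)) g < \<infinity>)"

lemma conj_integrable_mono:
  assumes "1 \<le> p" "conj_integrable \<mu> p g" and [measurable]: "g \<in> borel_measurable \<mu>"
    and le: "AE z in \<mu>. cmod (f z) \<le> C * cmod (g z)"
  shows "conj_integrable \<mu> p f"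
proof (cases "p = 1")
  case True
  then obtain D where D: "AE z in \<mu>. cmod (g z) \<le> D"
    using assms(2) by (auto simp: conj_integrable_def)
  have "AE z in \<mu>. cmod (f z) \<le> \<bar>C\<bar> * \<bar>D\<bar>"
    using le D
  proof eventually_elim
    case (elim z)
    have "C * cmod (g z) \<le> \<bar>C\<bar> * \<bar>D\<bar>"
      using elim by (intro mult_mono) auto
    then show ?case using elim by simp
  qed
  then show ?thesis using True by (auto simp: conj_integrable_def)
next
  case False
  have "AE z in \<mu>. cmod (f z) \<le> cmod (of_real C * g z)"
    using le
  proof eventually_elim
    case (elim z)
    have "C * cmod (g z) \<le> \<bar>C\<bar> * cmod (g z)"
      by (intro mult_right_mono) auto
    then show ?case using elim by (simp add: norm_mult)
  qed
  with False assms(1) have "p_integral \<mu> (p / (p - 1)) f \<le> p_integral \<mu> (p / (p - 1)) (\<lambda>z. of_real C * g z)"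
    by (intro p_integral_mono_AE) auto
  also have "\<dots> < \<infinity>"
    using False assms by (simp add: p_integral_cmult conj_integrable_def ennreal_mult_less_top)
  finally show ?thesis using False by (simp add: conj_integrable_def)
qed

text \<open>A crude form of Young's inequality: whichever of \<open>a\<^sup>p\<close> and \<open>b\<^sup>q\<close> is the larger one
  already dominates \<open>a * b\<close>.\<close>

lemma mult_le_powr_add_conj_powr:
  fixes a b :: real
  assumes "1 < p" "0 \<le> a" "0 \<le> b"
  shows "a * b \<le> a powr p + b powr (p / (p - 1))"
proof -
  define q where "q = p / (p - 1)"
  have q: "q > 0" "1 / p + 1 / q = 1" using assms by (auto simp: q_def field_simps)
  define m where "m = max (a powr p) (b powr q)"
  have "a = (a powr p) powr (1 / p)" "b = (b powr q) powr (1 / q)"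
    using assms q by (auto simp: powr_powr)
  moreover have "(a powr p) powr (1 / p) \<le> m powr (1 / p)" "(b powr q) powr (1 / q) \<le> m powr (1 / q)"
    using assms q by (auto simp: m_def intro!: powr_mono2)
  ultimately have "a * b \<le> m powr (1 / p) * m powr (1 / q)"
    using assms by (intro mult_mono) auto
  also have "\<dots> = m"
    using q by (simp add: m_def max_def flip: powr_add)
  also have "\<dots> \<le> a powr p + b powr q" by (simp add: m_def)
  finally show ?thesis by (simp add: q_def)
qed

text \<open>The part of Hoelder's inequality that duality arguments need: pairing with an element of
  the conjugate space is continuous at zero.\<close>

lemma conj_integrable_pairing_small:
  assumes p: "1 \<le> p" and g: "conj_integrable \<mu> p g" and [measurable]: "g \<in> borel_measurable \<mu>"
    and e: "0 < e"
  obtains d where "0 < d"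
    "\<And>s. s \<in> borel_measurable \<mu> \<Longrightarrow> p_integral \<mu> p s < ennreal d
        \<Longrightarrow> (\<integral>\<^sup>+z. ennreal (cmod (s z * g z)) \<partial>\<mu>) < ennreal e"
proof (cases "p = 1")
  case True
  then obtain C where C: "AE z in \<mu>. cmod (g z) \<le> C"
    using g by (auto simp: conj_integrable_def)
  show thesis
  proof (rule that)
    show "0 < e / (\<bar>C\<bar> + 1)" using e by simp
    fix s assume [measurable]: "s \<in> borel_measurable \<mu>"
      and s: "p_integral \<mu> p s < ennreal (e / (\<bar>C\<bar> + 1))"
    have "(\<integral>\<^sup>+z. ennreal (cmod (s z * g z)) \<partial>\<mu>)
            \<le> (\<integral>\<^sup>+z. ennreal (\<bar>C\<bar> + 1) * ennreal (cmod (s z) powr p) \<partial>\<mu>)"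
    proof (rule nn_integral_mono_AE)
      show "AE z in \<mu>. ennreal (cmod (s z * g z)) \<le> ennreal (\<bar>C\<bar> + 1) * ennreal (cmod (s z) powr p)"
        using C
      proof eventually_elim
        case (elim z)
        have "cmod (s z * g z) \<le> (\<bar>C\<bar> + 1) * cmod (s z)"
          using elim mult_right_mono[of "cmod (g z)" "\<bar>C\<bar> + 1" "cmod (s z)"]
          by (simp add: norm_mult mult.commute)
        then show ?case using True by (simp flip: ennreal_mult add: ennreal_leI del: ennreal_plus)
      qed
    qed
    also have "\<dots> = ennreal (\<bar>C\<bar> + 1) * p_integral \<mu> p s"
      by (simp add: nn_integral_cmult p_integral_def)
    also have "\<dots> < ennreal (\<bar>C\<bar> + 1) * ennreal (e / (\<bar>C\<bar> + 1))"
      using s by (intro ennreal_mult_strict_left_mono) (auto simp del: ennreal_plus)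
    also have "\<dots> = ennreal e"
      using e by (simp flip: ennreal_mult del: ennreal_plus)
    finally show "(\<integral>\<^sup>+z. ennreal (cmod (s z * g z)) \<partial>\<mu>) < ennreal e" .
  qed
next
  case False
  then have p1: "1 < p" using p by simp
  define q where "q = p / (p - 1)"
  have q: "0 < q" using p1 by (simp add: q_def)
  obtain G where G: "p_integral \<mu> q g = ennreal G" "0 \<le> G"
    using g False by (cases "p_integral \<mu> q g") (auto simp: conj_integrable_def q_def)
  \<comment> \<open>Young's inequality is applied to \<open>(t s) (g / t)\<close>; this \<open>t\<close> makes the part with \<open>g\<close> less than \<open>e / 2\<close>.\<close>
  define t where "t = (2 * (G + 1) / e) powr (1 / q)"
  have t: "0 < t" using G e by (simp add: t_def)
  have tq: "t powr (- q) * G < e / 2"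
  proof -
    have "t powr q = 2 * (G + 1) / e"
      using q G e by (simp add: t_def powr_powr)
    then have "t powr (- q) = e / (2 * (G + 1))" by (simp add: powr_minus_divide)
    moreover have "e / (2 * (G + 1)) * G < e / 2"
      using G e by (simp add: field_simps)
    ultimately show ?thesis by simp
  qed
  show thesis
  proof (rule that)
    show "0 < e / 2 / (t powr p)" using e t by simp
    fix s assume [measurable]: "s \<in> borel_measurable \<mu>"
      and s: "p_integral \<mu> p s < ennreal (e / 2 / (t powr p))"
    have "(\<integral>\<^sup>+z. ennreal (cmod (s z * g z)) \<partial>\<mu>)
       \<le> (\<integral>\<^sup>+z. ennreal (t powr p) * ennreal (cmod (s z) powr p)
               + ennreal (t powr (- q)) * ennreal (cmod (g z) powr q) \<partial>\<mu>)"
    proof (rule nn_integral_mono)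
      fix z
      have "cmod (s z * g z) = (t * cmod (s z)) * (cmod (g z) / t)"
        using t by (simp add: norm_mult)
      also have "\<dots> \<le> (t * cmod (s z)) powr p + (cmod (g z) / t) powr q"
        unfolding q_def using p1 t by (intro mult_le_powr_add_conj_powr) auto
      also have "\<dots> = t powr p * cmod (s z) powr p + t powr (- q) * cmod (g z) powr q"
        using t by (simp add: powr_mult powr_divide powr_minus_divide)
      finally show "ennreal (cmod (s z * g z)) \<le> ennreal (t powr p) * ennreal (cmod (s z) powr p)
               + ennreal (t powr (- q)) * ennreal (cmod (g z) powr q)"
        by (simp flip: ennreal_mult ennreal_plus add: ennreal_leI)
    qed
    also have "\<dots> = ennreal (t powr p) * p_integral \<mu> p s + ennreal (t powr (- q)) * p_integral \<mu> q g"
      by (simp add: nn_integral_cmult nn_integral_add p_integral_def)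
    also have "\<dots> < ennreal (e / 2) + ennreal (e / 2)"
    proof (rule add_strict_mono)
      have "ennreal (t powr p) * p_integral \<mu> p s < ennreal (t powr p) * ennreal (e / 2 / (t powr p))"
        using s t by (intro ennreal_mult_strict_left_mono) auto
      also have "\<dots> = ennreal (e / 2)" using t e by (simp flip: ennreal_mult)
      finally show "ennreal (t powr p) * p_integral \<mu> p s < ennreal (e / 2)" .
      show "ennreal (t powr (- q)) * p_integral \<mu> q g < ennreal (e / 2)"
        unfolding G using tq G(2) e by (simp add: ennreal_lessI flip: ennreal_mult)
    qed
    also have "\<dots> = ennreal e" using e by (simp flip: ennreal_plus)
    finally show "(\<integral>\<^sup>+z. ennreal (cmod (s z * g z)) \<partial>\<mu>) < ennreal e" .
  qed
qed

text \<open>Testing the functional \<open>f \<mapsto> \<integral> f N\<close> on truncations of the extremal function of Hoelder's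
  inequality recovers the norm of \<open>N / M\<close>. Only bounded test functions are used; the truncation
  at \<open>\<bar>M\<bar> \<ge> 1 / (k + 1)\<close> keeps them bounded and the integrals finite.\<close>

lemma conj_integrable_of_bounded_pairing:
  assumes p: "1 \<le> p" and fin: "finite_measure \<mu>"
    and [measurable]: "N \<in> borel_measurable \<mu>" "M \<in> borel_measurable \<mu>"
    and N: "\<And>z. cmod (N z) \<le> K"
    and M0: "AE z in \<mu>. M z \<noteq> 0"
    and Mp: "p_integral \<mu> p M < \<infinity>"
    and C: "0 \<le> C"
    and bound: "\<And>f B. f \<in> borel_measurable \<mu> \<Longrightarrow> (\<And>z. cmod (f z) \<le> B) \<Longrightarrow>
          ennreal (cmod (\<integral>z. f z * N z \<partial>\<mu>) powr p) \<le> ennreal C * p_integral \<mu> p (\<lambda>z. f z * M z)"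
  shows "conj_integrable \<mu> p (\<lambda>z. N z / M z)"
proof (cases "p = 1")
  case True
  interpret finite_measure \<mu> by fact
  have K: "0 \<le> K" using N[of undefined] norm_ge_zero order_trans by blast
  \<comment> \<open>The set where the claimed bound \<open>C + 1\<close> on \<open>N / M\<close> fails; the test function is its indicator,
    rotated against \<open>N\<close>.\<close>
  define R where "R = {z \<in> space \<mu>. cmod (N z) > (C + 1) * cmod (M z)}"
  have [measurable]: "R \<in> sets \<mu>" unfolding R_def by measurable
  define f where "f z = cnj (sgn (N z)) * indicator R z" for z
  have [measurable]: "f \<in> borel_measurable \<mu>" unfolding f_def by measurable
  have fN: "f z * N z = of_real (indicator R z * cmod (N z))" for z
    by (simp add: f_def sgn_div_norm scaleR_conv_of_real indicator_def complex_norm_square[symmetric]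
        field_simps power2_eq_square)
  have fM: "cmod (f z * M z) powr p = indicator R z * cmod (M z)" for z
  proof (cases "z \<in> R")
    case True
    then have "N z \<noteq> 0"
    proof -
      have "0 \<le> (C + 1) * cmod (M z)" using C by simp
      then show ?thesis using True by (auto simp: R_def simp del: zero_le_mult_iff)
    qed
    then show ?thesis using True \<open>p = 1\<close> by (simp add: f_def norm_mult norm_sgn)
  qed (simp add: f_def)
  have intM: "integrable \<mu> (\<lambda>z. cmod (M z))"
    using Mp True by (intro integrableI_bounded) (auto simp: p_integral_def)
  have intRM: "integrable \<mu> (\<lambda>z. indicator R z * cmod (M z))"
    by (rule Bochner_Integration.integrable_bound[OF intM]) (auto simp: indicator_def)
  have intRN: "integrable \<mu> (\<lambda>z. indicator R z * cmod (N z))"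
    by (rule integrable_const_bound[where B = K]) (use N K in \<open>auto simp: indicator_def\<close>)
  have "(\<integral>z. indicator R z * cmod (N z) \<partial>\<mu>) \<le> C * (\<integral>z. indicator R z * cmod (M z) \<partial>\<mu>)"
  proof -
    have "cmod (f z) \<le> 1" for z by (simp add: f_def norm_mult norm_sgn indicator_def)
    from bound[OF _ this]
    have "ennreal (cmod (\<integral>z. f z * N z \<partial>\<mu>)) \<le> ennreal C * p_integral \<mu> p (\<lambda>z. f z * M z)"
      using True by simp
    also have "(\<integral>z. f z * N z \<partial>\<mu>) = of_real (\<integral>z. indicator R z * cmod (N z) \<partial>\<mu>)"
      unfolding fN by (simp del: of_real_mult)
    also have "p_integral \<mu> p (\<lambda>z. f z * M z) = ennreal (\<integral>z. indicator R z * cmod (M z) \<partial>\<mu>)"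
      unfolding p_integral_def fM by (rule nn_integral_eq_integral[OF intRM]) simp
    finally show ?thesis
      using C by (simp flip: ennreal_mult add: integral_nonneg_AE)
  qed
  moreover have "(C + 1) * (\<integral>z. indicator R z * cmod (M z) \<partial>\<mu>) \<le> (\<integral>z. indicator R z * cmod (N z) \<partial>\<mu>)"
    unfolding integral_mult_right_zero[symmetric]
    by (rule integral_mono) (use intRM intRN in \<open>auto simp: R_def indicator_def\<close>)
  ultimately have "(\<integral>z. indicator R z * cmod (M z) \<partial>\<mu>) \<le> 0"
    by (simp add: algebra_simps)
  then have "(\<integral>z. indicator R z * cmod (M z) \<partial>\<mu>) = 0"
    by (intro antisym) (auto intro!: integral_nonneg_AE)
  then have "AE z in \<mu>. indicator R z * cmod (M z) = 0"
    using integral_nonneg_eq_0_iff_AE[OF intRM] by simp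
  with M0 have "AE z in \<mu>. cmod (N z / M z) \<le> C + 1"
    using AE_space
  proof eventually_elim
    case (elim z)
    then have "z \<notin> R" by (auto simp: indicator_def)
    then show ?case using elim by (auto simp: R_def norm_divide field_simps not_less)
  qed
  then show ?thesis using True by (auto simp: conj_integrable_def)
next
  case False
  interpret finite_measure \<mu> by fact
  have p1: "1 < p" using p False by simp
  have K: "0 \<le> K" using N[of undefined] norm_ge_zero order_trans by blast
  define q where "q = p / (p - 1)"
  have q: "1 < q" "(q - 1) * p = q" "(1 - q) * p = - q"
    using p1 by (auto simp: q_def field_simps)
  define h where "h k z = (if 1 / real (k + 1) \<le> cmod (M z) then cmod (N z / M z) powr q else 0)" for k z
  have [measurable]: "h k \<in> borel_measurable \<mu>" for k unfolding h_def by measurable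
  have h_le: "0 \<le> h k z" "h k z \<le> (K * real (k + 1)) powr q" for k z
  proof -
    show "0 \<le> h k z" by (simp add: h_def)
    have "cmod (N z / M z) \<le> K * real (k + 1)" if "1 / real (k + 1) \<le> cmod (M z)"
    proof -
      have "1 / cmod (M z) \<le> real (k + 1)"
        using that less_le_trans[OF _ that, of 0] by (simp add: field_simps)
      then show ?thesis
        using mult_mono[OF N[of z], of "1 / cmod (M z)" "real (k + 1)"] K by (simp add: norm_divide)
    qed
    then show "h k z \<le> (K * real (k + 1)) powr q"
      using q by (auto simp: h_def intro!: powr_mono2)
  qed
  have int_h: "integrable \<mu> (h k)" for k
    by (rule integrable_const_bound[where B = "(K * real (k + 1)) powr q"]) (use h_le in auto)
  have J: "(\<integral>z. h k z \<partial>\<mu>) \<le> C powr (1 / (p - 1))" for k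
  proof -
    define J where "J = (\<integral>z. h k z \<partial>\<mu>)"
    have J0: "0 \<le> J" by (simp add: J_def integral_nonneg_AE h_le)
    define f where "f z = (if 1 / real (k + 1) \<le> cmod (M z)
        then cnj (sgn (N z)) * of_real (cmod (N z) powr (q - 1) * cmod (M z) powr (- q)) else 0)" for z
    have [measurable]: "f \<in> borel_measurable \<mu>" unfolding f_def by measurable
    have pos: "0 < cmod (M z)" if "1 / real (k + 1) \<le> cmod (M z)" for z
      by (rule less_le_trans[OF _ that]) simp
    have fN: "f z * N z = of_real (h k z)" for z
    proof (cases "1 / real (k + 1) \<le> cmod (M z) \<and> N z \<noteq> 0")
      case True
      have "cnj (sgn (N z)) * N z = of_real (cmod (N z))"
        using True by (simp add: sgn_div_norm scaleR_conv_of_real complex_norm_square[symmetric]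
            field_simps power2_eq_square)
      moreover have "cmod (N z) * cmod (N z) powr (q - 1) = cmod (N z) powr q"
        using True powr_mult_base[of "cmod (N z)" "q - 1"] by simp
      moreover have "f z * N z = (cnj (sgn (N z)) * N z) * of_real (cmod (N z) powr (q - 1) * cmod (M z) powr (- q))"
        using True by (simp add: f_def)
      moreover have "h k z = cmod (N z) powr q * cmod (M z) powr (- q)"
        using True by (simp add: h_def norm_divide powr_divide powr_minus_divide)
      ultimately show ?thesis by (simp flip: of_real_mult add: mult.assoc[symmetric])
    qed (use q in \<open>auto simp: f_def h_def\<close>)
    have fM: "cmod (f z * M z) powr p = h k z" for z
    proof (cases "1 / real (k + 1) \<le> cmod (M z) \<and> N z \<noteq> 0")
      case True
      have "cmod (f z * M z) = cmod (N z) powr (q - 1) * cmod (M z) powr (1 - q)"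
        using True powr_mult_base[of "cmod (M z)" "- q"]
        by (simp add: f_def norm_mult norm_sgn mult.commute)
      also have "\<dots> powr p = cmod (N z) powr q * cmod (M z) powr (- q)"
        using q by (simp add: powr_mult powr_powr)
      also have "\<dots> = h k z"
        using True by (simp add: h_def norm_divide powr_divide powr_minus_divide)
      finally show ?thesis .
    qed (use q in \<open>auto simp: f_def h_def\<close>)
    have fB: "cmod (f z) \<le> K powr (q - 1) * real (k + 1) powr q" for z
    proof (cases "1 / real (k + 1) \<le> cmod (M z)")
      case True
      have "1 / cmod (M z) \<le> real (k + 1)"
        using True pos[OF True] by (simp add: field_simps)
      then have "(1 / cmod (M z)) powr q \<le> real (k + 1) powr q"
        using q pos[OF True] by (intro powr_mono2) auto
      moreover have "cmod (N z) powr (q - 1) \<le> K powr (q - 1)"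
        using q N[of z] by (intro powr_mono2) auto
      ultimately have "cmod (N z) powr (q - 1) * cmod (M z) powr (- q) \<le> K powr (q - 1) * real (k + 1) powr q"
        by (intro mult_mono) (auto simp: powr_divide powr_minus_divide)
      moreover have "cmod (f z) \<le> cmod (N z) powr (q - 1) * cmod (M z) powr (- q)"
        using True by (simp add: f_def norm_mult norm_sgn)
      ultimately show ?thesis by simp
    qed (simp add: f_def)
    have "ennreal (cmod (\<integral>z. f z * N z \<partial>\<mu>) powr p) \<le> ennreal C * p_integral \<mu> p (\<lambda>z. f z * M z)"
      by (rule bound[OF _ fB]) simp
    also have "p_integral \<mu> p (\<lambda>z. f z * M z) = ennreal J"
      unfolding p_integral_def fM J_def by (rule nn_integral_eq_integral[OF int_h]) (simp add: h_le)
    also have "(\<integral>z. f z * N z \<partial>\<mu>) = of_real J"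
      unfolding fN J_def by simp
    finally have Jp: "J powr p \<le> C * J"
      using C J0 by (simp flip: ennreal_mult)
    show ?thesis
    proof (cases "J = 0")
      case False
      then have "J powr p = J * J powr (p - 1)"
        using J0 powr_mult_base[of J "p - 1"] by simp
      with Jp False J0 have "J powr (p - 1) \<le> C" by (simp add: mult.commute)
      then have "(J powr (p - 1)) powr (1 / (p - 1)) \<le> C powr (1 / (p - 1))"
        using p1 by (intro powr_mono2) auto
      then show ?thesis using p1 J0 by (simp add: powr_powr J_def)
    qed (simp flip: J_def)
  qed
  have "p_integral \<mu> q (\<lambda>z. N z / M z) = (\<integral>\<^sup>+z. (SUP k. ennreal (h k z)) \<partial>\<mu>)"
    unfolding p_integral_def
  proof (rule nn_integral_cong_AE)
    show "AE z in \<mu>. ennreal (cmod (N z / M z) powr q) = (SUP k. ennreal (h k z))"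
      using M0
    proof eventually_elim
      case (elim z)
      obtain k where k: "1 / real (k + 1) < cmod (M z)"
        using elim nat_approx_posE[of "cmod (M z)"] by auto
      show ?case
      proof (rule antisym)
        show "ennreal (cmod (N z / M z) powr q) \<le> (SUP k. ennreal (h k z))"
          using k by (intro SUP_upper2[of k]) (auto simp: h_def)
        show "(SUP k. ennreal (h k z)) \<le> ennreal (cmod (N z / M z) powr q)"
          by (intro SUP_least ennreal_leI) (simp add: h_def)
      qed
    qed
  qed
  also have "\<dots> = (SUP k. \<integral>\<^sup>+z. ennreal (h k z) \<partial>\<mu>)"
  proof (rule nn_integral_monotone_convergence_SUP)
    show "incseq (\<lambda>k z. ennreal (h k z))"
    proof (rule incseq_SucI, rule le_funI)
      fix k z
      have "1 / real (Suc k + 1) \<le> 1 / real (k + 1)" by (simp add: field_simps)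
      then show "ennreal (h k z) \<le> ennreal (h (Suc k) z)"
        unfolding h_def by (intro ennreal_leI) (auto simp del: of_nat_add of_nat_Suc)
    qed
  qed simp
  also have "\<dots> \<le> ennreal (C powr (1 / (p - 1)))"
  proof (rule SUP_least)
    fix k
    have "(\<integral>\<^sup>+z. ennreal (h k z) \<partial>\<mu>) = ennreal (\<integral>z. h k z \<partial>\<mu>)"
      by (rule nn_integral_eq_integral[OF int_h]) (simp add: h_le)
    then show "(\<integral>\<^sup>+z. ennreal (h k z) \<partial>\<mu>) \<le> ennreal (C powr (1 / (p - 1)))"
      using J[of k] by (simp add: ennreal_leI)
  qed
  finally have "p_integral \<mu> q (\<lambda>z. N z / M z) < \<infinity>"
    by (rule le_less_trans) simp
  then show ?thesis using False by (simp add: conj_integrable_def q_def)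
qed

section \<open>Borel measures on the circle and on the torus\<close>

text \<open>These are measures on the whole line and plane that are concentrated on the fundamental
  domain; every Borel function is measurable for them, and Fubini's theorem applies.\<close>

definition circle :: "real measure" where
  "circle = density lborel (indicator circ)"

abbreviation torus :: "(real \<times> real) measure" where
  "torus \<equiv> circle \<Otimes>\<^sub>M circle"

lemma circ_borel [measurable]: "circ \<in> sets borel"
  by (simp add: circ_def)

lemma circ_Times_borel: "circ \<times> circ \<in> sets borel"
  by (simp flip: borel_prod)

lemma sets_circle [measurable_cong]: "sets circle = sets borel"
  by (simp add: circle_def)

lemma space_circle [simp]: "space circle = UNIV"
  by (simp add: circle_def)

lemma space_torus [simp]: "space torus = UNIV"
  by (simp add: space_pair_measure)

lemma emeasure_circ: "emeasure lborel circ = ennreal (2 * pi)"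
  by (simp add: circ_def)

lemma emeasure_circle_UNIV: "emeasure circle UNIV = ennreal (2 * pi)"
  by (simp add: circle_def emeasure_density emeasure_circ)

interpretation circle: finite_measure circle
  by standard (simp add: emeasure_circle_UNIV)

interpretation torus: pair_sigma_finite circle circle ..

lemma emeasure_torus_UNIV: "emeasure torus UNIV = ennreal (2 * pi) * ennreal (2 * pi)"
  using circle.emeasure_pair_measure_Times[of UNIV circle UNIV]
  by (simp add: emeasure_circle_UNIV sets_circle)

interpretation torus: finite_measure torus
  by standard (simp add: emeasure_torus_UNIV flip: ennreal_mult)

lemma measure_circle_UNIV: "measure circle UNIV = 2 * pi"
  by (simp add: measure_def emeasure_circle_UNIV)

lemma torus_eq_density: "torus = density lborel (indicator (circ \<times> circ))"
proof -
  have "torus = density (lborel \<Otimes>\<^sub>M lborel) (\<lambda>(x, y). indicator circ x * indicator circ y)"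
    unfolding circle_def
    by (rule pair_measure_density)
      (use circle.sigma_finite_measure_axioms in \<open>auto simp: circle_def lborel.sigma_finite_measure_axioms\<close>)
  also have "(\<lambda>(x, y). indicator circ x * indicator circ y :: ennreal) = indicator (circ \<times> circ)"
    by (auto simp: fun_eq_iff indicator_def)
  finally show ?thesis by (simp add: lborel_prod)
qed

lemma sets_torus: "sets torus = sets borel"
  by (subst torus_eq_density) simp

lemma borel_measurable_torus_iff: "f \<in> borel_measurable torus \<longleftrightarrow> f \<in> borel_measurable borel"
  by (simp add: measurable_cong_sets[OF sets_torus refl])

lemma borel_measurable_circle_iff: "f \<in> borel_measurable circle \<longleftrightarrow> f \<in> borel_measurable borel"
  by (simp add: measurable_cong_sets[OF sets_circle refl])

lemma integrable_bounded_circle: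
  fixes f :: "real \<Rightarrow> complex"
  shows "f \<in> borel_measurable circle \<Longrightarrow> (\<And>x. cmod (f x) \<le> B) \<Longrightarrow> integrable circle f"
  by (rule circle.integrable_const_bound[where B = B]) auto

lemma integrable_bounded_torus:
  fixes f :: "real \<times> real \<Rightarrow> complex"
  shows "f \<in> borel_measurable torus \<Longrightarrow> (\<And>x. cmod (f x) \<le> B) \<Longrightarrow> integrable torus f"
  by (rule torus.integrable_const_bound[where B = B]) auto

lemma integral_torus_iterated:
  fixes f :: "real \<times> real \<Rightarrow> complex"
  assumes "f \<in> borel_measurable torus" "\<And>z. cmod (f z) \<le> B"
  shows "(\<integral>z. f z \<partial>torus) = (\<integral>y. (\<integral>x. f (x, y) \<partial>circle) \<partial>circle)"
  using torus.integral_snd[of "\<lambda>x y. f (x, y)"] integrable_bounded_torus[OF assms] by simp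

lemma norm_integral_circle_le:
  fixes f :: "real \<Rightarrow> complex"
  assumes "f \<in> borel_measurable circle" "\<And>x. cmod (f x) \<le> B"
  shows "cmod (\<integral>x. f x \<partial>circle) \<le> 2 * pi * B"
proof -
  have "cmod (\<integral>x. f x \<partial>circle) \<le> (\<integral>x. cmod (f x) \<partial>circle)" by (rule integral_norm_bound)
  also have "\<dots> \<le> (\<integral>x. B \<partial>circle)"
    by (intro integral_mono integrable_norm integrable_bounded_circle[OF assms]) (use assms in auto)
  finally show ?thesis by (simp add: measure_circle_UNIV)
qed

lemma AE_torus_snd:
  assumes "AE y in circle. Q y"
  shows "AE z in torus. Q (snd z)"
proof -
  obtain N where N: "N \<in> null_sets circle" "{y. \<not> Q y} \<subseteq> N"
    using assms by (auto elim!: AE_E simp: null_sets_def)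
  then have "UNIV \<times> N \<in> null_sets torus"
    by (intro circle.times_in_null_sets2) (auto simp: sets_circle)
  then show ?thesis by (rule AE_I') (use N in auto)
qed

lemma AE_torus_fst:
  assumes "AE y in circle. Q y"
  shows "AE z in torus. Q (fst z)"
proof -
  obtain N where N: "N \<in> null_sets circle" "{y. \<not> Q y} \<subseteq> N"
    using assms by (auto elim!: AE_E simp: null_sets_def)
  then have "N \<times> UNIV \<in> null_sets torus"
    by (intro circle.times_in_null_sets1) (auto simp: sets_circle)
  then show ?thesis by (rule AE_I') (use N in auto)
qed

lemma AE_torus_iterated:
  assumes "AE z in torus. Q z"
  shows "AE y in circle. AE x in circle. Q (x, y)"
proof -
  obtain N where N: "N \<in> null_sets torus" "{z. \<not> Q z} \<subseteq> N"
    using assms by (auto elim!: AE_E simp: null_sets_def)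
  have [measurable]: "N \<in> sets torus" using N by auto
  have "AE z in torus. z \<notin> N" using N(1) by (rule AE_not_in)
  from torus.AE_pair[OF this] have "AE x in circle. AE y in circle. (x, y) \<notin> N" .
  then have "AE y in circle. AE x in circle. (x, y) \<notin> N"
    using sets.compl_sets[of N torus] \<open>N \<in> sets torus\<close>
    by (subst (asm) torus.AE_commute) (simp_all add: set_diff_eq)
  then show ?thesis
    by (elim eventually_mono) (use N in auto)
qed

lemma AE_circle_neq: "AE x in circle. x \<noteq> a"
  unfolding circle_def by (subst AE_density) (auto intro: AE_lborel_singleton[THEN eventually_mono])

lemma AE_torus_circ: "AE z in torus. z \<in> circ \<times> circ"
  unfolding torus_eq_density by (subst AE_density) (auto simp: circ_Times_borel indicator_def intro!: borel_measurable_indicator)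

section \<open>Trigonometric polynomials\<close>

lemma cis_measurable [measurable]: "cis \<in> borel_measurable borel"
  by (intro borel_measurable_continuous_onI continuous_intros)

definition char :: "int \<times> int \<Rightarrow> real \<times> real \<Rightarrow> complex" where
  "char = (\<lambda>(k, m) (x, y). cis (of_int k * x) * cis (of_int m * y))"

lemma char_apply: "char (k, m) (x, y) = cis (of_int k * x) * cis (of_int m * y)"
  by (simp add: char_def)

lemma weighted_exponential_eq: "weighted_exponential M i z = M z * char i z"
  by (cases i; cases z) (simp add: weighted_exponential_def char_def cis_conv_exp mult.assoc)

lemma char_measurable [measurable]: "char i \<in> borel_measurable torus"
  unfolding borel_measurable_torus_iff
  by (cases i, simp add: char_def split_def)
    (intro borel_measurable_continuous_onI continuous_intros)

lemma norm_char [simp]: "cmod (char i z) = 1"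
  by (cases i; cases z) (simp add: char_def norm_mult)

lemma char_add: "char (i + j) z = char i z * char j z"
  by (cases i; cases j; cases z) (simp add: char_def cis_mult algebra_simps)

lemma char_0 [simp]: "char 0 z = 1" "char (0, 0) z = 1"
  by (cases z; simp add: char_def zero_prod_def)+

lemma integral_cis_circle:
  "(\<integral>x. cis (of_int k * x) \<partial>circle) = (if k = 0 then 2 * pi else 0)"
proof (cases "k = 0")
  case False
  have "(\<integral>x. cis (of_int k * x) \<partial>circle) = (\<integral>x. indicator circ x *\<^sub>R cis (of_int k * x) \<partial>lborel)"
  proof -
    have "circle = density lborel (\<lambda>x. ennreal (indicator circ x))"
      unfolding circle_def by (simp add: ennreal_indicator)
    moreover have "(\<lambda>x. cis (of_int k * x)) \<in> borel_measurable lborel"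
      by measurable
    ultimately show ?thesis
      using integral_density[of "\<lambda>x. cis (of_int k * x)" lborel "indicator circ"] by simp
  qed
  also have "\<dots> = (\<integral>x. indicator {0..2 * pi} x *\<^sub>R cis (of_int k * x) \<partial>lborel)"
  proof (rule integral_cong_AE)
    show "(\<lambda>x. indicator circ x *\<^sub>R cis (of_int k * x)) \<in> borel_measurable lborel"
      "(\<lambda>x. indicator {0..2 * pi} x *\<^sub>R cis (of_int k * x)) \<in> borel_measurable lborel"
      by measurable
    show "AE x in lborel. indicator circ x *\<^sub>R cis (of_int k * x) = indicator {0..2 * pi} x *\<^sub>R cis (of_int k * x)"
      using AE_lborel_singleton[of "2 * pi"] by eventually_elim (auto simp: circ_def indicator_def)
  qed
  also have "\<dots> = cis (of_int k * (2 * pi)) / (\<i> * of_int k) - cis (of_int k * 0) / (\<i> * of_int k)"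
  proof (rule integral_FTC_atLeastAtMost)
    fix x :: real
    have "((\<lambda>x. exp (\<i> * of_int k * of_real x) / (\<i> * of_int k)) has_vector_derivative
        exp (\<i> * of_int k * of_real x)) (at x within {0..2 * pi})"
      by (rule has_vector_derivative_real_field) (use False in \<open>auto intro!: derivative_eq_intros\<close>)
    then show "((\<lambda>x. cis (of_int k * x) / (\<i> * of_int k)) has_vector_derivative cis (of_int k * x))
        (at x within {0..2 * pi})"
      by (simp add: cis_conv_exp mult.assoc)
  qed (auto intro!: continuous_intros)
  also have "cis (of_int k * (2 * pi)) = 1"
    using cis_multiple_2pi[of "of_int k"] by (simp add: mult_ac)
  finally show ?thesis using False by simp
qed (simp add: measure_circle_UNIV scaleR_conv_of_real)

lemma integral_char: "(\<integral>z. char i z \<partial>torus) = (if i = 0 then (2 * pi)\<^sup>2 else 0)"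
proof -
  obtain k m where i: "i = (k, m)" by (cases i)
  have "(\<integral>z. char i z \<partial>torus) = (\<integral>y. (\<integral>x. char i (x, y) \<partial>circle) \<partial>circle)"
    by (rule integral_torus_iterated[where B = 1]) auto
  then show ?thesis
    by (simp add: i char_apply integral_cis_circle power2_eq_square zero_prod_def)
qed

lemma lin_span_add:
  assumes "f \<in> lin_span u I" "g \<in> lin_span u I"
  shows "(\<lambda>z. f z + g z) \<in> lin_span u I"
proof -
  obtain F c G d where *: "finite F" "F \<subseteq> I" "f = (\<lambda>z. \<Sum>i\<in>F. c i * u i z)"
    "finite G" "G \<subseteq> I" "g = (\<lambda>z. \<Sum>i\<in>G. d i * u i z)"
    using assms by (auto simp: lin_span_def)
  define e where "e i = (if i \<in> F then c i else 0) + (if i \<in> G then d i else 0)" for i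
  have "f z + g z = (\<Sum>i\<in>F \<union> G. e i * u i z)" for z
  proof -
    have "(\<Sum>i\<in>F \<union> G. e i * u i z) = (\<Sum>i\<in>F \<union> G. (if i \<in> F then c i * u i z else 0))
        + (\<Sum>i\<in>F \<union> G. (if i \<in> G then d i * u i z else 0))"
      unfolding sum.distrib[symmetric] by (intro sum.cong) (auto simp: e_def distrib_right)
    then show ?thesis using * by (simp add: sum.If_cases Int_absorb1 Un_commute Int_commute)
  qed
  then show ?thesis
    unfolding lin_span_def using * by (intro CollectI exI[of _ "F \<union> G"] exI[of _ e]) auto
qed

lemma lin_span_cmult:
  assumes "f \<in> lin_span u I"
  shows "(\<lambda>z. a * f z) \<in> lin_span u I"
proof -
  obtain F c where *: "finite F" "F \<subseteq> I" "f = (\<lambda>z. \<Sum>i\<in>F. c i * u i z)"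
    using assms by (auto simp: lin_span_def)
  then show ?thesis
    unfolding lin_span_def
    by (intro CollectI exI[of _ F] exI[of _ "\<lambda>i. a * c i"]) (auto simp: sum_distrib_left mult.assoc)
qed

lemma lin_span_zero: "(\<lambda>z. 0) \<in> lin_span u I"
  unfolding lin_span_def by (intro CollectI exI[of _ "{}"]) auto

lemma lin_span_base:
  assumes "i \<in> I"
  shows "u i \<in> lin_span u I"
  unfolding lin_span_def using assms by (intro CollectI exI[of _ "{i}"] exI[of _ "\<lambda>_. 1"]) auto

lemma lin_span_sum:
  assumes "finite A" "\<And>a. a \<in> A \<Longrightarrow> f a \<in> lin_span u I"
  shows "(\<lambda>z. \<Sum>a\<in>A. f a z) \<in> lin_span u I"
  using assms by (induction A rule: finite_induct) (auto simp: lin_span_zero intro!: lin_span_add)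

text \<open>This reduces the weighted system to unweighted trigonometric
  polynomials and the weight.\<close>

lemma lin_span_weighted_exponential:
  "lin_span (weighted_exponential M) I = (\<lambda>S z. M z * S z) ` lin_span char I"
proof (intro equalityI subsetI)
  fix f assume "f \<in> lin_span (weighted_exponential M) I"
  then obtain F c where *: "finite F" "F \<subseteq> I" "f = (\<lambda>z. \<Sum>i\<in>F. c i * weighted_exponential M i z)"
    by (auto simp: lin_span_def)
  then have "f = (\<lambda>z. M z * (\<Sum>i\<in>F. c i * char i z))"
    by (auto simp: weighted_exponential_eq sum_distrib_left mult_ac)
  moreover have "(\<lambda>z. \<Sum>i\<in>F. c i * char i z) \<in> lin_span char I"
    using * by (auto simp: lin_span_def)
  ultimately show "f \<in> (\<lambda>S z. M z * S z) ` lin_span char I" by (rule image_eqI)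
next
  fix f assume "f \<in> (\<lambda>S z. M z * S z) ` lin_span char I"
  then obtain F c where *: "finite F" "F \<subseteq> I" "f = (\<lambda>z. M z * (\<Sum>i\<in>F. c i * char i z))"
    by (auto simp: lin_span_def)
  then have "f = (\<lambda>z. \<Sum>i\<in>F. c i * weighted_exponential M i z)"
    by (auto simp: weighted_exponential_eq sum_distrib_left mult_ac)
  with *(1,2) show "f \<in> lin_span (weighted_exponential M) I"
    unfolding lin_span_def by blast
qed

lemma lin_span_char_measurable:
  assumes "S \<in> lin_span char I"
  shows "S \<in> borel_measurable torus"
  using assms by (auto simp: lin_span_def)

lemma lin_span_char_bounded:
  assumes "S \<in> lin_span char I"
  obtains B where "\<And>z. cmod (S z) \<le> B"
proof -
  obtain F c where *: "S = (\<lambda>z. \<Sum>i\<in>F. c i * char i z)"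
    using assms by (auto simp: lin_span_def)
  have "cmod (S z) \<le> (\<Sum>i\<in>F. cmod (c i))" for z
    unfolding * by (rule order_trans[OF norm_sum]) (simp add: norm_mult)
  then show thesis by (rule that)
qed

lemma lin_span_char_mult:
  assumes "f \<in> lin_span char UNIV" "g \<in> lin_span char UNIV"
  shows "(\<lambda>z. f z * g z) \<in> lin_span char UNIV"
proof -
  obtain F c G d where *: "finite F" "f = (\<lambda>z. \<Sum>i\<in>F. c i * char i z)"
    "finite G" "g = (\<lambda>z. \<Sum>i\<in>G. d i * char i z)"
    using assms by (auto simp: lin_span_def)
  have "(\<lambda>z. f z * g z) = (\<lambda>z. \<Sum>i\<in>F. \<Sum>j\<in>G. c i * (d j * char (i + j) z))"
    by (simp add: * sum_product char_add mult_ac)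
  also have "\<dots> \<in> lin_span char UNIV"
    by (intro lin_span_sum * lin_span_cmult lin_span_base) auto
  finally show ?thesis .
qed

section \<open>Approximation by trigonometric polynomials\<close>

lemma real_polynomial_on_torus:
  fixes g :: "complex \<times> complex \<Rightarrow> real"
  assumes "real_polynomial_function g"
  shows "(\<lambda>z. of_real (g (cis (fst z), cis (snd z)))) \<in> lin_span char UNIV"
  using assms
proof (induction rule: real_polynomial_function.induct)
  case (linear L)
  interpret bounded_linear L by fact
  have L: "L (z, w) = Re z * L (1, 0) + Im z * L (\<i>, 0) + Re w * L (0, 1) + Im w * L (0, \<i>)" for z w
  proof -
    have "(z, w) = Re z *\<^sub>R (1, 0) + Im z *\<^sub>R (\<i>, 0) + Re w *\<^sub>R (0, 1) + Im w *\<^sub>R (0, \<i>)"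
      by (simp add: complex_eq_iff)
    then show ?thesis by (simp only: add scaleR real_scaleR_def)
  qed
  have "(\<lambda>z. of_real (L (cis (fst z), cis (snd z)))) =
      (\<lambda>z. (of_real (L (1, 0)) / 2 + of_real (L (\<i>, 0)) / (2 * \<i>)) * char (1, 0) z
         + (of_real (L (1, 0)) / 2 - of_real (L (\<i>, 0)) / (2 * \<i>)) * char (-1, 0) z
         + (of_real (L (0, 1)) / 2 + of_real (L (0, \<i>)) / (2 * \<i>)) * char (0, 1) z
         + (of_real (L (0, 1)) / 2 - of_real (L (0, \<i>)) / (2 * \<i>)) * char (0, -1) z)"
    by (rule ext, subst L) (auto simp: char_def complex_eq_iff split: prod.split)
  also have "\<dots> \<in> lin_span char UNIV"
    by (intro lin_span_add lin_span_cmult lin_span_base) auto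
  finally show ?case .
next
  case (const c)
  have "(\<lambda>z. of_real c * char (0, 0) z) \<in> lin_span char UNIV"
    by (intro lin_span_cmult lin_span_base) auto
  then show ?case by simp
qed (auto intro: lin_span_add lin_span_char_mult)

text \<open>A continuous function on the closed square that vanishes on its boundary is a continuous
  function on the product of two unit circles, which is a compact subset of \<open>\<complex>\<^sup>2\<close>;
  restrictions of polynomials to that set are trigonometric polynomials.\<close>

lemma trig_polynomial_approx_continuous:
  fixes h :: "real \<times> real \<Rightarrow> complex"
  assumes cont: "continuous_on ({0..2 * pi} \<times> {0..2 * pi}) h"
    and bdry: "\<And>x y. x \<in> {0, 2 * pi} \<or> y \<in> {0, 2 * pi} \<Longrightarrow> h (x, y) = 0"
    and B: "\<And>z. cmod (h z) \<le> B" and e: "0 < e"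
  obtains T where "T \<in> lin_span char UNIV" "\<And>z. cmod (T z) \<le> B + e"
    "\<And>z. z \<in> circ \<times> circ \<Longrightarrow> cmod (h z - T z) < e"
proof -
  define Q where "Q = {0..2 * pi} \<times> {0..2 * pi}"
  define K where "K = sphere (0::complex) 1 \<times> sphere (0::complex) 1"
  define q where "q z = (cis (fst z), cis (snd z))" for z :: "real \<times> real"
  define H where "H w = h (Arg2pi (fst w), Arg2pi (snd w))" for w :: "complex \<times> complex"
  have qK: "q z \<in> K" for z by (auto simp: q_def K_def)
  have contq: "continuous_on Q q" unfolding q_def by (intro continuous_intros)
  have cis_Arg: "cis (Arg2pi z) = z" if "cmod z = 1" for z
    using complex_norm_eq_1_exp[of z] that by (simp add: cis_conv_exp)
  have "q ` Q = K"
  proof (intro equalityI subsetI)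
    fix w assume w: "w \<in> K"
    have "q (Arg2pi (fst w), Arg2pi (snd w)) = w"
      using w by (auto simp: q_def K_def cis_Arg)
    moreover have "(Arg2pi (fst w), Arg2pi (snd w)) \<in> Q"
      using Arg2pi[of "fst w"] Arg2pi[of "snd w"] by (auto simp: Q_def)
    ultimately show "w \<in> q ` Q" by (metis image_eqI)
  qed (use qK in auto)
  have Arg_cis: "Arg2pi (cis x) = x" if "0 \<le> x" "x < 2 * pi" for x
    using that Arg2pi_exp[of "\<i> * of_real x"] by (simp add: cis_conv_exp)
  have Hq: "H (q z) = h z" if "z \<in> Q" for z
  proof (cases "fst z < 2 * pi \<and> snd z < 2 * pi")
    case True
    then show ?thesis using that by (auto simp: H_def q_def Q_def Arg_cis)
  next
    case False
    have "Arg2pi (cis (2 * pi)) = 0" using Arg_cis[of 0] by simp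
    then have "H (q z) = 0" "h z = 0"
      using that False unfolding H_def q_def Q_def by (cases z; auto intro!: bdry)+
    then show ?thesis by simp
  qed
  have "quotient_map (top_of_set Q) (top_of_set K) q"
  proof (rule T1_Spaces.continuous_imp_quotient_map)
    show "continuous_map (top_of_set Q) (top_of_set K) q"
      using contq qK by auto
    show "compact_space (top_of_set Q)"
      unfolding Q_def by (simp add: compact_space_subtopology compact_Times)
    show "q ` topspace (top_of_set Q) = topspace (top_of_set K)"
      using \<open>q ` Q = K\<close> by simp
    show "Hausdorff_space (top_of_set K)"
      by (intro Hausdorff_space_subtopology Hausdorff_space_euclidean)
  qed
  moreover have "continuous_map (top_of_set Q) euclidean (H \<circ> q)"
  proof -
    have "continuous_on Q (H \<circ> q)"
      using cont Hq by (subst continuous_on_cong[where g = h]) (auto simp: Q_def)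
    then show ?thesis by simp
  qed
  ultimately have "continuous_map (top_of_set K) euclidean H"
    by (rule continuous_compose_quotient_map)
  then have "continuous_on K H" by simp
  moreover have "compact K" unfolding K_def by (intro compact_Times) auto
  ultimately obtain g where g: "polynomial_function g" "\<And>w. w \<in> K \<Longrightarrow> cmod (H w - g w) < e"
    using Stone_Weierstrass_polynomial_function[of K H e] e by auto
  define T where "T z = g (q z)" for z
  show thesis
  proof (rule that[of T])
    have "real_polynomial_function (\<lambda>w. Re (g w))" "real_polynomial_function (\<lambda>w. Im (g w))"
      using g(1) bounded_linear_Re bounded_linear_Im by (auto simp: polynomial_function_def o_def)
    then have "(\<lambda>z. of_real (Re (g (cis (fst z), cis (snd z)))) + \<i> * of_real (Im (g (cis (fst z), cis (snd z)))))
        \<in> lin_span char UNIV"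
      by (intro lin_span_add lin_span_cmult real_polynomial_on_torus[of "\<lambda>w. Re (g w)"]
          real_polynomial_on_torus[of "\<lambda>w. Im (g w)"])
    moreover have "T = (\<lambda>z. g (cis (fst z), cis (snd z)))"
      by (simp add: fun_eq_iff T_def q_def)
    ultimately show "T \<in> lin_span char UNIV"
      by (simp add: complex_eq[symmetric])
    show "cmod (T z) \<le> B + e" for z
    proof -
      have "cmod (T z) \<le> cmod (H (q z)) + cmod (H (q z) - g (q z))"
        using norm_triangle_sub[of "g (q z)" "H (q z)"] by (simp add: T_def norm_minus_commute)
      also have "\<dots> \<le> B + e"
        using g(2)[OF qK[of z]] B by (intro add_mono) (auto simp: H_def)
      finally show ?thesis .
    qed
    show "cmod (h z - T z) < e" if "z \<in> circ \<times> circ" for z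
      using g(2)[OF qK[of z]] Hq[of z] that by (auto simp: T_def circ_def Q_def)
  qed
qed

text \<open>A measurable function is almost everywhere a limit of continuous ones. These are pulled back
  into a disc to keep them uniformly bounded, and multiplied by a cut-off that vanishes on the
  boundary of the square so that they become continuous on the torus. The uniform bound is what
  allows dominated convergence against an arbitrary integrable weight.\<close>

lemma bounded_borel_limit_trig_polynomials:
  fixes f :: "real \<times> real \<Rightarrow> complex"
  assumes f: "f \<in> borel_measurable torus" and B: "\<And>z. cmod (f z) \<le> B"
  obtains T where "\<And>n. T n \<in> lin_span char UNIV" "\<And>n z. cmod (T n z) \<le> B + 2"
    "AE z in torus. (\<lambda>n. T n z) \<longlonglongrightarrow> f z"
proof -
  have B0: "0 \<le> B" using B[of undefined] norm_ge_zero order_trans by blast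
  have "f \<in> borel_measurable lebesgue"
    using f by (auto simp: borel_measurable_torus_iff intro: measurable_completion)
  then have "f measurable_on UNIV" by (intro lebesgue_measurable_imp_measurable_on) auto
  then obtain N g where N: "negligible N" and g: "\<And>n. continuous_on UNIV (g n)"
    and lim: "\<And>z. z \<notin> N \<Longrightarrow> (\<lambda>n. g n z) \<longlonglongrightarrow> f z"
    by (auto simp: measurable_on_def)
  define \<eta> where "\<eta> n x = min 1 (max 0 (real n * min x (2 * pi - x)))" for n x
  \<comment> \<open>The radius \<open>B + 1\<close> instead of \<open>B\<close> keeps the denominator positive.\<close>
  define clamp where "clamp w = ((B + 1) / max (B + 1) (cmod w)) *\<^sub>R w" for w :: complex
  define h where "h n z = of_real (\<eta> n (fst z) * \<eta> n (snd z)) * clamp (g n z)" for n z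
  have \<eta>: "0 \<le> \<eta> n x" "\<eta> n x \<le> 1" for n x by (auto simp: \<eta>_def)
  have clamp: "cmod (clamp w) \<le> B + 1" for w
    using B0 by (simp add: clamp_def divide_le_eq max_def mult_left_mono)
  have cont_clamp: "continuous_on A clamp" for A
    unfolding clamp_def using B0 by (intro continuous_intros) (auto simp: max_def)
  have h: "cmod (h n z) \<le> B + 1" for n z
  proof -
    have "\<bar>\<eta> n (fst z) * \<eta> n (snd z)\<bar> \<le> 1"
      using \<eta> by (simp add: abs_mult mult_le_one)
    then have "cmod (h n z) \<le> 1 * (B + 1)"
      unfolding h_def norm_mult using clamp by (intro mult_mono) (auto simp: norm_mult abs_mult)
    then show ?thesis by simp
  qed
  have cont_h: "continuous_on A (h n)" for A n
    unfolding h_def \<eta>_def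
    by (intro continuous_intros continuous_on_compose2[OF cont_clamp[of UNIV]]
        continuous_on_subset[OF g]) auto
  have bdry: "h n (x, y) = 0" if "x \<in> {0, 2 * pi} \<or> y \<in> {0, 2 * pi}" for n x y
    using that by (auto simp: h_def \<eta>_def)
  have "\<forall>n. \<exists>T. T \<in> lin_span char UNIV \<and> (\<forall>z. cmod (T z) \<le> B + 1 + 1 / real (n + 1)) \<and>
      (\<forall>z\<in>circ \<times> circ. cmod (h n z - T z) < 1 / real (n + 1))"
  proof
    fix n :: nat
    have e: "0 < 1 / real (n + 1)" by simp
    show "\<exists>T. T \<in> lin_span char UNIV \<and> (\<forall>z. cmod (T z) \<le> B + 1 + 1 / real (n + 1)) \<and>
      (\<forall>z\<in>circ \<times> circ. cmod (h n z - T z) < 1 / real (n + 1))"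
      by (rule trig_polynomial_approx_continuous[OF cont_h bdry h e]) (rule exI conjI allI ballI | assumption)+
  qed
  from choice[OF this] obtain T where T: "\<And>n. T n \<in> lin_span char UNIV"
      "\<And>n z. cmod (T n z) \<le> B + 1 + 1 / real (n + 1)"
      "\<And>n z. z \<in> circ \<times> circ \<Longrightarrow> cmod (h n z - T n z) < 1 / real (n + 1)"
    by blast
  have \<eta>_lim: "(\<lambda>n. \<eta> n x) \<longlonglongrightarrow> 1" if "0 < x" "x < 2 * pi" for x
  proof (rule tendsto_eventually)
    define m where "m = min x (2 * pi - x)"
    have m: "0 < m" using that by (simp add: m_def)
    obtain k :: nat where k: "1 / m \<le> real k" using real_arch_simple by blast
    have "\<eta> n x = 1" if "k \<le> n" for n
    proof -
      have "1 / m \<le> real n" using k that by simp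
      then have "1 \<le> real n * m" using m by (simp add: field_simps)
      then show ?thesis by (simp add: \<eta>_def flip: m_def)
    qed
    then show "\<forall>\<^sub>F n in sequentially. \<eta> n x = 1" by (auto simp: eventually_sequentially)
  qed
  have h_lim: "(\<lambda>n. h n z) \<longlonglongrightarrow> f z" if "z \<notin> N" "z \<in> circ \<times> circ" "fst z \<noteq> 0" "snd z \<noteq> 0" for z
  proof -
    have "isCont clamp (f z)"
      using cont_clamp[of UNIV] by (simp add: continuous_on_eq_continuous_at)
    then have "(\<lambda>n. clamp (g n z)) \<longlonglongrightarrow> clamp (f z)"
      using lim[OF that(1)] by (rule isCont_tendsto_compose)
    moreover have "clamp (f z) = f z"
      using B[of z] B0 by (simp add: clamp_def max_def)
    moreover have "(\<lambda>n. \<eta> n (fst z)) \<longlonglongrightarrow> 1" "(\<lambda>n. \<eta> n (snd z)) \<longlonglongrightarrow> 1"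
      using that by (auto intro!: \<eta>_lim simp: circ_def)
    ultimately have "(\<lambda>n. h n z) \<longlonglongrightarrow> of_real (1 * 1) * f z"
      unfolding h_def by (intro tendsto_intros) simp_all
    then show ?thesis by simp
  qed
  have "AE z in lborel. z \<notin> N"
    using N AE_not_in[of N lebesgue] by (simp add: negligible_iff_null_sets AE_completion_iff)
  then have "AE z in torus. z \<notin> N"
    unfolding torus_eq_density
    by (subst AE_density) (auto intro: borel_measurable_indicator simp: circ_Times_borel)
  then have "AE z in torus. (\<lambda>n. T n z) \<longlonglongrightarrow> f z"
    using AE_torus_circ AE_torus_fst[OF AE_circle_neq[of 0]] AE_torus_snd[OF AE_circle_neq[of 0]]
  proof eventually_elim
    case (elim z)
    have "(\<lambda>n. h n z - T n z) \<longlonglongrightarrow> 0"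
    proof (rule tendsto_norm_zero_cancel,
        rule tendsto_sandwich[where f = "\<lambda>_. 0" and h = "\<lambda>n. 1 / real (n + 1)"])
      show "\<forall>\<^sub>F n in sequentially. cmod (h n z - T n z) \<le> 1 / real (n + 1)"
        by (intro always_eventually allI less_imp_le T(3) elim(2))
      show "(\<lambda>n. 1 / real (n + 1)) \<longlonglongrightarrow> 0"
        using LIMSEQ_inverse_real_of_nat by (simp add: inverse_eq_divide)
    qed auto
    from tendsto_diff[OF h_lim[OF elim] this] show ?case by simp
  qed
  moreover have "cmod (T n z) \<le> B + 2" for n z
    using T(2)[of n z] by (rule order_trans) simp
  ultimately show thesis using T(1) by (intro that) auto
qed

definition off_axis :: "(int \<times> int) set" where
  "off_axis = UNIV - {0} \<times> UNIV"

text \<open>Subtracting the mean over \<open>x\<close> from a trigonometric polynomial removes exactly the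
  frequencies with first coordinate zero.\<close>

lemma subtract_mean_trig_polynomial:
  assumes "T \<in> lin_span char UNIV"
  shows "(\<lambda>z. T z - (\<integral>x. T (x, snd z) \<partial>circle) / (2 * pi)) \<in> lin_span char off_axis"
proof -
  obtain F c where T: "finite F" "T = (\<lambda>z. \<Sum>i\<in>F. c i * char i z)"
    using assms by (auto simp: lin_span_def)
  have mean: "(\<integral>x. char i (x, y) \<partial>circle) = (if fst i = 0 then 2 * pi * char i (x, y) else 0)" for i x y
    by (cases i) (simp add: char_apply integral_cis_circle)
  have int: "integrable circle (\<lambda>x. c i * char i (x, y))" for i y
    by (rule integrable_bounded_circle[where B = "cmod (c i)"]) (auto simp: norm_mult)
  have "T z - (\<integral>x. T (x, snd z) \<partial>circle) / (2 * pi) = (\<Sum>i\<in>F \<inter> off_axis. c i * char i z)" for z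
  proof -
    have "(\<integral>x. T (x, snd z) \<partial>circle) / (2 * pi)
        = (\<Sum>i\<in>F. c i * (if fst i = 0 then char i z else 0))"
      unfolding T(2)
      by (subst Bochner_Integration.integral_sum[OF int])
        (auto simp: mean[where x = "fst z"] sum_divide_distrib intro!: sum.cong)
    then have "T z - (\<integral>x. T (x, snd z) \<partial>circle) / (2 * pi)
        = (\<Sum>i\<in>F. c i * char i z - c i * (if fst i = 0 then char i z else 0))"
      by (simp add: T(2) sum_subtractf)
    also have "\<dots> = (\<Sum>i\<in>F. if i \<in> off_axis then c i * char i z else 0)"
      by (intro sum.cong) (auto simp: off_axis_def)
    also have "\<dots> = (\<Sum>i\<in>F \<inter> off_axis. c i * char i z)"
      using T(1) by (simp add: sum.If_cases)
    finally show ?thesis .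
  qed
  then show ?thesis
    unfolding lin_span_def using T(1) by (intro CollectI exI[of _ "F \<inter> off_axis"] exI[of _ c]) auto
qed

text \<open>On almost every line the means over \<open>x\<close> of the approximating polynomials tend to the mean of
  \<open>f\<close>, which is zero, so they can be subtracted.\<close>

lemma mean_zero_limit_trig_polynomials:
  fixes f :: "real \<times> real \<Rightarrow> complex"
  assumes [measurable]: "f \<in> borel_measurable torus" and B: "\<And>z. cmod (f z) \<le> B"
    and mean: "\<And>y. (\<integral>x. f (x, y) \<partial>circle) = 0"
  obtains S where "\<And>n. S n \<in> lin_span char off_axis" "\<And>n z. cmod (S n z) \<le> 2 * (B + 2)"
    "AE z in torus. (\<lambda>n. S n z) \<longlonglongrightarrow> f z"
proof -
  obtain T where T: "\<And>n. T n \<in> lin_span char UNIV" "\<And>n z. cmod (T n z) \<le> B + 2"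
    "AE z in torus. (\<lambda>n. T n z) \<longlonglongrightarrow> f z"
    using bounded_borel_limit_trig_polynomials[OF assms(1) B] by blast
  have [measurable]: "T n \<in> borel_measurable torus" for n
    by (rule lin_span_char_measurable[OF T(1)])
  define A where "A n y = (\<integral>x. T n (x, y) \<partial>circle) / (2 * pi)" for n y
  define S where "S n z = T n z - A n (snd z)" for n z
  have A: "cmod (A n y) \<le> B + 2" for n y
    using norm_integral_circle_le[of "\<lambda>x. T n (x, y)" "B + 2"] T(2)
    by (simp add: A_def norm_divide field_simps)
  have "AE y in circle. (\<lambda>n. A n y) \<longlonglongrightarrow> 0"
    using AE_torus_iterated[OF T(3)]
  proof eventually_elim
    case (elim y)
    have "(\<lambda>n. \<integral>x. T n (x, y) \<partial>circle) \<longlonglongrightarrow> (\<integral>x. f (x, y) \<partial>circle)"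
      by (rule integral_dominated_convergence[where w = "\<lambda>_. B + 2"]) (use elim T(2) in auto)
    then have "(\<lambda>n. A n y) \<longlonglongrightarrow> 0 / of_real (2 * pi)"
      unfolding A_def mean by (intro tendsto_intros) auto
    then show ?case by simp
  qed
  from AE_torus_snd[OF this] T(3) have "AE z in torus. (\<lambda>n. S n z) \<longlonglongrightarrow> f z"
  proof eventually_elim
    case (elim z)
    from tendsto_diff[OF elim(2,1)] show ?case by (simp add: S_def)
  qed
  moreover have "cmod (S n z) \<le> 2 * (B + 2)" for n z
    using norm_triangle_ineq4[of "T n z" "A n (snd z)"] T(2)[of n z] A[of n "snd z"]
    by (simp add: S_def)
  moreover have "S n \<in> lin_span char off_axis" for n
    using subtract_mean_trig_polynomial[OF T(1)] by (simp add: S_def[abs_def] A_def)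
  ultimately show thesis by (intro that)
qed

section \<open>Averaging kernels that are small against the weight\<close>

locale weight =
  fixes p :: real and M :: "real \<times> real \<Rightarrow> complex"
  assumes p_ge_1: "1 \<le> p"
    and M_measurable [measurable]: "M \<in> borel_measurable torus"
    and M_integrable: "p_integral torus p M < \<infinity>"

text \<open>\<open>1 / M\<close> is zero where \<open>M\<close> vanishes, so that its integrability over a strip is meaningful
  only together with \<open>M \<noteq> 0\<close> almost everywhere.\<close>

definition strip_singular :: "real \<Rightarrow> (real \<times> real \<Rightarrow> complex) \<Rightarrow> bool" where
  "strip_singular p M \<longleftrightarrow>
     (\<forall>E\<in>sets borel. conj_integrable torus p (\<lambda>z. indicator E (snd z) / M z) \<longrightarrow> emeasure circle E = 0)"

locale singular_weight = weight +
  assumes M_nonzero: "AE z in torus. M z \<noteq> 0"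
    and singular: "strip_singular p M"

lemma emeasure_decseq_less:
  assumes A: "\<And>n. A n \<in> sets borel" "decseq A" "emeasure circle (\<Inter>n. A n) = 0" and e: "0 < e"
  obtains n :: nat where "emeasure circle (A n) < ennreal e"
proof -
  have "(\<lambda>n. emeasure circle (A n)) \<longlonglongrightarrow> emeasure circle (\<Inter>n. A n)"
    by (rule Lim_emeasure_decseq) (use A in \<open>auto simp: sets_circle circle.emeasure_finite\<close>)
  then have "\<forall>\<^sub>F n in sequentially. emeasure circle (A n) < ennreal e"
    using A(3) e by (intro order_tendstoD) auto
  then show thesis using that by (auto simp: eventually_sequentially)
qed

context weight
begin

text \<open>The function \<open>u\<close> averages over \<open>x\<close> on the lines with ordinate in \<open>B\<close>.\<close>

definition averaging_kernel :: "real \<Rightarrow> (real \<times> real \<Rightarrow> real) \<Rightarrow> real set \<Rightarrow> bool" where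
  "averaging_kernel e u B \<longleftrightarrow>
     u \<in> borel_measurable torus \<and> B \<in> sets borel \<and> (\<forall>z. 0 \<le> u z) \<and> (\<exists>K. \<forall>z. u z \<le> K) \<and>
     (\<forall>y. (\<integral>x. u (x, y) \<partial>circle) = indicator B y) \<and>
     emeasure circle (- B) < ennreal e \<and>
     p_integral torus p (\<lambda>z. of_real (u z) * M z) < ennreal e"

text \<open>Normalising \<open>v\<close> to have mean one over \<open>x\<close>, on those horizontal lines where its mean is
  bounded below.\<close>

lemma averaging_kernel_normalise:
  fixes v :: "real \<times> real \<Rightarrow> real"
  defines "I \<equiv> \<lambda>y. \<integral>x. v (x, y) \<partial>circle"
  assumes [measurable]: "v \<in> borel_measurable torus"
    and v: "\<And>z. 0 \<le> v z" "\<And>z. v z \<le> K"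
    and \<kappa>: "0 < \<kappa>" "emeasure circle {y. I y < \<kappa>} < ennreal e"
    and \<eta>: "0 \<le> \<eta>" "2 * pi * \<eta> < e"
    and small: "\<And>y. \<kappa> \<le> I y \<Longrightarrow>
        (\<integral>\<^sup>+x. ennreal ((v (x, y) * cmod (M (x, y))) powr p) \<partial>circle) \<le> ennreal (\<eta> * I y powr p)"
  shows "\<exists>u B. averaging_kernel e u B"
proof -
  define B where "B = {y. \<kappa> \<le> I y}"
  define u where "u z = indicator B (snd z) * (v z / I (snd z))" for z
  have [measurable]: "I \<in> borel_measurable circle" unfolding I_def by measurable
  have [measurable]: "I \<in> borel_measurable borel"
    using \<open>I \<in> borel_measurable circle\<close> by (simp add: borel_measurable_circle_iff)
  have [measurable]: "B \<in> sets borel" unfolding B_def by measurable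
  have [measurable]: "u \<in> borel_measurable torus" unfolding u_def by measurable
  have u: "0 \<le> u z" "u z \<le> K / \<kappa>" for z
  proof -
    have "0 \<le> K" using v[of z] by simp
    show "0 \<le> u z" using v \<kappa> by (auto simp: u_def B_def indicator_def)
    show "u z \<le> K / \<kappa>"
      using v[of z] \<kappa> \<open>0 \<le> K\<close> by (auto simp: u_def B_def indicator_def intro: frac_le)
  qed
  have mean: "(\<integral>x. u (x, y) \<partial>circle) = indicator B y" for y
    using \<kappa>(1) by (auto simp: u_def B_def indicator_def I_def)
  have "p_integral torus p (\<lambda>z. of_real (u z) * M z)
      = (\<integral>\<^sup>+y. (\<integral>\<^sup>+x. ennreal (cmod (of_real (u (x, y)) * M (x, y)) powr p) \<partial>circle) \<partial>circle)"
    unfolding p_integral_def by (rule torus.nn_integral_snd[symmetric]) measurable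
  also have "\<dots> \<le> (\<integral>\<^sup>+y. ennreal \<eta> \<partial>circle)"
  proof (rule nn_integral_mono)
    fix y
    show "(\<integral>\<^sup>+x. ennreal (cmod (of_real (u (x, y)) * M (x, y)) powr p) \<partial>circle) \<le> ennreal \<eta>"
    proof (cases "\<kappa> \<le> I y")
      case True
      then have I: "0 < I y" using \<kappa> by simp
      have "(\<integral>\<^sup>+x. ennreal (cmod (of_real (u (x, y)) * M (x, y)) powr p) \<partial>circle)
          = (\<integral>\<^sup>+x. ennreal (1 / I y powr p) * ennreal ((v (x, y) * cmod (M (x, y))) powr p) \<partial>circle)"
        using True I v p_ge_1
        by (intro nn_integral_cong)
          (simp add: u_def B_def norm_mult norm_divide powr_divide powr_mult flip: ennreal_mult)
      also have "\<dots> = ennreal (1 / I y powr p) * (\<integral>\<^sup>+x. ennreal ((v (x, y) * cmod (M (x, y))) powr p) \<partial>circle)"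
        by (rule nn_integral_cmult) measurable
      also have "\<dots> \<le> ennreal (1 / I y powr p) * ennreal (\<eta> * I y powr p)"
        by (intro mult_left_mono small True) auto
      also have "\<dots> = ennreal \<eta>"
        using I \<eta> by (simp flip: ennreal_mult)
      finally show ?thesis .
    next
      case False
      then show ?thesis using p_ge_1 by (simp add: u_def B_def)
    qed
  qed
  also have "\<dots> = ennreal (2 * pi * \<eta>)"
    using \<eta> by (simp add: emeasure_circle_UNIV mult.commute flip: ennreal_mult)
  also have "\<dots> < ennreal e"
    using \<eta> by (intro ennreal_lessI le_less_trans[OF _ \<eta>(2)]) auto
  finally have "p_integral torus p (\<lambda>z. of_real (u z) * M z) < ennreal e" .
  moreover have "- B = {y. I y < \<kappa>}" by (auto simp: B_def)
  ultimately have "averaging_kernel e u B"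
    unfolding averaging_kernel_def using u mean \<kappa>(2) by auto
  then show ?thesis by blast
qed

end

context singular_weight
begin

text \<open>For exponent one the weight has essential infimum zero on almost every horizontal line, and
  the kernel averages over the part of the line where the weight is small.\<close>

lemma averaging_kernel_exists_1:
  assumes p1: "p = 1" and e: "0 < e"
  shows "\<exists>u B. averaging_kernel e u B"
proof -
  define \<delta> where "\<delta> = e / (4 * pi)"
  have \<delta>: "0 < \<delta>" "2 * pi * \<delta> < e" using e by (auto simp: \<delta>_def)
  define v where "v z = (if cmod (M z) < \<delta> then 1 else 0 :: real)" for z
  define I where "I y = (\<integral>x. v (x, y) \<partial>circle)" for y
  have [measurable]: "v \<in> borel_measurable torus" unfolding v_def by measurable
  have "I \<in> borel_measurable circle" unfolding I_def by measurable
  then have [measurable]: "I \<in> borel_measurable borel"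
    by (simp add: borel_measurable_circle_iff)
  have v: "0 \<le> v z" "v z \<le> 1" for z by (auto simp: v_def)
  have I0: "0 \<le> I y" for y unfolding I_def using v by (intro integral_nonneg_AE) auto
  have nnI: "(\<integral>\<^sup>+x. ennreal (v (x, y)) \<partial>circle) = ennreal (I y)" for y
    unfolding I_def
    by (rule nn_integral_eq_integral)
      (use v in \<open>auto intro!: circle.integrable_const_bound[where B = 1]\<close>)
  define E where "E = {y. I y = 0}"
  have [measurable]: "E \<in> sets borel" unfolding E_def by measurable
  have "emeasure circle E = 0"
  proof -
    have "(\<integral>\<^sup>+z. indicator E (snd z) * ennreal (v z) \<partial>torus)
        = (\<integral>\<^sup>+y. (\<integral>\<^sup>+x. indicator E y * ennreal (v (x, y)) \<partial>circle) \<partial>circle)"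
      by (subst torus.nn_integral_snd[symmetric]) (auto simp: sets_circle)
    also have "\<dots> = (\<integral>\<^sup>+y. indicator E y * ennreal (I y) \<partial>circle)"
      by (simp add: nn_integral_cmult nnI)
    also have "\<dots> = 0"
      by (subst nn_integral_0_iff_AE) (auto simp: E_def indicator_def)
    finally have "AE z in torus. indicator E (snd z) * ennreal (v z) = 0"
      by (subst (asm) nn_integral_0_iff_AE) (auto simp: sets_circle)
    then have "AE z in torus. cmod (indicator E (snd z) / M z) \<le> 1 / \<delta>"
    proof eventually_elim
      case (elim z)
      then have "snd z \<notin> E \<or> \<delta> \<le> cmod (M z)"
        by (auto simp: v_def indicator_def split: if_splits)
      then show ?case
        using \<delta> by (auto simp: indicator_def norm_divide intro: frac_le)
    qed
    then have "conj_integrable torus p (\<lambda>z. indicator E (snd z) / M z)"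
      using p1 by (auto simp: conj_integrable_def)
    then show ?thesis using singular by (auto simp: strip_singular_def)
  qed
  moreover have "(\<Inter>n. {y. I y < 1 / real (n + 1)}) = E"
  proof (intro equalityI subsetI)
    fix y assume "y \<in> (\<Inter>n. {y. I y < 1 / real (n + 1)})"
    then have *: "I y < 1 / real (n + 1)" for n by auto
    have "\<not> 0 < I y"
    proof
      assume "0 < I y"
      then obtain n where "1 / real (Suc n) < I y" by (rule nat_approx_posE)
      with *[of n] show False by simp
    qed
    then show "y \<in> E" using I0[of y] by (simp add: E_def)
  qed (auto simp: E_def)
  ultimately have inter: "emeasure circle (\<Inter>n. {y. I y < 1 / real (n + 1)}) = 0" by simp
  have dec: "decseq (\<lambda>n. {y. I y < 1 / real (n + 1)})"
    by (auto simp: decseq_def elim!: less_le_trans intro!: frac_le)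
  obtain n where n: "emeasure circle {y. I y < 1 / real (n + 1)} < ennreal e"
    by (rule emeasure_decseq_less[OF _ dec inter e]) measurable
  show ?thesis
  proof (rule averaging_kernel_normalise[where v = v and K = 1 and \<kappa> = "1 / real (n + 1)" and \<eta> = \<delta>])
    fix y
    have "(\<integral>\<^sup>+x. ennreal ((v (x, y) * cmod (M (x, y))) powr p) \<partial>circle) \<le> (\<integral>\<^sup>+x. ennreal \<delta> * ennreal (v (x, y)) \<partial>circle)"
      using \<delta> p1 by (intro nn_integral_mono) (auto simp: v_def intro!: ennreal_leI)
    also have "\<dots> = ennreal (\<delta> * I y powr p)"
      using \<delta> I0[of y] p1 by (simp add: nn_integral_cmult nnI ennreal_mult)
    finally show "(\<integral>\<^sup>+x. ennreal ((v (x, y) * cmod (M (x, y))) powr p) \<partial>circle)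
        \<le> ennreal (\<delta> * (\<integral>x. v (x, y) \<partial>circle) powr p)"
      by (simp add: I_def)
  qed (use n v \<delta> in \<open>auto simp flip: I_def\<close>)
qed

text \<open>For \<open>p > 1\<close> the kernel is proportional to a truncation \<open>v\<close> of \<open>\<bar>M\<bar>\<^sup>-\<^sup>q\<close>, the extremal
  function for minimising \<open>\<integral> \<bar>u M\<bar>\<^sup>p\<close> under \<open>\<integral> u = 1\<close>. Since \<open>(v \<bar>M\<bar>)\<^sup>p \<le> v\<close>, the minimum is
  at most the power \<open>1 - p\<close> of \<open>\<integral> v\<close>, and \<open>\<integral> v\<close> is unbounded on almost every line.\<close>

lemma averaging_kernel_exists_gt_1:
  assumes p1: "1 < p" and e: "0 < e"
  shows "\<exists>u B. averaging_kernel e u B"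
proof -
  define q where "q = p / (p - 1)"
  have q: "0 < q" "q * (p - 1) = p" using p1 by (auto simp: q_def)
  \<comment> \<open>The kernel costs at most \<open>2 * pi * \<kappa> powr (1 - p)\<close>, which is \<open>e / 2\<close> for this \<open>\<kappa>\<close>.\<close>
  define \<kappa> where "\<kappa> = (e / (4 * pi)) powr (1 / (1 - p))"
  have \<kappa>: "0 < \<kappa>" "\<kappa> powr (1 - p) = e / (4 * pi)"
    using e p1 by (auto simp: \<kappa>_def powr_powr)
  define w where "w z = cmod (M z) powr (- q)" for z
  define v where "v n z = min (real n) (w z)" for n z
  define I where "I n y = (\<integral>x. v n (x, y) \<partial>circle)" for n y
  have [measurable]: "w \<in> borel_measurable torus" unfolding w_def by measurable
  have [measurable]: "v n \<in> borel_measurable torus" for n unfolding v_def by measurable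
  have "I n \<in> borel_measurable circle" for n unfolding I_def by measurable
  then have [measurable]: "I n \<in> borel_measurable borel" for n
    by (simp add: borel_measurable_circle_iff)
  have v: "0 \<le> v n z" "v n z \<le> real n" for n z by (auto simp: v_def w_def)
  have intv: "integrable circle (\<lambda>x. v n (x, y))" for n y
    by (rule circle.integrable_const_bound[where B = "real n"]) (use v in auto)
  have nnI: "(\<integral>\<^sup>+x. ennreal (v n (x, y)) \<partial>circle) = ennreal (I n y)" for n y
    unfolding I_def by (rule nn_integral_eq_integral[OF intv]) (use v in auto)
  have I_mono: "I n y \<le> I m y" if "n \<le> m" for n m y
    unfolding I_def using that by (intro integral_mono intv) (auto simp: v_def)
  define E where "E = (\<Inter>n. {y. I n y < \<kappa>})"
  have [measurable]: "E \<in> sets borel" unfolding E_def by measurable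
  have "emeasure circle E = 0"
  proof -
    have w_SUP: "ennreal (w z) = (SUP n. ennreal (v n z))" for z
    proof (rule antisym)
      obtain n where "w z \<le> real n" using real_arch_simple by blast
      then show "ennreal (w z) \<le> (SUP n. ennreal (v n z))"
        by (intro SUP_upper2[of n]) (auto simp: v_def)
      show "(SUP n. ennreal (v n z)) \<le> ennreal (w z)"
        by (intro SUP_least ennreal_leI) (simp add: v_def)
    qed
    have line: "(\<integral>\<^sup>+x. ennreal (w (x, y)) \<partial>circle) \<le> ennreal \<kappa>" if "y \<in> E" for y
    proof -
      have "(\<integral>\<^sup>+x. ennreal (w (x, y)) \<partial>circle) = (SUP n. \<integral>\<^sup>+x. ennreal (v n (x, y)) \<partial>circle)"
        unfolding w_SUP
        by (rule nn_integral_monotone_convergence_SUP)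
          (auto simp: incseq_def le_fun_def v_def intro!: ennreal_leI)
      also have "\<dots> \<le> ennreal \<kappa>"
        unfolding nnI using that by (intro SUP_least ennreal_leI less_imp_le) (auto simp: E_def)
      finally show ?thesis .
    qed
    have "p_integral torus q (\<lambda>z. indicator E (snd z) / M z)
        = (\<integral>\<^sup>+z. indicator E (snd z) * ennreal (w z) \<partial>torus)"
      unfolding p_integral_def
      by (rule nn_integral_cong)
        (use q in \<open>auto simp: indicator_def w_def norm_divide powr_divide powr_minus_divide\<close>)
    also have "\<dots> = (\<integral>\<^sup>+y. (\<integral>\<^sup>+x. indicator E y * ennreal (w (x, y)) \<partial>circle) \<partial>circle)"
      by (subst torus.nn_integral_snd[symmetric]) (auto simp: sets_circle)
    also have "\<dots> \<le> (\<integral>\<^sup>+y. ennreal \<kappa> \<partial>circle)"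
      by (intro nn_integral_mono) (auto simp: indicator_def line)
    also have "\<dots> < \<infinity>"
      by (simp add: emeasure_circle_UNIV ennreal_mult_less_top)
    finally have "conj_integrable torus p (\<lambda>z. indicator E (snd z) / M z)"
      using p1 by (simp add: conj_integrable_def q_def)
    then show ?thesis using singular by (auto simp: strip_singular_def)
  qed
  then have inter: "emeasure circle (\<Inter>n. {y. I n y < \<kappa>}) = 0" by (simp add: E_def)
  have dec: "decseq (\<lambda>n. {y. I n y < \<kappa>})"
    by (auto simp: decseq_def intro: le_less_trans[OF I_mono])
  obtain n where n: "emeasure circle {y. I n y < \<kappa>} < ennreal e"
    by (rule emeasure_decseq_less[OF _ dec inter e]) measurable
  show ?thesis
  proof (rule averaging_kernel_normalise[where v = "v n" and K = "real n" and \<kappa> = \<kappa> and \<eta> = "\<kappa> powr (1 - p)"])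
    fix y assume y: "\<kappa> \<le> (\<integral>x. v n (x, y) \<partial>circle)"
    then have I: "\<kappa> \<le> I n y" by (simp add: I_def)
    have "(v n z * cmod (M z)) powr p \<le> v n z" for z
    proof (cases "v n z = 0")
      case False
      then have pos: "0 < v n z" using v[of n z] by simp
      then have M: "0 < cmod (M z)" by (auto simp: v_def w_def min_def split: if_splits)
      have "v n z powr (p - 1) \<le> w z powr (p - 1)"
        using p1 pos by (intro powr_mono2) (auto simp: v_def)
      also have "\<dots> = cmod (M z) powr (- p)"
        using q by (simp add: w_def powr_powr)
      finally have "v n z powr (p - 1) * cmod (M z) powr p \<le> 1"
        using M by (simp add: powr_minus_divide field_simps)
      then have "v n z * (v n z powr (p - 1) * cmod (M z) powr p) \<le> v n z"
        using pos by (simp add: mult_le_cancel_left1)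
      then show ?thesis
        using pos powr_mult_base[of "v n z" "p - 1"] by (simp add: powr_mult mult.assoc[symmetric])
    qed (use p1 in simp)
    then have "(\<integral>\<^sup>+x. ennreal ((v n (x, y) * cmod (M (x, y))) powr p) \<partial>circle) \<le> (\<integral>\<^sup>+x. ennreal (v n (x, y)) \<partial>circle)"
      by (intro nn_integral_mono ennreal_leI)
    also have "\<dots> = ennreal (I n y)" by (rule nnI)
    also have "\<dots> \<le> ennreal (\<kappa> powr (1 - p) * I n y powr p)"
    proof (rule ennreal_leI)
      have pos: "0 < I n y" using I \<kappa> by simp
      have "I n y = I n y powr (1 - p) * I n y powr p"
        using pos by (simp flip: powr_add)
      also have "\<dots> \<le> \<kappa> powr (1 - p) * I n y powr p"
        using I \<kappa> p1 by (intro mult_right_mono powr_mono2') auto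
      finally show "I n y \<le> \<kappa> powr (1 - p) * I n y powr p" .
    qed
    finally show "(\<integral>\<^sup>+x. ennreal ((v n (x, y) * cmod (M (x, y))) powr p) \<partial>circle)
        \<le> ennreal (\<kappa> powr (1 - p) * (\<integral>x. v n (x, y) \<partial>circle) powr p)"
      by (simp add: I_def)
  qed (use n v \<kappa> e in \<open>auto simp flip: I_def\<close>)
qed

lemma averaging_kernel_exists:
  assumes "0 < e"
  shows "\<exists>u B. averaging_kernel e u B"
  using averaging_kernel_exists_1[OF _ assms] averaging_kernel_exists_gt_1[OF _ assms] p_ge_1
  by (cases "p = 1") auto

end

text \<open>The geometric rates make almost every line belong to all but finitely many of the sets \<open>B n\<close>,
  and they will make the differences of successive symbols summable.\<close>

locale averaging_kernels = weight +
  fixes u :: "nat \<Rightarrow> real \<times> real \<Rightarrow> real" and B :: "nat \<Rightarrow> real set"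
  assumes u_measurable [measurable]: "\<And>n. u n \<in> borel_measurable torus"
    and B_measurable [measurable]: "\<And>n. B n \<in> sets borel"
    and u_nonneg: "\<And>n z. 0 \<le> u n z"
    and u_bounded: "\<And>n. \<exists>K. \<forall>z. u n z \<le> K"
    and u_mean: "\<And>n y. (\<integral>x. u n (x, y) \<partial>circle) = indicator (B n) y"
    and B_large: "\<And>n. emeasure circle (- B n) \<le> ennreal ((1 / 4) ^ n)"
    and u_small: "\<And>n. p_integral torus p (\<lambda>z. of_real (u n z) * M z) \<le> ennreal (((1 / 4) ^ n) powr p)"

lemma (in singular_weight) averaging_kernels_exist:
  "\<exists>u B. averaging_kernels p M u B"
proof -
  define e :: "nat \<Rightarrow> real" where "e n = ((1 / 4) ^ n) powr p" for n
  have e: "0 < e n" "e n \<le> (1 / 4) ^ n" for n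
  proof -
    show "0 < e n" by (simp add: e_def)
    have "e n \<le> ((1 / 4) ^ n) powr 1"
      unfolding e_def using p_ge_1 by (intro powr_mono') (auto simp: power_le_one)
    then show "e n \<le> (1 / 4) ^ n" by simp
  qed
  have "\<forall>n. \<exists>uB. averaging_kernel (e n) (fst uB) (snd uB)"
    using averaging_kernel_exists[OF e(1)] by auto
  from choice[OF this] obtain uB where uB: "\<And>n. averaging_kernel (e n) (fst (uB n)) (snd (uB n))"
    by blast
  have "averaging_kernels p M (\<lambda>n. fst (uB n)) (\<lambda>n. snd (uB n))"
  proof unfold_locales
    fix n
    have *: "averaging_kernel (e n) (fst (uB n)) (snd (uB n))" by (rule uB)
    have "ennreal (e n) \<le> ennreal ((1 / 4) ^ n)" using e by (intro ennreal_leI)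
    moreover have "emeasure circle (- snd (uB n)) \<le> ennreal (e n)"
      using * by (auto simp: averaging_kernel_def)
    ultimately show "emeasure circle (- snd (uB n)) \<le> ennreal ((1 / 4) ^ n)"
      by (rule order_trans[rotated])
    show "p_integral torus p (\<lambda>z. of_real (fst (uB n) z) * M z) \<le> ennreal (((1 / 4) ^ n) powr p)"
      using * by (auto simp: averaging_kernel_def e_def)
  qed (use uB in \<open>auto simp: averaging_kernel_def\<close>)
  then show ?thesis by blast
qed

context averaging_kernels
begin

lemma AE_eventually_in_B: "AE y in circle. \<forall>\<^sub>F n in sequentially. y \<in> B n"
proof -
  have *: "measure circle (- B n) \<le> (1 / 4) ^ n" for n
    using B_large[of n] by (simp add: circle.emeasure_eq_measure)
  have "summable (\<lambda>n. measure circle (- B n))"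
    by (rule summable_comparison_test'[where g = "\<lambda>n. (1 / 4) ^ n" and N = 0])
      (use * in \<open>auto intro!: summable_geometric\<close>)
  then have "AE y in circle. \<forall>\<^sub>F n in sequentially. y \<in> space circle - (- B n)"
    by (intro borel_cantelli_AE1) (auto simp: sets_circle circle.emeasure_eq_measure)
  then show ?thesis by simp
qed

text \<open>Off \<open>B n\<close>, where the kernel has mean zero, the function itself has to be removed in order to
  have mean zero on every line.\<close>

definition corrected :: "nat \<Rightarrow> (real \<times> real \<Rightarrow> complex) \<Rightarrow> real \<times> real \<Rightarrow> complex" where
  "corrected n f z = indicator (B n) (snd z) * f z - (\<integral>x. f (x, snd z) \<partial>circle) * of_real (u n z)"

lemma corrected_measurable [measurable]:
  assumes [measurable]: "f \<in> borel_measurable torus"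
  shows "corrected n f \<in> borel_measurable torus"
  unfolding corrected_def by measurable

lemma u_integrable: "integrable circle (\<lambda>x. u n (x, y))"
proof -
  obtain K where "\<And>z. u n z \<le> K" using u_bounded by blast
  then show ?thesis
    by (intro circle.integrable_const_bound[where B = K]) (use u_nonneg in auto)
qed

lemma corrected_bounded:
  assumes "f \<in> borel_measurable torus" "\<And>z. cmod (f z) \<le> C"
  shows "\<exists>K. \<forall>z. cmod (corrected n f z) \<le> K"
proof -
  obtain K where K: "\<And>z. u n z \<le> K" using u_bounded by blast
  have [measurable]: "f \<in> borel_measurable torus" by fact
  have C: "0 \<le> C" using assms(2)[of undefined] norm_ge_zero order_trans by blast
  have "cmod (corrected n f z) \<le> C + (2 * pi * C) * K" for z
  proof -
    have "cmod (\<integral>x. f (x, snd z) \<partial>circle) \<le> 2 * pi * C"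
      by (rule norm_integral_circle_le) (use assms in auto)
    then have "cmod ((\<integral>x. f (x, snd z) \<partial>circle) * of_real (u n z)) \<le> (2 * pi * C) * K"
      unfolding norm_mult using K[of z] u_nonneg[of n z] C by (intro mult_mono) auto
    moreover have "cmod (indicator (B n) (snd z) * f z) \<le> C"
      using assms(2)[of z] C by (auto simp: indicator_def)
    moreover have "cmod (corrected n f z) \<le> cmod (indicator (B n) (snd z) * f z)
        + cmod ((\<integral>x. f (x, snd z) \<partial>circle) * of_real (u n z))"
      unfolding corrected_def by (rule norm_triangle_ineq4)
    ultimately show ?thesis by linarith
  qed
  then show ?thesis by blast
qed

lemma corrected_mean_zero:
  assumes [measurable]: "f \<in> borel_measurable torus" and "\<And>z. cmod (f z) \<le> C"
  shows "(\<integral>x. corrected n f (x, y) \<partial>circle) = 0"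
proof -
  have "integrable circle (\<lambda>x. f (x, y))"
    by (rule integrable_bounded_circle[where B = C]) (use assms in auto)
  then show ?thesis
    using u_integrable[of n y] by (simp add: corrected_def u_mean indicator_def)
qed

text \<open>The error consists of \<open>f M\<close> over strips whose measure tends to zero, and of a bounded multiple
  of \<open>u n M\<close>.\<close>

lemma corrected_approximates:
  assumes [measurable]: "f \<in> borel_measurable torus" and C: "\<And>z. cmod (f z) \<le> C"
  shows "(\<lambda>n. p_integral torus p (\<lambda>z. (f z - corrected n f z) * M z)) \<longlonglongrightarrow> 0"
proof -
  have C0: "0 \<le> C" using C[of undefined] norm_ge_zero order_trans by blast
  define g where "g n z = indicator (- B n) (snd z) * f z * M z" for n z
  define h where "h n z = (\<integral>x. f (x, snd z) \<partial>circle) * (of_real (u n z) * M z)" for n z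
  have [measurable]: "g n \<in> borel_measurable torus" for n unfolding g_def by measurable
  have [measurable]: "h n \<in> borel_measurable torus" for n unfolding h_def by measurable
  have eq: "(f z - corrected n f z) * M z = g n z + h n z" for n z
    by (auto simp: g_def h_def corrected_def indicator_def algebra_simps)
  have "(\<lambda>n. p_integral torus p (g n)) \<longlonglongrightarrow> 0"
  proof (rule p_integral_tendsto_0[where g = M and K = C])
    show "AE z in torus. cmod (g n z) \<le> C * cmod (M z)" for n
      using C C0 by (intro AE_I2) (auto simp: g_def indicator_def norm_mult intro!: mult_right_mono)
    show "AE z in torus. (\<lambda>n. g n z) \<longlonglongrightarrow> 0"
      using AE_torus_snd[OF AE_eventually_in_B]
    proof eventually_elim
      case (elim z)
      then show ?case
        by (intro tendsto_eventually) (auto simp: g_def elim!: eventually_mono)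
    qed
  qed (use p_ge_1 M_integrable in auto)
  moreover have "(\<lambda>n. p_integral torus p (h n)) \<longlonglongrightarrow> 0"
  proof (rule tendsto_sandwich[where f = "\<lambda>_. 0"])
    have "p_integral torus p (h n) \<le> ennreal ((2 * pi * C) powr p) * ennreal (((1 / 4) ^ n) powr p)" for n
    proof -
      have "p_integral torus p (h n)
          \<le> p_integral torus p (\<lambda>z. of_real (2 * pi * C) * (of_real (u n z) * M z))"
      proof (rule p_integral_mono_AE)
        have "cmod (\<integral>x. f (x, y) \<partial>circle) \<le> cmod (of_real (2 * pi * C))" for y
          using norm_integral_circle_le[of "\<lambda>x. f (x, y)" C] C C0 by (simp add: norm_mult)
        then show "AE z in torus. cmod (h n z) \<le> cmod (of_real (2 * pi * C) * (of_real (u n z) * M z))"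
          unfolding h_def norm_mult by (intro AE_I2 mult_right_mono) auto
      qed (use p_ge_1 in simp)
      also have "\<dots> = ennreal ((2 * pi * C) powr p) * p_integral torus p (\<lambda>z. of_real (u n z) * M z)"
        using p_ge_1 C0 by (subst p_integral_cmult) (auto simp: norm_mult)
      also have "\<dots> \<le> ennreal ((2 * pi * C) powr p) * ennreal (((1 / 4) ^ n) powr p)"
        by (intro mult_left_mono u_small) auto
      finally show ?thesis .
    qed
    then show "\<forall>\<^sub>F n in sequentially. p_integral torus p (h n)
        \<le> ennreal ((2 * pi * C) powr p * ((1 / 4) ^ n) powr p)"
      by (simp add: ennreal_mult)
    have "(\<lambda>n. ((1 / 4 :: real) ^ n) powr p) \<longlonglongrightarrow> 0 powr p"
      using p_ge_1 by (intro tendsto_powr2 LIMSEQ_power_zero) auto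
    then have "(\<lambda>n. (2 * pi * C) powr p * ((1 / 4 :: real) ^ n) powr p) \<longlonglongrightarrow> (2 * pi * C) powr p * 0"
      using p_ge_1 by (intro tendsto_intros) auto
    from tendsto_ennrealI[OF this]
    show "(\<lambda>n. ennreal ((2 * pi * C) powr p * ((1 / 4) ^ n) powr p)) \<longlonglongrightarrow> 0"
      by simp
  qed auto
  ultimately have "(\<lambda>n. ennreal (2 powr p) * (p_integral torus p (g n) + p_integral torus p (h n)))
      \<longlonglongrightarrow> ennreal (2 powr p) * (0 + 0)"
    by (intro ennreal_tendsto_cmult tendsto_add) auto
  then have upper: "(\<lambda>n. ennreal (2 powr p) * (p_integral torus p (g n) + p_integral torus p (h n))) \<longlonglongrightarrow> 0"
    by simp
  have "p_integral torus p (\<lambda>z. (f z - corrected n f z) * M z)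
      \<le> ennreal (2 powr p) * (p_integral torus p (g n) + p_integral torus p (h n))" for n
    unfolding eq using p_ge_1 by (intro p_integral_add_le) auto
  then show ?thesis
    by (intro tendsto_sandwich[OF _ _ tendsto_const upper]) auto
qed

end

section \<open>Completeness\<close>

lemma (in weight) truncation_approximates:
  assumes [measurable]: "f \<in> borel_measurable torus" and f: "p_integral torus p f < \<infinity>"
    and M0: "AE z in torus. M z \<noteq> 0" and e: "0 < e"
  obtains F C where "F \<in> borel_measurable torus" "\<And>z. cmod (F z) \<le> C"
    "p_integral torus p (\<lambda>z. f z - F z * M z) < ennreal e"
proof -
  define F where "F n z = (if cmod (f z) \<le> real n * cmod (M z) then f z / M z else 0)" for n z
  have [measurable]: "F n \<in> borel_measurable torus" for n unfolding F_def by measurable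
  have "(\<lambda>n. p_integral torus p (\<lambda>z. f z - F n z * M z)) \<longlonglongrightarrow> 0"
  proof (rule p_integral_tendsto_0[where g = f and K = 1])
    show "AE z in torus. cmod (f z - F n z * M z) \<le> 1 * cmod (f z)" for n
      by (intro AE_I2) (auto simp: F_def)
    show "AE z in torus. (\<lambda>n. f z - F n z * M z) \<longlonglongrightarrow> 0"
      using M0
    proof eventually_elim
      case (elim z)
      obtain k :: nat where k: "cmod (f z) / cmod (M z) \<le> real k" using real_arch_simple by blast
      have "f z - F n z * M z = 0" if "k \<le> n" for n
      proof -
        have "cmod (f z) / cmod (M z) \<le> real n" using k that by simp
        then show ?thesis using elim by (simp add: F_def field_simps)
      qed
      then show ?case by (intro tendsto_eventually) (auto simp: eventually_sequentially)
    qed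
  qed (use p_ge_1 f in auto)
  then have "\<forall>\<^sub>F n in sequentially. p_integral torus p (\<lambda>z. f z - F n z * M z) < ennreal e"
    using e by (intro order_tendstoD) auto
  then obtain n where n: "p_integral torus p (\<lambda>z. f z - F n z * M z) < ennreal e"
    by (auto simp: eventually_sequentially)
  have "cmod (F n z) \<le> real n" for z
    by (cases "M z = 0") (auto simp: F_def norm_divide field_simps)
  with n show thesis by (intro that[of "F n" "real n"]) auto
qed

lemma (in weight) mean_zero_approximation:
  assumes [measurable]: "g \<in> borel_measurable torus" and "\<And>z. cmod (g z) \<le> C"
    and "\<And>y. (\<integral>x. g (x, y) \<partial>circle) = 0"
  obtains S where "\<And>n. S n \<in> lin_span char off_axis"
    "(\<lambda>n. p_integral torus p (\<lambda>z. (g z - S n z) * M z)) \<longlonglongrightarrow> 0"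
    "(\<lambda>n. \<integral>z. S n z * char (-1, 0) z \<partial>torus) \<longlonglongrightarrow> (\<integral>z. g z * char (-1, 0) z \<partial>torus)"
proof -
  obtain S where S: "\<And>n. S n \<in> lin_span char off_axis" "\<And>n z. cmod (S n z) \<le> 2 * (C + 2)"
    "AE z in torus. (\<lambda>n. S n z) \<longlonglongrightarrow> g z"
    using mean_zero_limit_trig_polynomials[OF assms] by blast
  have [measurable]: "S n \<in> borel_measurable torus" for n
    by (rule lin_span_char_measurable[OF S(1)])
  have "(\<lambda>n. p_integral torus p (\<lambda>z. (g z - S n z) * M z)) \<longlonglongrightarrow> 0"
  proof (rule p_integral_tendsto_0[where g = M and K = "C + 2 * (C + 2)"])
    show "AE z in torus. cmod ((g z - S n z) * M z) \<le> (C + 2 * (C + 2)) * cmod (M z)" for n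
      unfolding norm_mult
      by (intro AE_I2 mult_right_mono order_trans[OF norm_triangle_ineq4] add_mono assms S) auto
    show "AE z in torus. (\<lambda>n. (g z - S n z) * M z) \<longlonglongrightarrow> 0"
      using S(3)
    proof eventually_elim
      case (elim z)
      have "(\<lambda>n. (g z - S n z) * M z) \<longlonglongrightarrow> (g z - g z) * M z"
        by (intro tendsto_intros elim)
      then show ?case by simp
    qed
  qed (use p_ge_1 M_integrable in auto)
  moreover have "(\<lambda>n. \<integral>z. S n z * char (-1, 0) z \<partial>torus) \<longlonglongrightarrow> (\<integral>z. g z * char (-1, 0) z \<partial>torus)"
  proof (rule integral_dominated_convergence[where w = "\<lambda>_. 2 * (C + 2)"])
    show "AE z in torus. (\<lambda>n. S n z * char (-1, 0) z) \<longlonglongrightarrow> g z * char (-1, 0) z"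
      using S(3) by eventually_elim (intro tendsto_intros)
  qed (use S(2) in \<open>auto simp: norm_mult\<close>)
  ultimately show thesis using S(1) by (intro that)
qed

text \<open>Approximate \<open>f\<close> by \<open>F M\<close> with bounded \<open>F\<close>, correct \<open>F\<close> to have mean zero on every line, and
  approximate the result by trigonometric polynomials.\<close>

lemma (in singular_weight) off_axis_complete:
  assumes [measurable]: "f \<in> borel_measurable torus" and f: "p_integral torus p f < \<infinity>" and e: "0 < e"
  obtains S where "S \<in> lin_span char off_axis"
    "p_integral torus p (\<lambda>z. f z - M z * S z) < ennreal e"
proof -
  \<comment> \<open>Three errors \<open>e'\<close> are added, with a factor \<open>2 powr p\<close> for each addition.\<close>
  define e' where "e' = e / (3 * 2 powr p * 2 powr p)"
  have e': "0 < e'" "2 powr p * (e' + 2 powr p * (e' + e')) \<le> e"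
  proof -
    show "0 < e'" using e by (simp add: e'_def)
    have "1 \<le> 2 powr p" using p_ge_1 by (simp add: ge_one_powr_ge_zero)
    then have "e' \<le> 2 powr p * e'" using \<open>0 < e'\<close> by simp
    then have "2 powr p * (e' + 2 powr p * (e' + e')) \<le> 2 powr p * (2 powr p * e' + 2 powr p * (e' + e'))"
      by (intro mult_left_mono) (auto simp: mult.commute)
    also have "\<dots> = e" by (simp add: e'_def field_simps)
    finally show "2 powr p * (e' + 2 powr p * (e' + e')) \<le> e" .
  qed
  obtain F C where [measurable]: "F \<in> borel_measurable torus" and F: "\<And>z. cmod (F z) \<le> C"
    "p_integral torus p (\<lambda>z. f z - F z * M z) < ennreal e'"
    using truncation_approximates[OF assms(1) f M_nonzero e'(1)] by blast
  obtain u B where "averaging_kernels p M u B" using averaging_kernels_exist by blast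
  then interpret averaging_kernels p M u B .
  have "\<forall>\<^sub>F n in sequentially. p_integral torus p (\<lambda>z. (F z - corrected n F z) * M z) < ennreal e'"
    by (rule order_tendstoD(2)[OF corrected_approximates[of F C]]) (use F(1) e' in simp_all)
  then obtain n where n: "p_integral torus p (\<lambda>z. (F z - corrected n F z) * M z) < ennreal e'"
    by (auto simp: eventually_sequentially)
  obtain K where K: "\<And>z. cmod (corrected n F z) \<le> K" using corrected_bounded[of F C n] F(1) by auto
  obtain S where S: "\<And>m. S m \<in> lin_span char off_axis"
    "(\<lambda>m. p_integral torus p (\<lambda>z. (corrected n F z - S m z) * M z)) \<longlonglongrightarrow> 0"
  proof (rule mean_zero_approximation[of "corrected n F" K])
    show "corrected n F \<in> borel_measurable torus" by measurable
    show "(\<integral>x. corrected n F (x, y) \<partial>circle) = 0" for y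
      by (rule corrected_mean_zero[of F C]) (use F(1) in simp_all)
    show "cmod (corrected n F z) \<le> K" for z by (rule K)
  qed blast
  have [measurable]: "S n \<in> borel_measurable torus" for n
    by (rule lin_span_char_measurable[OF S(1)])
  have "\<forall>\<^sub>F m in sequentially. p_integral torus p (\<lambda>z. (corrected n F z - S m z) * M z) < ennreal e'"
    by (rule order_tendstoD(2)[OF S(2)]) (use e' in simp)
  then obtain m where m: "p_integral torus p (\<lambda>z. (corrected n F z - S m z) * M z) < ennreal e'"
    by (auto simp: eventually_sequentially)
  have eq: "f z - M z * S m z = (f z - F z * M z) +
      ((F z - corrected n F z) * M z + (corrected n F z - S m z) * M z)" for z
    by (simp add: algebra_simps)
  have "p_integral torus p (\<lambda>z. f z - M z * S m z)
     \<le> ennreal (2 powr p) * (p_integral torus p (\<lambda>z. f z - F z * M z)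
        + p_integral torus p (\<lambda>z. (F z - corrected n F z) * M z + (corrected n F z - S m z) * M z))"
    unfolding eq using p_ge_1 by (intro p_integral_add_le) auto
  also have "\<dots> \<le> ennreal (2 powr p) * (p_integral torus p (\<lambda>z. f z - F z * M z)
        + ennreal (2 powr p) * (p_integral torus p (\<lambda>z. (F z - corrected n F z) * M z)
           + p_integral torus p (\<lambda>z. (corrected n F z - S m z) * M z)))"
    using p_ge_1 by (intro mult_left_mono add_left_mono p_integral_add_le) auto
  also have "\<dots> < ennreal (2 powr p) * (ennreal e' + ennreal (2 powr p) * (ennreal e' + ennreal e'))"
    using F(2) n m
    by (intro ennreal_mult_strict_left_mono add_strict_mono) auto
  also have "\<dots> = ennreal (2 powr p * (e' + 2 powr p * (e' + e')))"
    using e' by (simp add: ennreal_mult ennreal_plus flip: mult_2)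
  also have "\<dots> \<le> ennreal e" using e' by (intro ennreal_leI)
  finally show thesis using S(1) by (intro that)
qed

section \<open>The symbol produced by minimality\<close>

text \<open>The Fourier coefficient at the frequency \<open>(1, 0)\<close>, not normalised.\<close>

definition coefficient :: "(real \<times> real \<Rightarrow> complex) \<Rightarrow> complex" where
  "coefficient f = (\<integral>z. f z * char (-1, 0) z \<partial>torus)"

lemma coefficient_trig_polynomial:
  fixes c :: "int \<times> int \<Rightarrow> complex"
  assumes "finite F"
  shows "coefficient (\<lambda>z. \<Sum>i\<in>F. c i * char i z) = (if (1, 0) \<in> F then of_real ((2 * pi)\<^sup>2) * c (1, 0) else 0)"
proof -
  have int: "integrable torus (\<lambda>z. c i * char (i + (-1, 0)) z)" for i
    by (rule integrable_bounded_torus[where B = "cmod (c i)"]) (auto simp: norm_mult)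
  have "coefficient (\<lambda>z. \<Sum>i\<in>F. c i * char i z) = (\<integral>z. (\<Sum>i\<in>F. c i * char (i + (-1, 0)) z) \<partial>torus)"
    by (simp add: coefficient_def char_add sum_distrib_right mult.assoc)
  also have "\<dots> = (\<Sum>i\<in>F. c i * (\<integral>z. char (i + (-1, 0)) z \<partial>torus))"
    by (subst Bochner_Integration.integral_sum[OF int]) simp
  also have "\<dots> = (\<Sum>i\<in>F. if i = (1, 0) then of_real ((2 * pi)\<^sup>2) * c (1, 0) else 0)"
    by (intro sum.cong) (auto simp: integral_char zero_prod_def)
  finally show ?thesis using assms by (simp add: sum.delta)
qed

text \<open>In \<open>L\<^sup>p\<close> with weight \<open>\<bar>M\<bar>\<^sup>p\<close>, the frequency \<open>(1, 0)\<close> has positive distance from the span of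
  the others, that is, its coefficient functional is bounded on the span of all of them.\<close>

lemma (in weight) coefficient_bound_of_distance:
  assumes d: "0 < d"
    and dist: "\<And>S. S \<in> lin_span char (off_axis - {(1, 0)})
        \<Longrightarrow> ennreal d \<le> p_integral torus p (\<lambda>z. M z * (char (1, 0) z - S z))"
    and S: "S \<in> lin_span char off_axis"
  shows "ennreal (cmod (coefficient S) powr p)
           \<le> ennreal ((2 * pi)\<^sup>2 powr p / d) * p_integral torus p (\<lambda>z. S z * M z)"
proof (cases "coefficient S = 0")
  case True
  then show ?thesis using p_ge_1 by simp
next
  case False
  obtain F c where F: "finite F" "F \<subseteq> off_axis" and S_eq: "S = (\<lambda>z. \<Sum>i\<in>F. c i * char i z)"
    using S by (auto simp: lin_span_def)
  define a where "a = c (1, 0)"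
  have F1: "(1, 0) \<in> F" and coef: "coefficient S = of_real ((2 * pi)\<^sup>2) * a" and a: "a \<noteq> 0"
    using False coefficient_trig_polynomial[OF F(1), of c]
    by (auto simp: S_eq a_def split: if_splits)
  define S' where "S' z = (\<Sum>i\<in>F - {(1, 0)}. (- c i / a) * char i z)" for z
  have "S' \<in> lin_span char (off_axis - {(1, 0)})"
    unfolding lin_span_def
    by (rule CollectI, rule exI[of _ "F - {(1, 0)}"], rule exI[of _ "\<lambda>i. - c i / a"])
      (use F in \<open>auto simp: S'_def\<close>)
  note d_le = dist[OF this]
  have [measurable]: "S' \<in> borel_measurable torus" unfolding S'_def by measurable
  have eq: "S z * M z = a * (M z * (char (1, 0) z - S' z))" for z
  proof -
    have "a * S' z = - (\<Sum>i\<in>F - {(1, 0)}. c i * char i z)"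
      unfolding S'_def using a by (simp add: sum_distrib_left sum_negf flip: mult.assoc)
    moreover have "S z = a * char (1, 0) z + (\<Sum>i\<in>F - {(1, 0)}. c i * char i z)"
      unfolding S_eq a_def using F(1) F1 by (rule sum.remove)
    ultimately have "S z = a * (char (1, 0) z - S' z)" by (simp add: right_diff_distrib)
    then show ?thesis by (simp add: mult_ac)
  qed
  have "p_integral torus p (\<lambda>z. S z * M z)
      = ennreal (cmod a powr p) * p_integral torus p (\<lambda>z. M z * (char (1, 0) z - S' z))"
    unfolding eq by (rule p_integral_cmult) (use p_ge_1 in auto)
  then have "ennreal (cmod a powr p) * ennreal d \<le> p_integral torus p (\<lambda>z. S z * M z)"
    using d_le by (simp add: mult_left_mono)
  then have "ennreal ((2 * pi)\<^sup>2 powr p / d) * (ennreal (cmod a powr p) * ennreal d)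
      \<le> ennreal ((2 * pi)\<^sup>2 powr p / d) * p_integral torus p (\<lambda>z. S z * M z)"
    by (rule mult_left_mono) simp
  moreover have "ennreal ((2 * pi)\<^sup>2 powr p / d) * (ennreal (cmod a powr p) * ennreal d)
      = ennreal (((2 * pi)\<^sup>2 * cmod a) powr p)"
    using d by (simp add: powr_mult flip: ennreal_mult)
  moreover have "cmod (coefficient S) = (2 * pi)\<^sup>2 * cmod a"
    by (simp add: coef norm_mult norm_power)
  ultimately show ?thesis by simp
qed

locale coefficient_bounded_weight = singular_weight +
  fixes D :: real
  assumes D_nonneg: "0 \<le> D"
    and coefficient_bound: "\<And>S. S \<in> lin_span char off_axis \<Longrightarrow>
        ennreal (cmod (coefficient S) powr p) \<le> ennreal D * p_integral torus p (\<lambda>z. S z * M z)"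
begin

lemma p_integral_perturb:
  assumes [measurable]: "f \<in> borel_measurable torus" "g \<in> borel_measurable torus"
  shows "p_integral torus p (\<lambda>z. g z * M z) \<le> ennreal (2 powr p) *
           (p_integral torus p (\<lambda>z. f z * M z) + p_integral torus p (\<lambda>z. (f z - g z) * M z))"
proof -
  have "p_integral torus p (\<lambda>z. g z * M z)
      = p_integral torus p (\<lambda>z. f z * M z + - ((f z - g z) * M z))"
    by (simp add: algebra_simps)
  also have "\<dots> \<le> ennreal (2 powr p) *
      (p_integral torus p (\<lambda>z. f z * M z) + p_integral torus p (\<lambda>z. - ((f z - g z) * M z)))"
    using p_ge_1 by (intro p_integral_add_le) auto
  finally show ?thesis by (simp add: p_integral_uminus)
qed

text \<open>The bound passes from trigonometric polynomials to all bounded functions of mean zero because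
  both the coefficient and the weighted integral pass to the limit.\<close>

lemma coefficient_bound_mean_zero:
  assumes [measurable]: "g \<in> borel_measurable torus" and C: "\<And>z. cmod (g z) \<le> C"
    and mean: "\<And>y. (\<integral>x. g (x, y) \<partial>circle) = 0"
  shows "ennreal (cmod (coefficient g) powr p)
           \<le> ennreal (D * 2 powr p) * p_integral torus p (\<lambda>z. g z * M z)"
proof -
  obtain S where S: "\<And>n. S n \<in> lin_span char off_axis"
    "(\<lambda>n. p_integral torus p (\<lambda>z. (g z - S n z) * M z)) \<longlonglongrightarrow> 0"
    "(\<lambda>n. \<integral>z. S n z * char (-1, 0) z \<partial>torus) \<longlonglongrightarrow> (\<integral>z. g z * char (-1, 0) z \<partial>torus)"
    using mean_zero_approximation[OF assms(1) C mean] by blast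
  let ?K = "ennreal (D * 2 powr p)" and ?I = "p_integral torus p (\<lambda>z. g z * M z)"
  let ?e = "\<lambda>n. p_integral torus p (\<lambda>z. (g z - S n z) * M z)"
  have [measurable]: "S n \<in> borel_measurable torus" for n
    by (rule lin_span_char_measurable[OF S(1)])
  have "(\<lambda>n. cmod (coefficient (S n)) powr p) \<longlonglongrightarrow> cmod (coefficient g) powr p"
    unfolding coefficient_def
    by (rule tendsto_powr2[OF tendsto_norm[OF S(3)] tendsto_const]) (use p_ge_1 in auto)
  then have lim: "(\<lambda>n. ennreal (cmod (coefficient (S n)) powr p)) \<longlonglongrightarrow> ennreal (cmod (coefficient g) powr p)"
    by (rule tendsto_ennrealI)
  have "(\<lambda>n. ?K * (?I
           + ?e n))
      \<longlonglongrightarrow> ?K * (?I + 0)"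
    by (intro ennreal_tendsto_cmult tendsto_add tendsto_const S(2)) simp
  moreover have "ennreal (cmod (coefficient (S n)) powr p) \<le> ?K *
      (?I + ?e n)" for n
  proof -
    have "ennreal (cmod (coefficient (S n)) powr p) \<le> ennreal D * p_integral torus p (\<lambda>z. S n z * M z)"
      by (rule coefficient_bound[OF S(1)])
    also have "\<dots> \<le> ennreal D * (ennreal (2 powr p) *
      (?I + ?e n))"
      by (intro mult_left_mono p_integral_perturb) auto
    finally show ?thesis using D_nonneg by (simp add: ennreal_mult mult.assoc)
  qed
  ultimately have "ennreal (cmod (coefficient g) powr p)
      \<le> ?K * (?I + 0)"
    by (intro LIMSEQ_le[OF lim]) auto
  then show ?thesis by simp
qed

end

locale symbol_construction = coefficient_bounded_weight p M D + averaging_kernels p M u B for p M D u B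
begin

text \<open>The coefficient functional is bounded only on functions of mean zero, but the kernels extend
  it: \<open>coefficient (f - (\<integral> f dx) u\<^sub>n)\<close> is \<open>\<integral> f (e\<^sup>-\<^sup>i\<^sup>x - symbol n y)\<close>, and in the limit the correction
  costs nothing.\<close>

definition symbol :: "nat \<Rightarrow> real \<Rightarrow> complex" where
  "symbol n y = (\<integral>x. of_real (u n (x, y)) * cis (- x) \<partial>circle)"

lemma symbol_measurable [measurable]: "symbol n \<in> borel_measurable circle"
  unfolding symbol_def by measurable

lemma norm_symbol: "cmod (symbol n y) \<le> 1"
proof -
  have "cmod (symbol n y) \<le> (\<integral>x. cmod (of_real (u n (x, y)) * cis (- x)) \<partial>circle)"
    unfolding symbol_def by (rule integral_norm_bound)
  also have "\<dots> = (\<integral>x. u n (x, y) \<partial>circle)"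
    by (simp add: norm_mult u_nonneg)
  also have "\<dots> \<le> 1" by (simp add: u_mean indicator_def)
  finally show ?thesis .
qed

lemma symbol_integrable:
  assumes [measurable]: "a \<in> borel_measurable circle" and "\<And>y. cmod (a y) \<le> C"
  shows "integrable circle (\<lambda>y. a y * symbol n y)"
proof (rule integrable_bounded_circle[where B = C])
  fix y
  have "0 \<le> C" using assms(2)[of y] norm_ge_zero order_trans by blast
  then show "cmod (a y * symbol n y) \<le> C"
    using mult_mono[OF assms(2)[of y] norm_symbol[of n y]] by (simp add: norm_mult)
qed measurable

lemma coefficient_multiple_kernel:
  assumes [measurable]: "a \<in> borel_measurable circle" and a: "\<And>y. cmod (a y) \<le> C"
  shows "coefficient (\<lambda>z. a (snd z) * of_real (u n z)) = (\<integral>y. a y * symbol n y \<partial>circle)"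
    "integrable torus (\<lambda>z. a (snd z) * of_real (u n z) * char (-1, 0) z)"
proof -
  obtain K where K: "\<And>z. u n z \<le> K" using u_bounded by blast
  have C: "0 \<le> C" using a[of undefined] norm_ge_zero order_trans by blast
  have b: "cmod (a (snd z) * of_real (u n z) * char (-1, 0) z) \<le> C * K" for z
    using mult_mono[OF a[of "snd z"] K[of z] C] u_nonneg[of n z] by (simp add: norm_mult)
  show "integrable torus (\<lambda>z. a (snd z) * of_real (u n z) * char (-1, 0) z)"
    by (rule integrable_bounded_torus[OF _ b]) measurable
  have "coefficient (\<lambda>z. a (snd z) * of_real (u n z))
      = (\<integral>y. (\<integral>x. a y * of_real (u n (x, y)) * char (-1, 0) (x, y) \<partial>circle) \<partial>circle)"
    unfolding coefficient_def
    by (subst integral_torus_iterated[OF _ b]) auto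
  then show "coefficient (\<lambda>z. a (snd z) * of_real (u n z)) = (\<integral>y. a y * symbol n y \<partial>circle)"
    by (simp add: symbol_def char_apply mult.assoc)
qed

text \<open>The test function is a difference of two kernels, rotated on each line so that its
  coefficient is the distance of the two symbols in \<open>L\<^sup>1\<close> of the lines on which both kernels have
  mean one; there its mean over \<open>x\<close> vanishes.\<close>

lemma symbol_difference_bound:
  defines "A \<equiv> \<lambda>n. B n \<inter> B (Suc n)"
  shows "(\<integral>y. indicator (A n) y * cmod (symbol n y - symbol (Suc n) y) \<partial>circle)
           \<le> (2 * (D * 2 powr p * 2 powr p)) powr (1 / p) * (1 / 4) ^ n"
proof -
  let ?r = "ennreal (((1 / 4) ^ n) powr p)"
  have [measurable]: "A n \<in> sets borel" unfolding A_def by measurable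
  define a where "a y = indicator (A n) y * cnj (sgn (symbol n y - symbol (Suc n) y))" for y
  have [measurable]: "a \<in> borel_measurable circle" unfolding a_def by measurable
  have a: "cmod (a y) \<le> 1" for y by (auto simp: a_def norm_mult norm_sgn indicator_def)
  define g where "g z = a (snd z) * of_real (u n z) - a (snd z) * of_real (u (Suc n) z)" for z
  have [measurable]: "g \<in> borel_measurable torus" unfolding g_def by measurable
  obtain K L where KL: "\<And>z. u n z \<le> K" "\<And>z. u (Suc n) z \<le> L" using u_bounded by metis
  have g: "cmod (g z) \<le> K + L" for z
  proof -
    have "cmod (g z) \<le> cmod (a (snd z) * of_real (u n z)) + cmod (a (snd z) * of_real (u (Suc n) z))"
      unfolding g_def by (rule norm_triangle_ineq4)
    also have "\<dots> \<le> 1 * K + 1 * L"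
      unfolding norm_mult using a KL u_nonneg by (intro add_mono mult_mono) auto
    finally show ?thesis by simp
  qed
  have mean: "(\<integral>x. g (x, y) \<partial>circle) = 0" for y
    using u_integrable[of n y] u_integrable[of "Suc n" y]
    by (auto simp: g_def u_mean a_def A_def indicator_def)
  define J where "J = (\<integral>y. indicator (A n) y * cmod (symbol n y - symbol (Suc n) y) \<partial>circle)"
  have J0: "0 \<le> J" unfolding J_def by (intro integral_nonneg_AE) auto
  have "coefficient g = (\<integral>y. a y * symbol n y \<partial>circle) - (\<integral>y. a y * symbol (Suc n) y \<partial>circle)"
    using coefficient_multiple_kernel[of a 1, OF _ a, of n] coefficient_multiple_kernel[of a 1, OF _ a, of "Suc n"]
    by (simp add: coefficient_def g_def left_diff_distrib)
  also have "\<dots> = (\<integral>y. a y * symbol n y - a y * symbol (Suc n) y \<partial>circle)"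
    by (rule Bochner_Integration.integral_diff[symmetric]) (auto intro!: symbol_integrable[where C = 1] a)
  also have "\<dots> = (\<integral>y. of_real (indicator (A n) y * cmod (symbol n y - symbol (Suc n) y)) \<partial>circle)"
  proof (rule Bochner_Integration.integral_cong)
    fix y
    have "cnj (sgn w) * w = of_real (cmod w)" for w :: complex
      by (cases "w = 0") (auto simp: sgn_div_norm scaleR_conv_of_real complex_norm_square[symmetric]
          field_simps power2_eq_square)
    from this[of "symbol n y - symbol (Suc n) y"]
    show "a y * symbol n y - a y * symbol (Suc n) y
        = of_real (indicator (A n) y * cmod (symbol n y - symbol (Suc n) y))"
      by (auto simp: a_def indicator_def right_diff_distrib)
  qed simp
  also have "\<dots> = of_real J" unfolding J_def by (simp del: of_real_mult)
  finally have coef: "cmod (coefficient g) = J" using J0 by simp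
  have "p_integral torus p (\<lambda>z. g z * M z)
      \<le> p_integral torus p (\<lambda>z. of_real (u n z) * M z + - (of_real (u (Suc n) z) * M z))"
  proof (rule p_integral_mono_AE)
    have "cmod (g z * M z) \<le> cmod (of_real (u n z) * M z + - (of_real (u (Suc n) z) * M z))" for z
    proof -
      have "g z * M z = a (snd z) * (of_real (u n z) * M z + - (of_real (u (Suc n) z) * M z))"
        by (simp add: g_def algebra_simps)
      then show ?thesis using a[of "snd z"] by (simp add: norm_mult mult_left_le_one_le)
    qed
    then show "AE z in torus. cmod (g z * M z) \<le> cmod (of_real (u n z) * M z + - (of_real (u (Suc n) z) * M z))"
      by simp
  qed (use p_ge_1 in simp)
  also have "\<dots> \<le> ennreal (2 powr p) * (p_integral torus p (\<lambda>z. of_real (u n z) * M z)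
      + p_integral torus p (\<lambda>z. - (of_real (u (Suc n) z) * M z)))"
    using p_ge_1 by (intro p_integral_add_le) auto
  also have "\<dots> \<le> ennreal (2 powr p) * (?r + ?r)"
  proof -
    have "ennreal (((1 / 4) ^ Suc n) powr p) \<le> ?r"
      using p_ge_1 by (intro ennreal_leI powr_mono2) auto
    then show ?thesis
      unfolding p_integral_uminus
      by (intro mult_left_mono add_mono u_small order_trans[OF u_small]) auto
  qed
  finally have gM: "p_integral torus p (\<lambda>z. g z * M z)
      \<le> ennreal (2 powr p) * (?r + ?r)" .
  have "ennreal (J powr p) \<le> ennreal (D * 2 powr p) * p_integral torus p (\<lambda>z. g z * M z)"
    using coefficient_bound_mean_zero[of g "K + L"] g mean coef by simp
  also have "\<dots> \<le> ennreal (D * 2 powr p)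
      * (ennreal (2 powr p) * (?r + ?r))"
    by (intro mult_left_mono gM) simp
  also have "\<dots> = ennreal (2 * (D * 2 powr p * 2 powr p) * ((1 / 4) ^ n) powr p)"
    using D_nonneg by (simp add: mult_ac flip: ennreal_mult ennreal_plus)
  finally have "J powr p \<le> 2 * (D * 2 powr p * 2 powr p) * ((1 / 4) ^ n) powr p"
    using D_nonneg by simp
  then have "(J powr p) powr (1 / p) \<le> (2 * (D * 2 powr p * 2 powr p) * ((1 / 4) ^ n) powr p) powr (1 / p)"
    using p_ge_1 by (intro powr_mono2) auto
  then have "J \<le> (2 * (D * 2 powr p * 2 powr p)) powr (1 / p) * (1 / 4) ^ n"
    using p_ge_1 D_nonneg J0 by (simp add: powr_powr powr_mult)
  then show ?thesis by (simp add: J_def)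
qed

lemma AE_symbol_convergent: "AE y in circle. convergent (\<lambda>n. symbol n y)"
proof -
  define A where "A n = B n \<inter> B (Suc n)" for n
  have [measurable]: "A n \<in> sets borel" for n unfolding A_def by measurable
  define t where "t n y = indicator (A n) y * cmod (symbol n y - symbol (Suc n) y)" for n y
  have [measurable]: "t n \<in> borel_measurable circle" for n unfolding t_def by measurable
  define Q where "Q = (2 * (D * 2 powr p * 2 powr p)) powr (1 / p)"
  have t0: "0 \<le> t n y" for n y by (simp add: t_def)
  have t2: "t n y \<le> 2" for n y
    using norm_triangle_ineq4[of "symbol n y" "symbol (Suc n) y"] norm_symbol[of n y] norm_symbol[of "Suc n" y]
    by (auto simp: t_def indicator_def)
  have "(\<integral>\<^sup>+y. ennreal (t n y) \<partial>circle) \<le> ennreal (Q * (1 / 4) ^ n)" for n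
  proof -
    have "(\<integral>\<^sup>+y. ennreal (t n y) \<partial>circle) = ennreal (\<integral>y. t n y \<partial>circle)"
      by (rule nn_integral_eq_integral)
        (use t0 t2 in \<open>auto intro!: circle.integrable_const_bound[where B = 2]\<close>)
    then show ?thesis
      using symbol_difference_bound[of n] by (simp add: t_def A_def Q_def ennreal_leI)
  qed
  then have "(\<integral>\<^sup>+y. (\<Sum>n. ennreal (t n y)) \<partial>circle) \<le> (\<Sum>n. ennreal (Q * (1 / 4) ^ n))"
    by (subst nn_integral_suminf) (auto intro!: suminf_le)
  also have "\<dots> = ennreal (\<Sum>n. Q * (1 / 4) ^ n)"
    by (rule suminf_ennreal2) (auto simp: Q_def intro!: summable_mult summable_geometric)
  finally have "(\<integral>\<^sup>+y. (\<Sum>n. ennreal (t n y)) \<partial>circle) \<noteq> \<infinity>"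
    by (auto simp: top_unique)
  then have "AE y in circle. (\<Sum>n. ennreal (t n y)) \<noteq> \<infinity>"
    by (intro nn_integral_PInf_AE) auto
  then show ?thesis
    using AE_eventually_in_B
  proof eventually_elim
    case (elim y)
    have "summable (\<lambda>n. t n y)"
      using elim(1) t0 by (intro summable_suminf_not_top) auto
    moreover have "\<forall>\<^sub>F n in sequentially. norm (symbol (Suc n) y - symbol n y) \<le> t n y"
    proof -
      have "\<forall>\<^sub>F n in sequentially. y \<in> B (Suc n)"
        using elim(2) by (rule eventually_sequentially_Suc[THEN iffD2])
      with elim(2) show ?thesis
        by eventually_elim (simp add: t_def A_def norm_minus_commute)
    qed
    ultimately have "summable (\<lambda>n. symbol (Suc n) y - symbol n y)"
      by (rule summable_comparison_test_ev[rotated])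
    then have "convergent (\<lambda>n. \<Sum>k<n. symbol (Suc k) y - symbol k y)"
      by (simp add: summable_iff_convergent)
    then have "convergent (\<lambda>n. symbol n y - symbol 0 y)"
      by (simp add: sum_lessThan_telescope[of "\<lambda>n. symbol n y"])
    then have "convergent (\<lambda>n. (symbol n y - symbol 0 y) + symbol 0 y)"
      by (intro convergent_add convergent_const)
    then show ?case by simp
  qed
qed

text \<open>The limit is cut off to keep it in the closed unit disc where the symbols do not converge.\<close>

definition limit_symbol :: "real \<Rightarrow> complex" where
  "limit_symbol y = (if cmod (lim (\<lambda>n. symbol n y)) \<le> 1 then lim (\<lambda>n. symbol n y) else 0)"

lemma limit_symbol_measurable [measurable]: "limit_symbol \<in> borel_measurable circle"
  unfolding limit_symbol_def by measurable

lemma norm_limit_symbol: "cmod (limit_symbol y) \<le> 1"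
  by (simp add: limit_symbol_def)

lemma AE_symbol_tendsto: "AE y in circle. (\<lambda>n. symbol n y) \<longlonglongrightarrow> limit_symbol y"
  using AE_symbol_convergent
proof eventually_elim
  case (elim y)
  then have lim: "(\<lambda>n. symbol n y) \<longlonglongrightarrow> lim (\<lambda>n. symbol n y)"
    by (simp add: convergent_LIMSEQ_iff)
  then have "cmod (lim (\<lambda>n. symbol n y)) \<le> 1"
    by (intro LIMSEQ_le_const2[OF tendsto_norm]) (auto intro: norm_symbol)
  with lim show ?case by (simp add: limit_symbol_def)
qed

lemma coefficient_corrected:
  assumes [measurable]: "f \<in> borel_measurable torus" and C: "\<And>z. cmod (f z) \<le> C"
  shows "coefficient (corrected n f)
    = (\<integral>z. f z * (indicator (B n) (snd z) * cis (- fst z) - symbol n (snd z)) \<partial>torus)"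
proof -
  have C0: "0 \<le> C" using C[of undefined] norm_ge_zero order_trans by blast
  define b where "b y = (\<integral>x. f (x, y) \<partial>circle)" for y
  have [measurable]: "b \<in> borel_measurable circle" unfolding b_def by measurable
  have b: "cmod (b y) \<le> 2 * pi * C" for y
    unfolding b_def by (rule norm_integral_circle_le) (use C in auto)
  have int1: "integrable torus (\<lambda>z. f z * (indicator (B n) (snd z) * cis (- fst z)))"
    by (rule integrable_bounded_torus[where B = C])
      (use C C0 in \<open>auto simp: norm_mult indicator_def\<close>)
  have b2: "cmod (f z * symbol n (snd z)) \<le> C" for z
    using mult_mono[OF C[of z] norm_symbol[of n "snd z"] C0] by (simp add: norm_mult)
  have int2: "integrable torus (\<lambda>z. f z * symbol n (snd z))"
    by (rule integrable_bounded_torus[OF _ b2]) measurable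
  note kern = coefficient_multiple_kernel[of b, OF _ b, of n]
  have "coefficient (corrected n f)
      = (\<integral>z. f z * (indicator (B n) (snd z) * cis (- fst z)) - b (snd z) * of_real (u n z) * char (-1, 0) z \<partial>torus)"
    unfolding coefficient_def
    by (intro Bochner_Integration.integral_cong)
      (auto simp: corrected_def b_def char_def algebra_simps)
  also have "\<dots> = (\<integral>z. f z * (indicator (B n) (snd z) * cis (- fst z)) \<partial>torus) - (\<integral>y. b y * symbol n y \<partial>circle)"
    using int1 kern by (simp add: coefficient_def)
  also have "(\<integral>y. b y * symbol n y \<partial>circle) = (\<integral>z. f z * symbol n (snd z) \<partial>torus)"
    by (subst integral_torus_iterated[OF _ b2]) (auto simp: b_def)
  finally show ?thesis
    using int1 int2 by (simp add: right_diff_distrib)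
qed

text \<open>Passing to the limit in the coefficient bound for the corrected functions.\<close>

lemma limit_symbol_pairing_bound:
  assumes [measurable]: "f \<in> borel_measurable torus" and C: "\<And>z. cmod (f z) \<le> C"
  shows "ennreal (cmod (\<integral>z. f z * (cis (- fst z) - limit_symbol (snd z)) \<partial>torus) powr p)
    \<le> ennreal (D * 2 powr p * 2 powr p) * p_integral torus p (\<lambda>z. f z * M z)"
proof -
  let ?L = "\<integral>z. f z * (cis (- fst z) - limit_symbol (snd z)) \<partial>torus"
  let ?K = "ennreal (D * 2 powr p * 2 powr p)" and ?I = "p_integral torus p (\<lambda>z. f z * M z)"
  let ?e = "\<lambda>n. p_integral torus p (\<lambda>z. (f z - corrected n f z) * M z)"
  have C0: "0 \<le> C" using C[of undefined] norm_ge_zero order_trans by blast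
  have "(\<lambda>n. coefficient (corrected n f)) \<longlonglongrightarrow> ?L"
    unfolding coefficient_corrected[OF assms]
  proof (rule integral_dominated_convergence[where w = "\<lambda>_. C * 2"])
    show "AE z in torus. (\<lambda>n. f z * (indicator (B n) (snd z) * cis (- fst z) - symbol n (snd z)))
        \<longlonglongrightarrow> f z * (cis (- fst z) - limit_symbol (snd z))"
      using AE_torus_snd[OF AE_symbol_tendsto] AE_torus_snd[OF AE_eventually_in_B]
    proof eventually_elim
      case (elim z)
      have "(\<lambda>n. indicator (B n) (snd z) :: complex) \<longlonglongrightarrow> 1"
        using elim(2) by (intro tendsto_eventually) (auto elim!: eventually_mono)
      then have "(\<lambda>n. f z * (indicator (B n) (snd z) * cis (- fst z) - symbol n (snd z)))
        \<longlonglongrightarrow> f z * (1 * cis (- fst z) - limit_symbol (snd z))"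
        by (intro tendsto_intros elim(1))
      then show ?case by simp
    qed
    show "AE z in torus. norm (f z * (indicator (B n) (snd z) * cis (- fst z) - symbol n (snd z))) \<le> C * 2" for n
    proof (rule AE_I2)
      fix z
      have "cmod (indicator (B n) (snd z) * cis (- fst z) - symbol n (snd z))
          \<le> cmod (indicator (B n) (snd z) * cis (- fst z)) + cmod (symbol n (snd z))"
        by (rule norm_triangle_ineq4)
      also have "\<dots> \<le> 2"
        using norm_symbol[of n "snd z"] by (auto simp: norm_mult indicator_def)
      finally show "norm (f z * (indicator (B n) (snd z) * cis (- fst z) - symbol n (snd z))) \<le> C * 2"
        unfolding norm_mult using C C0 by (intro mult_mono) auto
    qed
  qed auto
  then have "(\<lambda>n. cmod (coefficient (corrected n f)) powr p)
      \<longlonglongrightarrow> cmod ?L powr p"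
    by (intro tendsto_powr2[OF tendsto_norm tendsto_const]) (use p_ge_1 in auto)
  then have lim: "(\<lambda>n. ennreal (cmod (coefficient (corrected n f)) powr p))
      \<longlonglongrightarrow> ennreal (cmod ?L powr p)"
    by (rule tendsto_ennrealI)
  have lim2: "(\<lambda>n. ?K * (?I
           + ?e n))
      \<longlonglongrightarrow> ?K * (?I + 0)"
    by (intro ennreal_tendsto_cmult tendsto_add tendsto_const corrected_approximates[OF assms]) simp
  have "ennreal (cmod (coefficient (corrected n f)) powr p) \<le> ?K *
      (?I + ?e n)" for n
  proof -
    obtain K where K: "\<And>z. cmod (corrected n f z) \<le> K" using corrected_bounded[OF assms] by blast
    have "ennreal (cmod (coefficient (corrected n f)) powr p)
        \<le> ennreal (D * 2 powr p) * p_integral torus p (\<lambda>z. corrected n f z * M z)"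
      by (rule coefficient_bound_mean_zero[OF _ K corrected_mean_zero[OF assms]]) measurable
    also have "\<dots> \<le> ennreal (D * 2 powr p) * (ennreal (2 powr p) *
      (?I + ?e n))"
      by (intro mult_left_mono p_integral_perturb) auto
    finally show ?thesis using D_nonneg by (simp add: ennreal_mult mult.assoc)
  qed
  then have "ennreal (cmod ?L powr p)
      \<le> ?K * (?I + 0)"
    by (intro LIMSEQ_le[OF lim lim2]) auto
  then show ?thesis by simp
qed

lemma limit_symbol_conj_integrable:
  "conj_integrable torus p (\<lambda>z. (cis (- fst z) - limit_symbol (snd z)) / M z)"
proof (rule conj_integrable_of_bounded_pairing[where K = 2 and C = "D * 2 powr p * 2 powr p"])
  show "cmod (cis (- fst z) - limit_symbol (snd z)) \<le> 2" for z :: "real \<times> real"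
    using norm_triangle_ineq4[of "cis (- fst z)" "limit_symbol (snd z)"] norm_limit_symbol[of "snd z"] by simp
  show "finite_measure torus" by (rule torus.finite_measure_axioms)
qed (use p_ge_1 M_nonzero M_integrable D_nonneg limit_symbol_pairing_bound in auto)

text \<open>Where the symbol stays away from the unit circle, the numerator stays away from zero and
  \<open>1 / M\<close> would be integrable over a strip.\<close>

lemma AE_limit_symbol_unimodular: "AE y in circle. cmod (limit_symbol y) = 1"
proof -
  define E where "E n = {y. cmod (limit_symbol y) \<le> 1 - 1 / real (Suc n)}" for n
  have "limit_symbol \<in> borel_measurable borel"
    using limit_symbol_measurable by (simp add: borel_measurable_circle_iff)
  then have [measurable]: "E n \<in> sets borel" for n unfolding E_def by measurable
  have "emeasure circle (E n) = 0" for n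
  proof -
    have "conj_integrable torus p (\<lambda>z. indicator (E n) (snd z) / M z)"
    proof (rule conj_integrable_mono[OF p_ge_1 limit_symbol_conj_integrable])
      have "cmod (indicator (E n) (snd z) / M z)
          \<le> real (Suc n) * cmod ((cis (- fst z) - limit_symbol (snd z)) / M z)" for z
      proof (cases "snd z \<in> E n")
        case True
        have "1 - cmod (limit_symbol (snd z)) \<le> cmod (cis (- fst z) - limit_symbol (snd z))"
          using norm_triangle_ineq2[of "cis (- fst z)" "limit_symbol (snd z)"] by simp
        moreover have "1 / real (Suc n) \<le> 1 - cmod (limit_symbol (snd z))"
          using True by (simp add: E_def)
        ultimately have "1 / real (Suc n) \<le> cmod (cis (- fst z) - limit_symbol (snd z))"
          by linarith
        then have "1 \<le> real (Suc n) * cmod (cis (- fst z) - limit_symbol (snd z))"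
          by (simp add: pos_divide_le_eq mult.commute del: of_nat_Suc)
        then have "1 / cmod (M z) \<le> real (Suc n) * cmod (cis (- fst z) - limit_symbol (snd z)) / cmod (M z)"
          by (rule divide_right_mono) simp
        then show ?thesis using True by (simp add: norm_divide)
      qed simp
      then show "AE z in torus. cmod (indicator (E n) (snd z) / M z)
          \<le> real (Suc n) * cmod ((cis (- fst z) - limit_symbol (snd z)) / M z)"
        by simp
    qed measurable
    then show ?thesis using singular by (auto simp: strip_singular_def)
  qed
  then have "AE y in circle. \<forall>n. y \<notin> E n"
    by (intro AE_all_countable[THEN iffD2] allI AE_not_in) (auto simp: null_sets_def sets_circle)
  then show ?thesis
  proof eventually_elim
    case (elim y)
    have "\<not> 0 < 1 - cmod (limit_symbol y)"
    proof
      assume "0 < 1 - cmod (limit_symbol y)"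
      then obtain n where "1 / real (Suc n) < 1 - cmod (limit_symbol y)" by (rule nat_approx_posE)
      with elim show False by (auto simp: E_def dest!: spec[of _ n])
    qed
    with norm_limit_symbol[of y] show ?case by simp
  qed
qed

end

text \<open>The limit symbol belongs to the numerator \<open>e\<^sup>-\<^sup>i\<^sup>x\<close> of the coefficient functional, hence the
  conjugation.\<close>

lemma (in coefficient_bounded_weight) unimodular_symbol_exists:
  obtains P where "P \<in> borel_measurable borel" "AE y in circle. cmod (P y) = 1"
    "conj_integrable torus p (\<lambda>z. (cis (fst z) - P (snd z)) / M z)"
proof -
  obtain u B where "averaging_kernels p M u B" using averaging_kernels_exist by blast
  then interpret averaging_kernels p M u B .
  interpret symbol_construction p M D u B ..
  have [measurable]: "limit_symbol \<in> borel_measurable borel"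
    using limit_symbol_measurable by (simp add: borel_measurable_circle_iff)
  show thesis
  proof (rule that[of "\<lambda>y. cnj (limit_symbol y)"])
    show "AE y in circle. cmod (cnj (limit_symbol y)) = 1"
      using AE_limit_symbol_unimodular by simp
    show "conj_integrable torus p (\<lambda>z. (cis (fst z) - cnj (limit_symbol (snd z))) / M z)"
    proof (rule conj_integrable_mono[OF p_ge_1 limit_symbol_conj_integrable])
      have "cis (fst z) - cnj (limit_symbol (snd z)) = cnj (cis (- fst z) - limit_symbol (snd z))" for z
        by (simp add: cis_cnj)
      then have "cmod (cis (fst z) - cnj (limit_symbol (snd z))) = cmod (cis (- fst z) - limit_symbol (snd z))" for z
        by (simp only: complex_mod_cnj)
      then show "AE z in torus. cmod ((cis (fst z) - cnj (limit_symbol (snd z))) / M z)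
          \<le> 1 * cmod ((cis (- fst z) - limit_symbol (snd z)) / M z)"
        by (simp add: norm_divide)
    qed measurable
  qed measurable
qed

section \<open>Completeness and minimality in terms of the weight\<close>

definition span_approximates ::
    "real \<Rightarrow> (real \<times> real \<Rightarrow> complex) \<Rightarrow> (int \<times> int) set \<Rightarrow> (real \<times> real \<Rightarrow> complex) \<Rightarrow> bool" where
  "span_approximates p M I f \<longleftrightarrow>
     (\<forall>e>0. \<exists>S\<in>lin_span char I. p_integral torus p (\<lambda>z. f z - M z * S z) < ennreal e)"

context weight
begin

text \<open>Every element of the span vanishes where \<open>M\<close> does, so it cannot approximate the indicator of
  that set.\<close>

lemma nonzero_if_span_dense:
  assumes "\<And>f. f \<in> borel_measurable torus \<Longrightarrow> p_integral torus p f < \<infinity> \<Longrightarrow> span_approximates p M off_axis f"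
  shows "AE z in torus. M z \<noteq> 0"
proof -
  define f :: "real \<times> real \<Rightarrow> complex" where "f z = (if M z = 0 then 1 else 0)" for z
  have [measurable]: "f \<in> borel_measurable torus" unfolding f_def by measurable
  have f01: "cmod (f z) powr p = indicator {z. M z = 0} z" for z
    using p_ge_1 by (simp add: f_def)
  have [measurable]: "{z. M z = 0} \<in> sets torus"
    using measurable_sets[OF M_measurable, of "{0}"] by (simp add: vimage_def)
  have f_eq: "p_integral torus p f = emeasure torus {z. M z = 0}"
    unfolding p_integral_def f01 by (simp add: ennreal_indicator)
  have "p_integral torus p f < \<infinity>"
    unfolding f_eq infinity_ennreal_def by (rule less_top[THEN iffD1]) (use torus.emeasure_finite in simp)
  then have approx: "span_approximates p M off_axis f" by (intro assms) auto
  have small: "emeasure torus {z. M z = 0} \<le> ennreal e" if e: "0 < e" for e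
  proof -
    obtain S where S: "S \<in> lin_span char off_axis" "p_integral torus p (\<lambda>z. f z - M z * S z) < ennreal e"
      using approx e by (auto simp: span_approximates_def)
    have "p_integral torus p f \<le> p_integral torus p (\<lambda>z. f z - M z * S z)"
      using p_ge_1 by (intro p_integral_mono_AE) (auto simp: f_def)
    with S show ?thesis by (simp add: f_eq)
  qed
  have "emeasure torus {z. M z = 0} \<le> 0"
    by (rule ennreal_le_epsilon) (simp add: small)
  then show ?thesis by (intro AE_I'[of "{z. M z = 0}"]) (auto simp: null_sets_def)
qed

lemma integral_off_axis_times_strip:
  assumes i: "i \<in> off_axis" and [measurable]: "r \<in> borel_measurable circle" and r: "\<And>y. cmod (r y) \<le> C"
  shows "(\<integral>z. char i z * r (snd z) \<partial>torus) = 0"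
proof -
  obtain k m where km: "i = (k, m)" by (cases i)
  have k: "k \<noteq> 0" using i by (auto simp: km off_axis_def)
  have b: "cmod (char i z * r (snd z)) \<le> C" for z using r by (simp add: norm_mult)
  have "(\<integral>z. char i z * r (snd z) \<partial>torus) = (\<integral>y. (\<integral>x. char i (x, y) * r y \<partial>circle) \<partial>circle)"
    by (subst integral_torus_iterated[OF _ b]) auto
  also have "\<dots> = (\<integral>y. (\<integral>x. cis (of_int k * x) \<partial>circle) * (cis (of_int m * y) * r y) \<partial>circle)"
    by (simp add: km char_apply mult.assoc)
  finally show ?thesis using k by (simp add: integral_cis_circle)
qed

lemma integral_trig_polynomial_times_strip:
  assumes S: "S \<in> lin_span char off_axis" and [measurable]: "r \<in> borel_measurable circle"
    and r: "\<And>y. cmod (r y) \<le> C"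
  shows "(\<integral>z. S z * r (snd z) \<partial>torus) = 0"
proof -
  obtain F c where F: "finite F" "F \<subseteq> off_axis" and S_eq: "S = (\<lambda>z. \<Sum>i\<in>F. c i * char i z)"
    using S by (auto simp: lin_span_def)
  have int: "integrable torus (\<lambda>z. c i * (char i z * r (snd z)))" for i
    by (intro integrable_mult_right integrable_bounded_torus[where B = C]) (use r in \<open>auto simp: norm_mult\<close>)
  have "(\<integral>z. S z * r (snd z) \<partial>torus) = (\<integral>z. (\<Sum>i\<in>F. c i * (char i z * r (snd z))) \<partial>torus)"
    by (simp add: S_eq sum_distrib_right mult.assoc)
  also have "\<dots> = (\<Sum>i\<in>F. c i * (\<integral>z. char i z * r (snd z) \<partial>torus))"
    by (subst Bochner_Integration.integral_sum[OF int]) simp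
  also have "\<dots> = 0"
  proof (intro sum.neutral ballI)
    fix i assume "i \<in> F"
    then have "i \<in> off_axis" using F by auto
    from integral_off_axis_times_strip[OF this assms(2) r]
    show "c i * (\<integral>z. char i z * r (snd z) \<partial>torus) = 0" by simp
  qed
  finally show ?thesis .
qed

text \<open>If \<open>1 / M\<close> were conjugate integrable over a strip, it would annihilate the system there
  without annihilating \<open>M\<close> itself.\<close>

lemma strip_singular_if_span_dense:
  assumes M0: "AE z in torus. M z \<noteq> 0" and approx: "span_approximates p M off_axis M"
  shows "strip_singular p M"
  unfolding strip_singular_def
proof (intro ballI impI)
  fix E :: "real set"
  assume [measurable]: "E \<in> sets borel" and conj: "conj_integrable torus p (\<lambda>z. indicator E (snd z) / M z)"
  have "2 * pi * measure circle E < e" if e: "0 < e" for e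
  proof -
    obtain d where d: "0 < d" "\<And>s. s \<in> borel_measurable torus \<Longrightarrow> p_integral torus p s < ennreal d \<Longrightarrow>
        (\<integral>\<^sup>+z. ennreal (cmod (s z * (indicator E (snd z) / M z))) \<partial>torus) < ennreal e"
      by (rule conj_integrable_pairing_small[OF p_ge_1 conj _ e]) (auto simp: sets_circle)
    obtain S where S: "S \<in> lin_span char off_axis" "p_integral torus p (\<lambda>z. M z - M z * S z) < ennreal d"
      using approx d(1) by (auto simp: span_approximates_def)
    have [measurable]: "S \<in> borel_measurable torus" by (rule lin_span_char_measurable[OF S(1)])
    obtain K where K: "\<And>z. cmod (S z) \<le> K" using lin_span_char_bounded[OF S(1)] by blast
    have K0: "0 \<le> K" using K[of undefined] norm_ge_zero order_trans by blast
    have int: "integrable torus (\<lambda>z. indicator E (snd z) :: complex)"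
      "integrable torus (\<lambda>z. S z * indicator E (snd z))"
      by (rule integrable_bounded_torus[where B = 1], simp_all add: indicator_def)
        (rule integrable_bounded_torus[where B = K], simp_all add: indicator_def K K0)
    have "(\<integral>z. (1 - S z) * indicator E (snd z) \<partial>torus) = (\<integral>z. indicator E (snd z) \<partial>torus)"
      using int integral_trig_polynomial_times_strip[OF S(1), of "indicator E" 1]
      by (simp add: left_diff_distrib indicator_def)
    also have "\<dots> = (\<integral>y. (\<integral>x. indicator E y \<partial>circle) \<partial>circle)"
      by (subst integral_torus_iterated[where B = 1]) (auto simp: indicator_def)
    also have "\<dots> = of_real (2 * pi * measure circle E)"
    proof -
      have "(\<integral>y. indicator E y \<partial>circle) = (\<integral>y. complex_of_real (indicator E y) \<partial>circle)"
        by (intro Bochner_Integration.integral_cong) (auto simp: indicator_def)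
      then show ?thesis by (simp add: measure_circle_UNIV scaleR_conv_of_real)
    qed
    finally have "cmod (\<integral>z. (1 - S z) * indicator E (snd z) \<partial>torus) = 2 * pi * measure circle E"
      by (simp add: norm_mult)
    then have "ennreal (2 * pi * measure circle E) = ennreal (cmod (\<integral>z. (1 - S z) * indicator E (snd z) \<partial>torus))"
      by simp
    also have "\<dots> \<le> (\<integral>\<^sup>+z. ennreal (cmod ((1 - S z) * indicator E (snd z))) \<partial>torus)"
      by (rule integral_norm_bound_ennreal) (use int in \<open>simp add: left_diff_distrib\<close>)
    also have "\<dots> = (\<integral>\<^sup>+z. ennreal (cmod ((M z - M z * S z) * (indicator E (snd z) / M z))) \<partial>torus)"
    proof (rule nn_integral_cong_AE)
      show "AE z in torus. ennreal (cmod ((1 - S z) * indicator E (snd z)))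
          = ennreal (cmod ((M z - M z * S z) * (indicator E (snd z) / M z)))"
        using M0
      proof eventually_elim
        case (elim z)
        have "M z - M z * S z = M z * (1 - S z)" by (simp add: right_diff_distrib)
        then show ?case using elim by (simp add: norm_mult norm_divide)
      qed
    qed
    also have "\<dots> < ennreal e"
      by (rule d(2)) (use S in auto)
    finally have "ennreal (2 * pi * measure circle E) < ennreal e" .
    then show ?thesis by (simp add: ennreal_less_iff)
  qed
  from this[of "2 * pi * measure circle E"] have "\<not> 0 < measure circle E" by auto
  then have "measure circle E = 0" using measure_nonneg[of circle E] by linarith
  then show "emeasure circle E = 0" by (simp add: circle.emeasure_eq_measure)
qed

text \<open>The functional dual to the exponential \<open>(k, m)\<close> is \<open>e\<^sup>-\<^sup>i\<^sup>m\<^sup>y (e\<^sup>-\<^sup>i\<^sup>k\<^sup>x - P(y)\<^sup>-\<^sup>k) / M\<close>. Its numerator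
  is at most \<open>\<bar>k\<bar> \<bar>e\<^sup>i\<^sup>x - P(y)\<bar>\<close> because both \<open>e\<^sup>i\<^sup>x\<close> and \<open>P(y)\<close> have modulus one.\<close>

lemma span_does_not_approximate_own_exponential:
  assumes M0: "AE z in torus. M z \<noteq> 0" and [measurable]: "P \<in> borel_measurable borel"
    and P: "\<And>y. cmod (P y) = 1"
    and conj: "conj_integrable torus p (\<lambda>z. (cis (fst z) - P (snd z)) / M z)"
    and i: "i \<in> off_axis"
  shows "\<not> span_approximates p M (off_axis - {i}) (\<lambda>z. M z * char i z)"
proof
  assume approx: "span_approximates p M (off_axis - {i}) (\<lambda>z. M z * char i z)"
  obtain k m where km: "i = (k, m)" by (cases i)
  have [measurable]: "P \<in> borel_measurable circle"
    by (simp add: borel_measurable_circle_iff)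
  define n where "n = nat \<bar>k\<bar>"
  \<comment> \<open>Conjugation inverts numbers of modulus one; with it only natural powers are needed.\<close>
  define \<sigma> where "\<sigma> = (if 0 \<le> k then cnj else id)"
  have [measurable]: "\<sigma> \<in> borel_measurable borel" by (simp add: \<sigma>_def)
  have \<sigma>: "cmod (\<sigma> w) = cmod w" "\<sigma> (v - w) = \<sigma> v - \<sigma> w" for v w by (simp_all add: \<sigma>_def)
  define r where "r y = \<sigma> (P y) ^ n * cis (- of_int m * y)" for y
  have [measurable]: "r \<in> borel_measurable circle" unfolding r_def by measurable
  have r1: "cmod (r y) \<le> 1" for y by (simp add: r_def norm_mult norm_power \<sigma> P)
  define N where "N z = char (- i) z - r (snd z)" for z
  have [measurable]: "N \<in> borel_measurable torus" unfolding N_def by measurable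
  have N_eq: "N z = (\<sigma> (cis (fst z)) ^ n - \<sigma> (P (snd z)) ^ n) * cis (- of_int m * snd z)" for z
  proof -
    have "\<sigma> (cis x) ^ n = cis (- of_int k * x)" for x
      by (auto simp: \<sigma>_def n_def cis_cnj Complex.DeMoivre)
    then show ?thesis by (cases z) (simp add: N_def r_def km char_def left_diff_distrib)
  qed
  have N_le: "cmod (N z) \<le> real n * cmod (cis (fst z) - P (snd z))" for z
  proof -
    have "cmod (N z) = cmod (\<sigma> (cis (fst z)) ^ n - \<sigma> (P (snd z)) ^ n)"
      by (simp add: N_eq norm_mult)
    also have "\<dots> \<le> real n * cmod (\<sigma> (cis (fst z)) - \<sigma> (P (snd z)))"
      by (rule norm_power_diff) (auto simp: \<sigma> P)
    finally show ?thesis by (simp flip: \<sigma>(2) add: \<sigma>(1))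
  qed
  have conjN: "conj_integrable torus p (\<lambda>z. N z / M z)"
  proof (rule conj_integrable_mono[OF p_ge_1 conj])
    show "AE z in torus. cmod (N z / M z) \<le> real n * cmod ((cis (fst z) - P (snd z)) / M z)"
      using N_le by (intro AE_I2) (simp add: norm_divide divide_right_mono)
  qed measurable
  have pos: "0 < (2 * pi)\<^sup>2" by simp
  obtain d where d: "0 < d" "\<And>s. s \<in> borel_measurable torus \<Longrightarrow> p_integral torus p s < ennreal d \<Longrightarrow>
        (\<integral>\<^sup>+z. ennreal (cmod (s z * (N z / M z))) \<partial>torus) < ennreal ((2 * pi)\<^sup>2)"
    by (rule conj_integrable_pairing_small[OF p_ge_1 conjN _ pos]) measurable
  obtain S where S: "S \<in> lin_span char (off_axis - {i})"
      "p_integral torus p (\<lambda>z. M z * char i z - M z * S z) < ennreal d"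
    using approx d(1) by (auto simp: span_approximates_def)
  have [measurable]: "S \<in> borel_measurable torus" by (rule lin_span_char_measurable[OF S(1)])
  have pair: "(\<integral>z. char j z * N z \<partial>torus) = (if j = i then (2 * pi)\<^sup>2 else 0)"
      "integrable torus (\<lambda>z. char j z * N z)" if "j \<in> off_axis" for j
  proof -
    have int: "integrable torus (char (j + - i))" "integrable torus (\<lambda>z. char j z * r (snd z))"
      using r1 by (auto intro!: integrable_bounded_torus[where B = 1] simp: norm_mult)
    have eq: "char j z * N z = char (j + - i) z - char j z * r (snd z)" for z
      unfolding char_add by (simp add: N_def right_diff_distrib)
    show "integrable torus (\<lambda>z. char j z * N z)" unfolding eq using int by auto
    show "(\<integral>z. char j z * N z \<partial>torus) = (if j = i then (2 * pi)\<^sup>2 else 0)"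
    proof -
      have "(\<integral>z. char j z * r (snd z) \<partial>torus) = 0"
        by (rule integral_off_axis_times_strip[OF that _ r1]) measurable
      then show ?thesis
        unfolding eq Bochner_Integration.integral_diff[OF int] by (simp add: integral_char)
    qed
  qed
  obtain F c where F: "finite F" "F \<subseteq> off_axis - {i}" and S_eq: "S = (\<lambda>z. \<Sum>j\<in>F. c j * char j z)"
    using S by (auto simp: lin_span_def)
  have intS: "integrable torus (\<lambda>z. c j * (char j z * N z))" if "j \<in> F" for j
    using that F pair(2)[of j] by auto
  have SN: "S z * N z = (\<Sum>j\<in>F. c j * (char j z * N z))" for z
    by (simp add: S_eq sum_distrib_right mult.assoc)
  have "(\<integral>z. S z * N z \<partial>torus) = (\<Sum>j\<in>F. c j * (\<integral>z. char j z * N z \<partial>torus))"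
    unfolding SN by (subst Bochner_Integration.integral_sum[OF intS]) auto
  also have "\<dots> = 0"
  proof (intro sum.neutral ballI)
    fix j assume "j \<in> F"
    then have "j \<in> off_axis" "j \<noteq> i" using F by auto
    then show "c j * (\<integral>z. char j z * N z \<partial>torus) = 0" by (simp add: pair(1)[of j])
  qed
  finally have S0: "(\<integral>z. S z * N z \<partial>torus) = 0" .
  have int_SN: "integrable torus (\<lambda>z. S z * N z)" unfolding SN using intS by auto
  have "(\<integral>z. (char i z - S z) * N z \<partial>torus) = (2 * pi)\<^sup>2"
    using int_SN pair[OF i] S0 by (simp add: left_diff_distrib)
  then have "ennreal ((2 * pi)\<^sup>2) = ennreal (cmod (\<integral>z. (char i z - S z) * N z \<partial>torus))"
    by (simp add: norm_power norm_mult)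
  also have "\<dots> \<le> (\<integral>\<^sup>+z. ennreal (cmod ((char i z - S z) * N z)) \<partial>torus)"
    by (rule integral_norm_bound_ennreal) (use int_SN pair(2)[OF i] in \<open>simp add: left_diff_distrib\<close>)
  also have "\<dots> = (\<integral>\<^sup>+z. ennreal (cmod ((M z * char i z - M z * S z) * (N z / M z))) \<partial>torus)"
  proof (rule nn_integral_cong_AE)
    show "AE z in torus. ennreal (cmod ((char i z - S z) * N z))
        = ennreal (cmod ((M z * char i z - M z * S z) * (N z / M z)))"
      using M0
    proof eventually_elim
      case (elim z)
      have "M z * char i z - M z * S z = M z * (char i z - S z)" by (simp add: right_diff_distrib)
      then show ?case using elim by (simp add: norm_mult norm_divide)
    qed
  qed
  also have "\<dots> < ennreal ((2 * pi)\<^sup>2)" by (rule d(2)) (use S in auto)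
  finally show False by simp
qed

end

lemma (in singular_weight) symbol_if_not_approximated:
  assumes "\<not> span_approximates p M (off_axis - {(1, 0)}) (\<lambda>z. M z * char (1, 0) z)"
  obtains P where "P \<in> borel_measurable borel" "AE y in circle. cmod (P y) = 1"
    "conj_integrable torus p (\<lambda>z. (cis (fst z) - P (snd z)) / M z)"
proof -
  obtain d where d: "0 < d" "\<And>S. S \<in> lin_span char (off_axis - {(1, 0)}) \<Longrightarrow>
      ennreal d \<le> p_integral torus p (\<lambda>z. M z * char (1, 0) z - M z * S z)"
    using assms by (auto simp: span_approximates_def not_less)
  interpret coefficient_bounded_weight p M "(2 * pi)\<^sup>2 powr p / d"
  proof
    show "0 \<le> (2 * pi)\<^sup>2 powr p / d" using d by simp
  qed (use coefficient_bound_of_distance[OF d(1)] d(2) in \<open>simp add: right_diff_distrib\<close>)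
  show thesis by (rule unimodular_symbol_exists) (rule that)
qed

section \<open>From Lebesgue to Borel measurability\<close>

text \<open>Lebesgue measure on the torus is the completion of its Borel measure, so that all notions
  in question only depend on Borel representatives of \<open>M\<close>, \<open>P\<close> and the approximated functions.\<close>

lemma circ_Times_lebesgue: "circ \<times> circ \<in> sets lebesgue"
  using circ_Times_borel by simp

lemma AE_lebesgue_on_iff_torus:
  assumes S: "S \<in> sets lebesgue" "S \<subseteq> circ \<times> circ"
  shows "(AE z in lebesgue_on S. Q z) \<longleftrightarrow> (AE z in torus. z \<in> S \<longrightarrow> Q z)"
proof -
  have "(AE z in lebesgue_on S. Q z) \<longleftrightarrow> (AE z in lborel. z \<in> S \<longrightarrow> Q z)"
    using S by (simp add: AE_restrict_space_iff AE_completion_iff)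
  also have "\<dots> \<longleftrightarrow> (AE z in lborel. z \<in> circ \<times> circ \<longrightarrow> z \<in> S \<longrightarrow> Q z)"
    using S(2) by (intro AE_cong_simp refl arg_cong[where f = "\<lambda>Q. AE z in lborel. Q z"] ext) auto
  also have "\<dots> \<longleftrightarrow> (AE z in torus. z \<in> S \<longrightarrow> Q z)"
    unfolding torus_eq_density
    by (subst AE_density)
      (auto intro: borel_measurable_indicator simp: circ_Times_borel indicator_def)
  finally show ?thesis .
qed

lemma AE_torus_measure_iff: "(AE z in torus_measure. Q z) \<longleftrightarrow> (AE z in torus. Q z)"
proof -
  have "(AE z in torus_measure. Q z) \<longleftrightarrow> (AE z in torus. z \<in> circ \<times> circ \<longrightarrow> Q z)"
    by (rule AE_lebesgue_on_iff_torus) (auto simp: circ_Times_lebesgue)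
  also have "\<dots> \<longleftrightarrow> (AE z in torus. Q z)"
    using AE_torus_circ by (auto elim: eventually_elim2)
  finally show ?thesis .
qed

lemma AE_circ_measure_iff: "(AE y in circ_measure. Q y) \<longleftrightarrow> (AE y in circle. Q y)"
proof -
  have "circ \<in> sets lebesgue" by simp
  then have "(AE y in circ_measure. Q y) \<longleftrightarrow> (AE y in lborel. y \<in> circ \<longrightarrow> Q y)"
    by (simp add: AE_restrict_space_iff AE_completion_iff)
  also have "\<dots> \<longleftrightarrow> (AE y in circle. Q y)"
    unfolding circle_def by (subst AE_density) (auto simp: indicator_def)
  finally show ?thesis .
qed

text \<open>Completing a measure does not change nonnegative integrals, even those of functions that are
  not Borel; hence almost everywhere equality with a Borel function suffices.\<close>

lemma nn_integral_lebesgue_on_eq_torus: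
  assumes S: "S \<in> sets lebesgue" "S \<subseteq> circ \<times> circ"
    and g: "g \<in> borel_measurable torus"
    and eq: "AE z in torus. f z * indicator S z = g z"
  shows "(\<integral>\<^sup>+z. f z \<partial>lebesgue_on S) = (\<integral>\<^sup>+z. g z \<partial>torus)"
proof -
  have "(\<integral>\<^sup>+z. f z \<partial>lebesgue_on S) = (\<integral>\<^sup>+z. f z * indicator S z \<partial>lborel)"
    using S by (simp add: nn_integral_restrict_space nn_integral_completion)
  also have "\<dots> = (\<integral>\<^sup>+z. indicator (circ \<times> circ) z * g z \<partial>lborel)"
  proof (rule nn_integral_cong_AE)
    have "AE z in lborel. z \<in> circ \<times> circ \<longrightarrow> f z * indicator S z = g z"
      using eq unfolding torus_eq_density
      by (subst (asm) AE_density)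
        (auto intro: borel_measurable_indicator simp: circ_Times_borel indicator_def)
    then show "AE z in lborel. f z * indicator S z = indicator (circ \<times> circ) z * g z"
      by eventually_elim (use S(2) in \<open>auto simp: indicator_def\<close>)
  qed
  also have "\<dots> = (\<integral>\<^sup>+z. g z \<partial>torus)"
    unfolding torus_eq_density using g
    by (subst nn_integral_density)
      (auto intro: borel_measurable_indicator simp: circ_Times_borel borel_measurable_torus_iff)
  finally show ?thesis .
qed

lemma p_integral_torus_measure_eq:
  assumes "g \<in> borel_measurable torus" "AE z in torus. f z = g z"
  shows "p_integral torus_measure p f = p_integral torus p g"
  unfolding p_integral_def
proof (rule nn_integral_lebesgue_on_eq_torus[OF circ_Times_lebesgue order_refl])
  show "AE z in torus. ennreal (cmod (f z) powr p) * indicator (circ \<times> circ) z = ennreal (cmod (g z) powr p)"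
    using assms(2) AE_torus_circ by eventually_elim simp
qed (use assms(1) in measurable)

lemma borel_representative:
  fixes f :: "'a::euclidean_space \<Rightarrow> complex"
  assumes f: "f \<in> borel_measurable (lebesgue_on S)" and S: "S \<in> sets lebesgue"
  obtains g where "g \<in> borel_measurable borel" "AE z in lebesgue_on S. f z = g z"
proof -
  define h where "h z = (if z \<in> S then f z else 0)" for z
  have h: "h \<in> borel_measurable (completion lborel)"
    unfolding h_def using f S by (rule borel_measurable_if_I)
  have ReIm: "(\<lambda>z. Re (h z)) \<in> borel_measurable (completion lborel)"
    "(\<lambda>z. Im (h z)) \<in> borel_measurable (completion lborel)"
    using h by measurable
  obtain a b where ab: "a \<in> borel_measurable lborel" "AE z in lborel. Re (h z) = a z"
    "b \<in> borel_measurable lborel" "AE z in lborel. Im (h z) = b z"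
    using completion_ex_borel_measurable_real[OF ReIm(1)] completion_ex_borel_measurable_real[OF ReIm(2)]
    by blast
  show thesis
  proof (rule that[of "\<lambda>z. Complex (a z) (b z)"])
    have [measurable]: "a \<in> borel_measurable borel" "b \<in> borel_measurable borel" using ab by auto
    have "(\<lambda>z. of_real (a z) + \<i> * of_real (b z)) \<in> borel_measurable borel" by measurable
    then show "(\<lambda>z. Complex (a z) (b z)) \<in> borel_measurable borel"
      by (simp add: Complex_eq)
    have "AE z in lborel. h z = Complex (a z) (b z)"
      using ab(2,4) by eventually_elim (simp add: complex_eq_iff)
    then have "AE z in lborel. z \<in> S \<longrightarrow> f z = Complex (a z) (b z)"
      by eventually_elim (auto simp: h_def)
    then show "AE z in lebesgue_on S. f z = Complex (a z) (b z)"
      using S by (simp add: AE_restrict_space_iff AE_completion_iff)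
  qed
qed

text \<open>A quotient of moduli with the convention \<open>a / 0 = \<infinity>\<close>, compared with the quotient of complex
  numbers, for which \<open>a / 0 = 0\<close>: finiteness of the former norm says in addition that the
  denominator does not vanish.\<close>

lemma Lp_norm_conj_exponent_quotient:
  fixes N M N' M' :: "real \<times> real \<Rightarrow> complex"
  assumes p: "1 \<le> p" and S: "S \<in> sets lebesgue" "S \<subseteq> circ \<times> circ"
    and [measurable]: "N \<in> borel_measurable (lebesgue_on S)" "M \<in> borel_measurable (lebesgue_on S)"
      "N' \<in> borel_measurable torus" "M' \<in> borel_measurable torus"
    and M: "AE z in torus. M z = M' z"
    and N: "AE z in torus. if z \<in> S then N z = N' z \<and> N z \<noteq> 0 else N' z = 0"
  shows "(if p = 1 then Lp_norm (lebesgue_on S) \<infinity> (\<lambda>z. ennreal (cmod (N z)) / ennreal (cmod (M z))) < \<infinity>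
          else (\<integral>\<^sup>+z. ennreal (cmod (N z) powr (p / (p - 1))) / ennreal (cmod (M z) powr (p / (p - 1))) \<partial>lebesgue_on S) < \<infinity>)
     \<longleftrightarrow> (AE z in torus. N' z \<noteq> 0 \<longrightarrow> M' z \<noteq> 0) \<and> conj_integrable torus p (\<lambda>z. N' z / M' z)"
proof (cases "p = 1")
  case True
  define h where "h z = ennreal (cmod (N z)) / ennreal (cmod (M z))" for z
  have [measurable]: "h \<in> borel_measurable (lebesgue_on S)" unfolding h_def by measurable
  have "Lp_norm (lebesgue_on S) \<infinity> h < \<infinity> \<longleftrightarrow> (\<exists>C. AE z in lebesgue_on S. h z \<le> ennreal C)"
  proof
    assume "Lp_norm (lebesgue_on S) \<infinity> h < \<infinity>"
    then obtain C where C: "esssup (lebesgue_on S) h = ennreal C"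
      by (cases "esssup (lebesgue_on S) h") (auto simp: Lp_norm_def)
    then show "\<exists>C. AE z in lebesgue_on S. h z \<le> ennreal C"
      using esssup_AE[of h "lebesgue_on S"] by auto
  next
    assume "\<exists>C. AE z in lebesgue_on S. h z \<le> ennreal C"
    then obtain C where "AE z in lebesgue_on S. h z \<le> ennreal C" ..
    then have "esssup (lebesgue_on S) h \<le> ennreal C" by (intro esssup_I) auto
    then show "Lp_norm (lebesgue_on S) \<infinity> h < \<infinity>"
      by (simp add: Lp_norm_def le_less_trans[OF _ ennreal_less_top])
  qed
  also have "\<dots> \<longleftrightarrow> (\<exists>C. AE z in torus. z \<in> S \<longrightarrow> h z \<le> ennreal C)"
    by (simp add: AE_lebesgue_on_iff_torus[OF S])
  also have "\<dots> \<longleftrightarrow> (AE z in torus. N' z \<noteq> 0 \<longrightarrow> M' z \<noteq> 0) \<and> (\<exists>C. AE z in torus. cmod (N' z / M' z) \<le> C)"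
  proof (intro iffI conjI; (elim exE conjE)?)
    fix C assume C: "AE z in torus. z \<in> S \<longrightarrow> h z \<le> ennreal C"
    have *: "AE z in torus. (N' z \<noteq> 0 \<longrightarrow> M' z \<noteq> 0) \<and> cmod (N' z / M' z) \<le> \<bar>C\<bar>"
      using C M N
    proof eventually_elim
      case (elim z)
      show ?case
      proof (cases "z \<in> S")
        case True
        then have NN: "N' z \<noteq> 0" "N z = N' z" "M z = M' z" using elim by auto
        have "M' z \<noteq> 0"
          using elim(1) True NN by (auto simp: h_def top_unique)
        moreover from this have "ennreal (cmod (N' z / M' z)) \<le> ennreal C"
          using elim(1) True NN by (simp add: h_def divide_ennreal norm_divide)
        then have "cmod (N' z / M' z) \<le> \<bar>C\<bar>"
          by (cases "0 \<le> C") (auto simp: ennreal_neg)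
        ultimately show ?thesis by simp
      qed (use elim in auto)
    qed
    then show "AE z in torus. N' z \<noteq> 0 \<longrightarrow> M' z \<noteq> 0" by eventually_elim simp
    from * have "AE z in torus. cmod (N' z / M' z) \<le> \<bar>C\<bar>" by eventually_elim simp
    then show "\<exists>C. AE z in torus. cmod (N' z / M' z) \<le> C" ..
  next
    fix C assume "AE z in torus. N' z \<noteq> 0 \<longrightarrow> M' z \<noteq> 0" "AE z in torus. cmod (N' z / M' z) \<le> C"
    then have "AE z in torus. z \<in> S \<longrightarrow> h z \<le> ennreal C"
      using M N
      by eventually_elim (auto simp: h_def divide_ennreal norm_divide intro!: ennreal_leI split: if_splits)
    then show "\<exists>C. AE z in torus. z \<in> S \<longrightarrow> h z \<le> ennreal C" ..
  qed
  finally show ?thesis using True by (simp add: conj_integrable_def h_def[abs_def])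
next
  case False
  define q where "q = p / (p - 1)"
  have q: "0 < q" using p False by (simp add: q_def)
  define h where "h z = ennreal (cmod (N z) powr q) / ennreal (cmod (M z) powr q)" for z
  have [measurable]: "h \<in> borel_measurable (lebesgue_on S)" unfolding h_def by measurable
  have eq: "(\<integral>\<^sup>+z. h z \<partial>lebesgue_on S) = p_integral torus q (\<lambda>z. N' z / M' z)"
    if nz: "AE z in torus. N' z \<noteq> 0 \<longrightarrow> M' z \<noteq> 0"
    unfolding p_integral_def
  proof (rule nn_integral_lebesgue_on_eq_torus[OF S])
    show "AE z in torus. h z * indicator S z = ennreal (cmod (N' z / M' z) powr q)"
      using nz M N
      by eventually_elim
        (use q in \<open>auto simp: h_def divide_ennreal norm_divide powr_divide indicator_def split: if_splits\<close>)
  qed measurable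
  have nz: "AE z in torus. N' z \<noteq> 0 \<longrightarrow> M' z \<noteq> 0" if "(\<integral>\<^sup>+z. h z \<partial>lebesgue_on S) < \<infinity>"
  proof -
    have "AE z in lebesgue_on S. h z \<noteq> \<infinity>"
      using that by (intro nn_integral_PInf_AE) auto
    then have "AE z in torus. z \<in> S \<longrightarrow> h z \<noteq> \<infinity>"
      by (simp add: AE_lebesgue_on_iff_torus[OF S])
    then show ?thesis
      using M N by eventually_elim (auto simp: h_def split: if_splits)
  qed
  have "(\<integral>\<^sup>+z. h z \<partial>lebesgue_on S) < \<infinity> \<longleftrightarrow>
      (AE z in torus. N' z \<noteq> 0 \<longrightarrow> M' z \<noteq> 0) \<and> p_integral torus q (\<lambda>z. N' z / M' z) < \<infinity>"
    using nz eq by auto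
  then show ?thesis using False by (simp add: conj_integrable_def h_def[abs_def] q_def)
qed

lemma recip_in_Lp_conj_exponent_iff:
  assumes p: "1 \<le> p" and M: "M \<in> borel_measurable \<mu>"
  shows "recip_in_Lp \<mu> (conj_exponent p) M \<longleftrightarrow>
    (if p = 1 then Lp_norm \<mu> \<infinity> (\<lambda>z. ennreal (cmod 1) / ennreal (cmod (M z))) < \<infinity>
     else (\<integral>\<^sup>+z. ennreal (cmod 1 powr (p / (p - 1))) / ennreal (cmod (M z) powr (p / (p - 1))) \<partial>\<mu>) < \<infinity>)"
proof (cases "p = 1")
  case True
  then show ?thesis using M by (simp add: recip_in_Lp_def conj_exponent_def)
next
  case False
  define q where "q = p / (p - 1)"
  have q: "0 < q" using p False by (simp add: q_def)
  have "ennreal_powr (1 / ennreal a) q = ennreal (1 powr q) / ennreal (a powr q)" if "0 \<le> a" for a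
  proof (cases "a = 0")
    case False
    then have "1 / ennreal a = ennreal (1 / a)" "1 / ennreal (a powr q) = ennreal (1 / a powr q)"
      using that by (simp_all add: divide_ennreal flip: ennreal_1)
    then show ?thesis using that False by (simp add: ennreal_powr_def powr_divide)
  qed (use q in \<open>simp add: ennreal_powr_def\<close>)
  then have "Lp_norm \<mu> (ennreal q) (\<lambda>z. 1 / ennreal (cmod (M z)))
      = ennreal_powr (\<integral>\<^sup>+z. ennreal (1 powr q) / ennreal (cmod (M z) powr q) \<partial>\<mu>) (1 / q)"
    using q by (simp add: Lp_norm_def)
  moreover have "ennreal_powr x (1 / q) < \<infinity> \<longleftrightarrow> x < \<infinity>" for x
    by (simp add: ennreal_powr_def less_top)
  ultimately show ?thesis
    using False M by (simp add: recip_in_Lp_def conj_exponent_def flip: q_def)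
qed

lemma emeasure_circle:
  assumes [measurable]: "A \<in> sets borel"
  shows "emeasure circle A = emeasure lborel (A \<inter> circ)"
proof -
  have "emeasure circle A = (\<integral>\<^sup>+x. indicator circ x * indicator A x \<partial>lborel)"
    unfolding circle_def by (rule emeasure_density) auto
  also have "\<dots> = (\<integral>\<^sup>+x. indicator (A \<inter> circ) x \<partial>lborel)"
    by (rule nn_integral_cong) (simp split: split_indicator)
  also have "\<dots> = emeasure lborel (A \<inter> circ)" by (rule nn_integral_indicator) simp
  finally show ?thesis .
qed

lemma borel_subset_of_circ:
  assumes E: "E \<in> sets lebesgue" "E \<subseteq> circ"
  obtains C where "C \<in> sets borel" "emeasure circle C = emeasure lebesgue E"
    "AE z in torus. z \<in> circ \<times> E \<longleftrightarrow> snd z \<in> C" "circ \<times> E \<in> sets lebesgue"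
proof -
  obtain C N N' where C: "E = C \<union> N" "N \<subseteq> N'" "N' \<in> null_sets lborel" "C \<in> sets lborel"
    using sets_completionE[OF E(1)] by blast
  have [measurable]: "C \<in> sets borel" using C by simp
  have "AE y in circle. y \<notin> N'"
    unfolding circle_def using AE_not_in[OF C(3)] by (subst AE_density) (auto elim: eventually_mono)
  from AE_torus_snd[OF this] AE_torus_circ
  have ae: "AE z in torus. z \<in> circ \<times> E \<longleftrightarrow> snd z \<in> C"
    by eventually_elim (use C in auto)
  have "UNIV \<times> N' \<in> null_sets (lborel \<Otimes>\<^sub>M lborel)"
    using C(3) by (intro lborel.times_in_null_sets2) auto
  then have "UNIV \<times> N' \<in> null_sets lborel" by (simp add: lborel_prod)
  then have "circ \<times> N \<in> sets lebesgue"
    by (rule null_sets_completion) (use C in auto)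
  moreover have "circ \<times> C \<in> sets lebesgue"
    by (rule sets_completionI_sets) (simp flip: borel_prod)
  ultimately have "circ \<times> C \<union> circ \<times> N \<in> sets lebesgue" by (rule sets.Un[rotated])
  then have S: "circ \<times> E \<in> sets lebesgue" by (simp add: C(1) Sigma_Un_distrib2)
  have "C \<inter> circ = C" using C(1) E(2) by auto
  then have "emeasure circle C = emeasure lborel C" by (simp add: emeasure_circle)
  also have "\<dots> = emeasure lebesgue C" by simp
  also have "\<dots> = emeasure lebesgue E"
  proof (rule emeasure_eq_AE)
    have "AE y in lborel. y \<in> C \<longleftrightarrow> y \<in> E"
      using AE_not_in[OF C(3)] by eventually_elim (use C in auto)
    then show "AE y in lebesgue. y \<in> C \<longleftrightarrow> y \<in> E" by (rule AE_completion)
  qed (use E(1) C in auto)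
  finally show thesis using C S ae by (intro that[of C]) auto
qed

lemma strong_x_singularity_iff:
  assumes p: "1 \<le> p" and M: "M \<in> borel_measurable torus_measure"
    and [measurable]: "M' \<in> borel_measurable torus" and MM': "AE z in torus. M z = M' z"
    and M0: "AE z in torus. M' z \<noteq> 0"
  shows "strong_x_singularity p M \<longleftrightarrow> strip_singular p M'"
proof -
  have recip: "recip_in_Lp (lebesgue_on (circ \<times> E)) (conj_exponent p) M
      \<longleftrightarrow> conj_integrable torus p (\<lambda>z. indicator C (snd z) / M' z)"
    if C: "C \<in> sets borel" "AE z in torus. z \<in> circ \<times> E \<longleftrightarrow> snd z \<in> C"
      and S: "circ \<times> E \<in> sets lebesgue" "E \<subseteq> circ" for E C
  proof -
    have [measurable]: "C \<in> sets borel" by fact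
    have [measurable]: "M \<in> borel_measurable (lebesgue_on (circ \<times> E))"
      by (rule measurable_restrict_mono[OF M]) (use S(2) in auto)
    have N: "AE z in torus. if z \<in> circ \<times> E then (1 :: complex) = indicator C (snd z) \<and> (1 :: complex) \<noteq> 0
        else (indicator C (snd z) :: complex) = 0"
      using C(2) by eventually_elim (auto simp: indicator_def)
    have nz: "AE z in torus. (indicator C (snd z) :: complex) \<noteq> 0 \<longrightarrow> M' z \<noteq> 0"
      using M0 by eventually_elim simp
    have sub: "circ \<times> E \<subseteq> circ \<times> circ" using S(2) by auto
    have "recip_in_Lp (lebesgue_on (circ \<times> E)) (conj_exponent p) M
        \<longleftrightarrow> (AE z in torus. (indicator C (snd z) :: complex) \<noteq> 0 \<longrightarrow> M' z \<noteq> 0) \<and>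
          conj_integrable torus p (\<lambda>z. indicator C (snd z) / M' z)"
      unfolding recip_in_Lp_conj_exponent_iff[OF p \<open>M \<in> borel_measurable (lebesgue_on (circ \<times> E))\<close>]
      by (rule Lp_norm_conj_exponent_quotient[OF p S(1) sub _ _ _ _ MM' N]) measurable
    with nz show ?thesis by simp
  qed
  show ?thesis
    unfolding strong_x_singularity_def strip_singular_def
  proof (intro iffI allI ballI impI)
    fix E :: "real set"
    assume strong: "\<forall>E. E \<in> sets lebesgue \<and> E \<subseteq> circ \<and> 0 < emeasure lebesgue E \<longrightarrow>
        \<not> recip_in_Lp (lebesgue_on (circ \<times> E)) (conj_exponent p) M"
      and [measurable]: "E \<in> sets borel"
      and conj: "conj_integrable torus p (\<lambda>z. indicator E (snd z) / M' z)"
    have ae: "AE z in torus. z \<in> circ \<times> (E \<inter> circ) \<longleftrightarrow> snd z \<in> E"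
      using AE_torus_circ by eventually_elim (simp add: mem_Times_iff)
    have S: "circ \<times> (E \<inter> circ) \<in> sets lebesgue"
      by (rule sets_completionI_sets) (simp flip: borel_prod)
    have "recip_in_Lp (lebesgue_on (circ \<times> (E \<inter> circ))) (conj_exponent p) M"
      by (rule recip[OF \<open>E \<in> sets borel\<close> ae S Int_lower2, THEN iffD2]) (rule conj)
    moreover have "E \<inter> circ \<in> sets lebesgue" by (rule sets_completionI_sets) simp
    ultimately have "\<not> 0 < emeasure lebesgue (E \<inter> circ)"
      using strong[THEN spec, of "E \<inter> circ"] by simp
    then have "emeasure lebesgue (E \<inter> circ) = 0" by simp
    then show "emeasure circle E = 0" by (simp add: emeasure_circle)
  next
    fix E :: "real set"
    assume sing: "\<forall>E\<in>sets borel. conj_integrable torus p (\<lambda>z. indicator E (snd z) / M' z) \<longrightarrow> emeasure circle E = 0"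
      and E: "E \<in> sets lebesgue \<and> E \<subseteq> circ \<and> 0 < emeasure lebesgue E"
    then have "E \<in> sets lebesgue" "E \<subseteq> circ" by simp_all
    then obtain C where C: "C \<in> sets borel" "emeasure circle C = emeasure lebesgue E"
      "AE z in torus. z \<in> circ \<times> E \<longleftrightarrow> snd z \<in> C" "circ \<times> E \<in> sets lebesgue"
      by (rule borel_subset_of_circ)
    show "\<not> recip_in_Lp (lebesgue_on (circ \<times> E)) (conj_exponent p) M"
    proof
      assume "recip_in_Lp (lebesgue_on (circ \<times> E)) (conj_exponent p) M"
      then have "conj_integrable torus p (\<lambda>z. indicator C (snd z) / M' z)"
        by (rule recip[OF C(1,3,4), THEN iffD1, rotated]) (use E in simp)
      then have "emeasure circle C = 0" using sing C(1) by blast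
      then have "emeasure lebesgue E = 0" by (rule C(2)[symmetric, THEN trans])
      with E show False by (simp only: less_irrefl simp_thms)
    qed
  qed
qed

text \<open>On each line there is at most one such \<open>x\<close>, namely the argument of \<open>P(y)\<close>.\<close>

lemma AE_torus_cis_neq:
  assumes [measurable]: "P \<in> borel_measurable borel"
  shows "AE z in torus. cis (fst z) \<noteq> P (snd z)"
proof -
  have [measurable]: "P \<in> borel_measurable circle"
    by (simp add: borel_measurable_circle_iff)
  have "AE y in circle. AE x in circle. cis x \<noteq> P y"
  proof (rule AE_I2)
    fix y
    have "AE x in circle. x \<in> circ"
      unfolding circle_def by (subst AE_density) (auto simp: indicator_def)
    with AE_circle_neq[of "Arg2pi (P y)"] show "AE x in circle. cis x \<noteq> P y"
    proof eventually_elim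
      case (elim x)
      then have "Arg2pi (cis x) = x"
        using Arg2pi_exp[of "\<i> * of_real x"] by (simp add: cis_conv_exp circ_def)
      with elim show ?case by auto
    qed
  qed
  then have "AE x in circle. AE y in circle. cis x \<noteq> P y"
    by (subst torus.AE_commute) measurable
  then have "AE x in circle. AE y in circle. cis (fst (x, y)) \<noteq> P (snd (x, y))" by simp
  then show ?thesis by (rule torus.AE_pair_measure[rotated]) measurable
qed

lemma xP_integral_iff:
  assumes p: "1 \<le> p" and M: "M \<in> borel_measurable torus_measure"
    and [measurable]: "M' \<in> borel_measurable torus" and MM': "AE z in torus. M z = M' z"
    and P: "P \<in> borel_measurable circ_measure" and [measurable]: "P' \<in> borel_measurable borel"
    and PP': "AE y in circle. P y = P' y"
  shows "(if p = 1
      then Lp_norm torus_measure \<infinity>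
             (\<lambda>(x, y). ennreal (cmod (exp (\<i> * of_real x) - P y)) / ennreal (cmod (M (x, y)))) < \<infinity>
      else (\<integral>\<^sup>+(x, y). ennreal (cmod (exp (\<i> * of_real x) - P y) powr enn2real (conj_exponent p))
             / ennreal (cmod (M (x, y)) powr enn2real (conj_exponent p)) \<partial>torus_measure) < \<infinity>)
    \<longleftrightarrow> (AE z in torus. M' z \<noteq> 0) \<and> conj_integrable torus p (\<lambda>z. (cis (fst z) - P' (snd z)) / M' z)"
proof -
  have [measurable]: "P' \<in> borel_measurable circle"
    by (simp add: borel_measurable_circle_iff)
  define N where "N z = cis (fst z) - P (snd z)" for z
  define N' where "N' z = cis (fst z) - P' (snd z)" for z
  have N'_meas [measurable]: "N' \<in> borel_measurable torus" unfolding N'_def by measurable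
  have NN': "AE z in torus. N z = N' z \<and> N z \<noteq> 0"
    using AE_torus_snd[OF PP'] AE_torus_cis_neq[OF \<open>P' \<in> borel_measurable borel\<close>]
    by eventually_elim (simp add: N_def N'_def)
  have "(\<lambda>z. P (snd z)) \<in> borel_measurable torus_measure"
  proof (rule measurableI)
    fix A :: "complex set" assume "A \<in> sets borel"
    then have "P -` A \<inter> space circ_measure \<in> sets circ_measure"
      using P by (rule measurable_sets[rotated])
    then have "P -` A \<inter> circ \<in> sets lebesgue"
      by (simp add: sets_restrict_space_iff)
    then have "circ \<times> (P -` A \<inter> circ) \<in> sets lebesgue"
      by (elim borel_subset_of_circ) auto
    moreover have "(\<lambda>z. P (snd z)) -` A \<inter> space torus_measure = circ \<times> (P -` A \<inter> circ)"
      by auto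
    ultimately show "(\<lambda>z. P (snd z)) -` A \<inter> space torus_measure \<in> sets torus_measure"
      using circ_Times_lebesgue by (simp add: sets_restrict_space_iff) blast
  qed simp
  moreover have "(\<lambda>z. cis (fst z)) \<in> borel_measurable torus_measure"
    by (intro measurable_restrict_space1 measurable_completion) (simp flip: borel_prod)
  ultimately have N_meas: "N \<in> borel_measurable torus_measure" unfolding N_def by measurable
  have N: "AE z in torus. if z \<in> circ \<times> circ then N z = N' z \<and> N z \<noteq> 0 else N' z = 0"
    using NN' AE_torus_circ by eventually_elim auto
  have "(AE z in torus. N' z \<noteq> 0 \<longrightarrow> M' z \<noteq> 0) \<longleftrightarrow> (AE z in torus. M' z \<noteq> 0)"
    using NN' by (auto elim: eventually_elim2)
  moreover have "enn2real (conj_exponent p) = p / (p - 1)" if "p \<noteq> 1"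
    using that p by (simp add: conj_exponent_def)
  ultimately show ?thesis
    using Lp_norm_conj_exponent_quotient[OF p circ_Times_lebesgue order_refl N_meas M N'_meas assms(3) MM' N]
    by (cases "p = 1") (simp_all add: N_def N'_def cis_conv_exp split_def)
qed

lemma closed_lin_span_weighted_exponential_iff:
  assumes p: "1 \<le> p" and [measurable]: "M' \<in> borel_measurable torus" "f' \<in> borel_measurable torus"
    and M: "AE z in torus. M z = M' z" and f: "AE z in torus. f z = f' z"
    and fLp: "f \<in> Lp torus_measure (ennreal p)"
  shows "f \<in> closed_lin_span torus_measure (ennreal p) (weighted_exponential M) I
           \<longleftrightarrow> span_approximates p M' I f'"
proof -
  have p0: "0 < p" using p by simp
  have norm_less: "Lp_norm torus_measure (ennreal p) (\<lambda>z. ennreal (cmod (f z - M z * S z))) < ennreal e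
      \<longleftrightarrow> p_integral torus p (\<lambda>z. f' z - M' z * S z) < ennreal (e powr p)"
    if "S \<in> lin_span char I" "0 < e" for S e
  proof -
    have [measurable]: "S \<in> borel_measurable torus" by (rule lin_span_char_measurable[OF that(1)])
    have "p_integral torus_measure p (\<lambda>z. f z - M z * S z) = p_integral torus p (\<lambda>z. f' z - M' z * S z)"
    proof (rule p_integral_torus_measure_eq)
      show "AE z in torus. f z - M z * S z = f' z - M' z * S z"
        using M f by eventually_elim simp
    qed measurable
    then show ?thesis unfolding Lp_norm_less_iff[OF p0 that(2)] by simp
  qed
  show ?thesis
  proof
    assume f_in: "f \<in> closed_lin_span torus_measure (ennreal p) (weighted_exponential M) I"
    show "span_approximates p M' I f'"
      unfolding span_approximates_def
    proof (intro allI impI)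
      fix e :: real assume e: "0 < e"
      define d where "d = e powr (1 / p)"
      have d: "0 < d" "d powr p = e" using e p0 by (simp_all add: d_def powr_powr)
      obtain g where g: "g \<in> lin_span (weighted_exponential M) I"
        "Lp_norm torus_measure (ennreal p) (\<lambda>z. ennreal (cmod (f z - g z))) < ennreal d"
        using f_in d(1) unfolding closed_lin_span_def by (auto dest!: spec[of _ "ennreal d"])
      then obtain S where S: "S \<in> lin_span char I" "g = (\<lambda>z. M z * S z)"
        by (auto simp: lin_span_weighted_exponential)
      then show "\<exists>S\<in>lin_span char I. p_integral torus p (\<lambda>z. f' z - M' z * S z) < ennreal e"
        using norm_less[OF S(1) d(1)] g(2) d(2) by auto
    qed
  next
    assume approx: "span_approximates p M' I f'"
    have "\<exists>g\<in>lin_span (weighted_exponential M) I.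
        Lp_norm torus_measure (ennreal p) (\<lambda>z. ennreal (cmod (f z - g z))) < \<epsilon>" if "0 < \<epsilon>" for \<epsilon>
    proof -
      obtain e where e: "0 < e" "ennreal e \<le> \<epsilon>"
      proof (cases \<epsilon>)
        case (real r)
        then show thesis using that(1) \<open>0 < \<epsilon>\<close> by (intro that[of r]) auto
      qed (use that[of 1] in auto)
      have "0 < e powr p" using e(1) by simp
      then obtain S where S: "S \<in> lin_span char I"
          "p_integral torus p (\<lambda>z. f' z - M' z * S z) < ennreal (e powr p)"
        using approx unfolding span_approximates_def by blast
      then have "Lp_norm torus_measure (ennreal p) (\<lambda>z. ennreal (cmod (f z - M z * S z))) < \<epsilon>"
        using norm_less[OF S(1) e(1)] e(2) by (auto intro: less_le_trans)
      with S(1) show ?thesis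
        unfolding lin_span_weighted_exponential by (intro bexI[of _ "\<lambda>z. M z * S z"] imageI)
    qed
    with fLp show "f \<in> closed_lin_span torus_measure (ennreal p) (weighted_exponential M) I"
      by (simp add: closed_lin_span_def)
  qed
qed

lemma torus_borel_representative:
  fixes f :: "real \<times> real \<Rightarrow> complex"
  assumes "f \<in> borel_measurable torus_measure"
  obtains g where "g \<in> borel_measurable torus" "AE z in torus. f z = g z"
  using borel_representative[OF assms circ_Times_lebesgue]
  unfolding AE_torus_measure_iff borel_measurable_torus_iff by blast

lemma borel_measurable_torus_measure:
  fixes g :: "real \<times> real \<Rightarrow> complex"
  assumes "g \<in> borel_measurable torus"
  shows "g \<in> borel_measurable torus_measure"
  using assms unfolding borel_measurable_torus_iff
  by (intro measurable_restrict_space1 measurable_completion) simp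

lemma complete_system_weighted_exponential_iff:
  assumes p: "1 \<le> p" and [measurable]: "M' \<in> borel_measurable torus" and M: "AE z in torus. M z = M' z"
  shows "complete_system torus_measure (ennreal p) (weighted_exponential M) I \<longleftrightarrow>
    (\<forall>f. f \<in> borel_measurable torus \<longrightarrow> p_integral torus p f < \<infinity> \<longrightarrow> span_approximates p M' I f)"
proof -
  have p0: "0 < p" using p by simp
  have "complete_system torus_measure (ennreal p) (weighted_exponential M) I \<longleftrightarrow>
      (\<forall>f\<in>Lp torus_measure (ennreal p). f \<in> closed_lin_span torus_measure (ennreal p) (weighted_exponential M) I)"
    by (auto simp: complete_system_def closed_lin_span_def)
  also have "\<dots> \<longleftrightarrow> (\<forall>f. f \<in> borel_measurable torus \<longrightarrow> p_integral torus p f < \<infinity> \<longrightarrow> span_approximates p M' I f)"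
  proof (intro iffI allI impI ballI)
    fix f assume *: "\<forall>f\<in>Lp torus_measure (ennreal p). f \<in> closed_lin_span torus_measure (ennreal p) (weighted_exponential M) I"
      and f: "f \<in> borel_measurable torus" "p_integral torus p f < \<infinity>"
    have ff: "AE z in torus. f z = f z" by simp
    have "f \<in> Lp torus_measure (ennreal p)"
      using f borel_measurable_torus_measure[OF f(1)] p_integral_torus_measure_eq[OF f(1) ff]
      by (simp add: Lp_iff_p_integral[OF p0])
    with * show "span_approximates p M' I f"
      using closed_lin_span_weighted_exponential_iff[OF p assms(2) f(1) M ff] by blast
  next
    fix f assume *: "\<forall>f. f \<in> borel_measurable torus \<longrightarrow> p_integral torus p f < \<infinity> \<longrightarrow> span_approximates p M' I f"
      and f: "f \<in> Lp torus_measure (ennreal p)"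
    then have fm: "f \<in> borel_measurable torus_measure" and fp: "p_integral torus_measure p f < \<infinity>"
      by (auto simp: Lp_iff_p_integral[OF p0])
    obtain g where g: "g \<in> borel_measurable torus" "AE z in torus. f z = g z"
      by (rule torus_borel_representative[OF fm])
    have "p_integral torus p g < \<infinity>" using fp p_integral_torus_measure_eq[OF g] by simp
    with * g have "span_approximates p M' I g" by blast
    then show "f \<in> closed_lin_span torus_measure (ennreal p) (weighted_exponential M) I"
      using closed_lin_span_weighted_exponential_iff[OF p assms(2) g(1) M g(2) f] by blast
  qed
  finally show ?thesis .
qed

lemma minimal_system_weighted_exponential_iff:
  assumes p: "1 \<le> p" and MLp: "M \<in> Lp torus_measure (ennreal p)"
    and [measurable]: "M' \<in> borel_measurable torus" and M: "AE z in torus. M z = M' z"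
  shows "minimal_system torus_measure (ennreal p) (weighted_exponential M) I \<longleftrightarrow>
    (\<forall>i\<in>I. \<not> span_approximates p M' (I - {i}) (\<lambda>z. M' z * char i z))"
proof -
  have p0: "0 < p" using p by simp
  have we: "weighted_exponential M i = (\<lambda>z. M z * char i z)" for i
    by (simp add: fun_eq_iff weighted_exponential_eq)
  have [measurable]: "M \<in> borel_measurable torus_measure"
    using MLp by (simp add: Lp_iff_p_integral[OF p0])
  have "weighted_exponential M i \<in> Lp torus_measure (ennreal p)" for i
  proof -
    have [measurable]: "char i \<in> borel_measurable torus_measure"
      by (rule borel_measurable_torus_measure) measurable
    have "p_integral torus_measure p (\<lambda>z. M z * char i z) = p_integral torus_measure p M"
      by (simp add: p_integral_def norm_mult)
    then show ?thesis using MLp by (simp add: we Lp_iff_p_integral[OF p0])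
  qed
  moreover have "AE z in torus. weighted_exponential M i z = M' z * char i z" for i
    using M by eventually_elim (simp add: we)
  ultimately have "weighted_exponential M i \<in> closed_lin_span torus_measure (ennreal p) (weighted_exponential M) J
      \<longleftrightarrow> span_approximates p M' J (\<lambda>z. M' z * char i z)" for i J
    by (intro closed_lin_span_weighted_exponential_iff[OF p assms(3) _ M]) auto
  then show ?thesis by (simp add: minimal_system_def)
qed

lemma Upsilon_I:
  assumes P: "P \<in> borel_measurable borel" and one: "AE y in circle. cmod (P y) = 1"
  shows "P \<in> Upsilon"
proof -
  have [measurable]: "P \<in> borel_measurable circ_measure"
    using P by (intro measurable_restrict_space1 measurable_completion) simp
  have ae: "AE y in circ_measure. cmod (P y) = 1"
    using one by (simp add: AE_circ_measure_iff)
  have "esssup circ_measure (\<lambda>y. ennreal (cmod (P y))) \<le> 1"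
    by (rule esssup_I) (use ae in \<open>auto elim!: eventually_mono\<close>)
  moreover have "esssup circ_measure (\<lambda>y. 1 / ennreal (cmod (P y))) \<le> 1"
    by (rule esssup_I) (use ae in \<open>auto elim!: eventually_mono\<close>)
  ultimately show ?thesis
    by (auto simp: Upsilon_def Lp_def recip_in_Lp_def Lp_norm_def intro: le_less_trans)
qed

lemma recip_not_in_Lp_torus_if_strong_x_singularity:
  assumes "strong_x_singularity p M"
  shows "\<not> recip_in_Lp torus_measure (conj_exponent p) M"
proof -
  have "0 < emeasure lebesgue circ" by (simp add: circ_def ennreal_zero_less_top)
  then show ?thesis using assms by (auto simp: strong_x_singularity_def)
qed

theorem proposition3:
  fixes p :: real and M :: "real \<times> real \<Rightarrow> complex" and \<Omega> :: "(int \<times> int) set"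
  assumes "1 \<le> p"
    and "M \<in> Lp torus_measure (ennreal p)"
    and "\<Omega> = UNIV - {0} \<times> UNIV"
  shows "complete_system torus_measure (ennreal p) (weighted_exponential M) \<Omega> \<and>
         minimal_system torus_measure (ennreal p) (weighted_exponential M) \<Omega> \<longleftrightarrow>
         (\<exists>P\<in>Upsilon. (AE y in circ_measure. cmod (P y) = 1) \<and> strong_xP_singularity p P M)"
proof -
  note p = assms(1)
  have \<Omega>: "\<Omega> = off_axis" using assms(3) by (simp add: off_axis_def)
  have Mm: "M \<in> borel_measurable torus_measure" and Mp: "p_integral torus_measure p M < \<infinity>"
    using assms(1,2) by (simp_all add: Lp_iff_p_integral)
  obtain M' where M'm: "M' \<in> borel_measurable torus" and M': "AE z in torus. M z = M' z"
    by (rule torus_borel_representative[OF Mm])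
  have M'p: "p_integral torus p M' < \<infinity>"
    using Mp p_integral_torus_measure_eq[OF M'm M'] by simp
  interpret weight p M' by standard (use p M'm M'p in auto)
  have complete_iff: "complete_system torus_measure (ennreal p) (weighted_exponential M) \<Omega> \<longleftrightarrow>
      (\<forall>f. f \<in> borel_measurable torus \<longrightarrow> p_integral torus p f < \<infinity> \<longrightarrow> span_approximates p M' off_axis f)"
    unfolding \<Omega> by (rule complete_system_weighted_exponential_iff[OF p M'm M'])
  have minimal_iff: "minimal_system torus_measure (ennreal p) (weighted_exponential M) \<Omega> \<longleftrightarrow>
      (\<forall>i\<in>off_axis. \<not> span_approximates p M' (off_axis - {i}) (\<lambda>z. M' z * char i z))"
    unfolding \<Omega> by (rule minimal_system_weighted_exponential_iff[OF p assms(2) M'm M'])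
  show ?thesis
  proof (intro iffI; elim conjE bexE)
    assume compl: "complete_system torus_measure (ennreal p) (weighted_exponential M) \<Omega>"
      and min: "minimal_system torus_measure (ennreal p) (weighted_exponential M) \<Omega>"
    have M0: "AE z in torus. M' z \<noteq> 0"
      using compl[unfolded complete_iff] by (intro nonzero_if_span_dense) blast
    have sing: "strip_singular p M'"
      using compl[unfolded complete_iff] M'm M'p by (intro strip_singular_if_span_dense M0) blast
    interpret singular_weight p M' by standard (use M0 sing in auto)
    have "(1, 0) \<in> off_axis" by (simp add: off_axis_def)
    then have "\<not> span_approximates p M' (off_axis - {(1, 0)}) (\<lambda>z. M' z * char (1, 0) z)"
      using min[unfolded minimal_iff] by blast
    then obtain P where P: "P \<in> borel_measurable borel" "AE y in circle. cmod (P y) = 1"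
      "conj_integrable torus p (\<lambda>z. (cis (fst z) - P (snd z)) / M' z)"
      by (rule symbol_if_not_approximated)
    have Ups: "P \<in> Upsilon" by (rule Upsilon_I[OF P(1,2)])
    have Pm: "P \<in> borel_measurable circ_measure"
      using P(1) by (intro measurable_restrict_space1 measurable_completion) simp
    have strong: "strong_x_singularity p M"
      using sing strong_x_singularity_iff[OF p Mm M'm M' M0] by simp
    have "AE y in circle. P y = P y" by simp
    from xP_integral_iff[OF p Mm M'm M' Pm P(1) this] have "xP_singularity p P M"
      unfolding xP_singularity_def
      using Ups M0 P(3) recip_not_in_Lp_torus_if_strong_x_singularity[OF strong] by blast
    then have "strong_xP_singularity p P M" using strong by (simp add: strong_xP_singularity_def)
    then show "\<exists>P\<in>Upsilon. (AE y in circ_measure. cmod (P y) = 1) \<and> strong_xP_singularity p P M"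
      using Ups P(2) by (intro bexI[of _ P]) (auto simp: AE_circ_measure_iff)
  next
    fix P assume Ups: "P \<in> Upsilon" and one: "AE y in circ_measure. cmod (P y) = 1"
      and strong_xP: "strong_xP_singularity p P M"
    have Pm: "P \<in> borel_measurable circ_measure" using Ups by (simp add: Upsilon_def Lp_def)
    \<comment> \<open>A Borel representative that has modulus one everywhere.\<close>
    obtain P\<^sub>0 where P\<^sub>0: "P\<^sub>0 \<in> borel_measurable borel" "AE y in circ_measure. P y = P\<^sub>0 y"
      by (rule borel_representative[OF Pm]) auto
    define P' where "P' y = (if cmod (P\<^sub>0 y) = 1 then P\<^sub>0 y else 1)" for y
    have P'm: "P' \<in> borel_measurable borel" unfolding P'_def using P\<^sub>0(1) by measurable
    have P'1: "cmod (P' y) = 1" for y by (simp add: P'_def)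
    have PP': "AE y in circle. P y = P' y"
      using P\<^sub>0(2) one unfolding AE_circ_measure_iff by eventually_elim (simp add: P'_def)
    have M0: "AE z in torus. M' z \<noteq> 0"
      and conj: "conj_integrable torus p (\<lambda>z. (cis (fst z) - P' (snd z)) / M' z)"
      using strong_xP xP_integral_iff[OF p Mm M'm M' Pm P'm PP']
      unfolding strong_xP_singularity_def xP_singularity_def by blast+
    have "strip_singular p M'"
      using strong_xP strong_x_singularity_iff[OF p Mm M'm M' M0] by (simp add: strong_xP_singularity_def)
    then interpret singular_weight p M' by unfold_locales (use M0 in auto)
    have "span_approximates p M' off_axis f"
      if "f \<in> borel_measurable torus" "p_integral torus p f < \<infinity>" for f
      unfolding span_approximates_def
    proof (intro allI impI)
      fix e :: real assume "0 < e"
      from off_axis_complete[OF that this]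
      show "\<exists>S\<in>lin_span char off_axis. p_integral torus p (\<lambda>z. f z - M' z * S z) < ennreal e"
        by blast
    qed
    then have "complete_system torus_measure (ennreal p) (weighted_exponential M) \<Omega>"
      unfolding complete_iff by blast
    moreover have "minimal_system torus_measure (ennreal p) (weighted_exponential M) \<Omega>"
      unfolding minimal_iff
      using span_does_not_approximate_own_exponential[OF M0 P'm P'1 conj] by blast
    ultimately show "complete_system torus_measure (ennreal p) (weighted_exponential M) \<Omega> \<and>
         minimal_system torus_measure (ennreal p) (weighted_exponential M) \<Omega>" ..
  qed
qed

end
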